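(* Let $r,s\ge1$ be integers, and set $d=2s-2$ and $n=r+d$. Then the polytopal complex $\mathcal C(r,s)$ is isomorphic to the polytopal subcomplex of the polar-to-cyclic polytope $C_d(n)^\Delta$ induced on the vertices dual to lower facets of $C_d(n)$, whose faces are of dimension at most $d/2$. Moreover, the $1$-skeleton of each of these complexes is the composition graph $C(r,s)$.
   Context: Staircase triangulation: a lattice path in the grid $[r]\times[s]$ is a connected chain of horizontal and vertical unit segments joining $(1,1)$ to $(r,s)$, weakly monotone in both coordinates; it is identified with its set of $r+s-1$ vertices. Partial lattice paths are subsets of lattice paths. Identifying $(i,j)$ with the vertex $(e_i,e_j)$ of $\Delta^{r-1}\times\Delta^{s-1}\subset\mathbb R^r\times\mathbb R^s$, the partial lattice paths index the simplices of a triangulation $\Sigma(r,s)$ of $\Delta^{r-1}\times\Delta^{s-1}$, the staircase triangulation. $\mathcal C(r,s)$ is the $(s-1)$-dimensional polytopal complex obtained by intersecting the simplices of $\Sigma(r,s)$ with the plane $\{(\frac1r,\dots,\frac1r)\}\times\mathbb R^s$ (whose intersection with $\Delta^{r-1}\times\Delta^{s-1}$ is $(s-1)$-dimensional); its cells are the non-empty intersections. Cyclic polytopes: $C_d(n)$ is the convex hull of $n$ distinct points $\mu(t_1),\dots,\mu(t_n)$, $t_1<\dots<t_n$, on the moment curve $\mu(t)=(t,t^2,\dots,t^d)$; faces are identified with their index sets in $[n]$. A facet indexed by $I\subset[n]$ is a lower facet if the end-set of $I$ (the last block of contiguous elements of $I$) has even cardinality; equivalently, the last coordinate of its outer normal is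 negative. $C_d(n)^\Delta$ denotes the polar (dual) polytope; each vertex of it is dual to a facet of $C_d(n)$, and the subcomplex induced on a set of vertices consists of all faces all of whose vertices lie in the set. Composition graph $C(r,s)$: its vertices are the weak compositions of $r$ into $s$ parts, i.e. ordered tuples $(a_1,\dots,a_s)$ of non-negative integers with sum $r$; two are adjacent if they differ by one in exactly two positions that are connected by a (possibly empty) sequence of $0$'s, i.e. all entries strictly between these positions are $0$. Isomorphism of polytopal complexes means isomorphism of face posets. *)

theory Defs
  imports "HOL-Analysis.Analysis"
begin

section \<open>Complexes and graphs\<close>

text \<open>A polytopal complex is represented by the set of its non-empty cells, so its face poset
  is that set ordered by inclusion.\<close>

definition complex_iso :: "'a set set \<Rightarrow> 'b set set \<Rightarrow> bool" where
  "complex_iso K L \<longleftrightarrow>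
     (\<exists>\<phi>. bij_betw \<phi> K L \<and> (\<forall>A\<in>K. \<forall>B\<in>K. A \<subseteq> B \<longleftrightarrow> \<phi> A \<subseteq> \<phi> B))"

text \<open>A graph is a pair of its vertex set and its set of (two-element) edges.\<close>

type_synonym 'v graph = "'v set \<times> 'v set set"

definition graph_iso :: "'v graph \<Rightarrow> 'w graph \<Rightarrow> bool" where
  "graph_iso G H \<longleftrightarrow>
     (\<exists>f. bij_betw f (fst G) (fst H) \<and> (\<lambda>e. f ` e) ` snd G = snd H)"

text \<open>The one-dimensional polytopes are the non-degenerate segments, each being spanned by
  its two vertices.\<close>

definition one_skeleton :: "'a::euclidean_space set set \<Rightarrow> 'a graph" where
  "one_skeleton K =
     ({v. {v} \<in> K}, {{v, w} | v w. v \<noteq> w \<and> closed_segment v w \<in> K})"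

definition weak_compositions :: "nat \<Rightarrow> nat \<Rightarrow> nat list set" where
  "weak_compositions r s = {a. length a = s \<and> sum_list a = r}"

definition composition_adjacent :: "nat list \<Rightarrow> nat list \<Rightarrow> bool" where
  "composition_adjacent a b \<longleftrightarrow>
     (\<exists>j k. j < k \<and> k < length a \<and>
        (a ! j = b ! j + 1 \<or> b ! j = a ! j + 1) \<and>
        (a ! k = b ! k + 1 \<or> b ! k = a ! k + 1) \<and>
        (\<forall>i < length a. i \<noteq> j \<longrightarrow> i \<noteq> k \<longrightarrow> a ! i = b ! i) \<and>
        (\<forall>i. j < i \<and> i < k \<longrightarrow> a ! i = 0))"

definition composition_graph :: "nat \<Rightarrow> nat \<Rightarrow> nat list graph" where
  "composition_graph r s =
     (weak_compositions r s,
      {{a, b} | a b. a \<in> weak_compositions r s \<and> b \<in> weak_compositions r s \<and>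
                     composition_adjacent a b})"


section \<open>The staircase triangulation and its section\<close>

definition unit_step :: "nat \<times> nat \<Rightarrow> nat \<times> nat \<Rightarrow> bool" where
  "unit_step p q \<longleftrightarrow> q = (fst p + 1, snd p) \<or> q = (fst p, snd p + 1)"

definition lattice_paths :: "nat \<Rightarrow> nat \<Rightarrow> (nat \<times> nat) set set" where
  "lattice_paths r s =
     {set p | p. p \<noteq> [] \<and> hd p = (1, 1) \<and> last p = (r, s) \<and> successively unit_step p}"

definition partial_lattice_paths :: "nat \<Rightarrow> nat \<Rightarrow> (nat \<times> nat) set set" where
  "partial_lattice_paths r s = {\<sigma>. \<exists>\<pi>\<in>lattice_paths r s. \<sigma> \<subseteq> \<pi>}"

text \<open>Below, \<open>e\<close> and \<open>f\<close> enumerate the standard bases of the two factors: \<open>e 1, \<dots>, e r\<close> and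
  \<open>f 1, \<dots>, f s\<close>. The empty partial path contributes the empty simplex.\<close>

definition staircase_triangulation ::
  "(nat \<Rightarrow> 'a::euclidean_space) \<Rightarrow> (nat \<Rightarrow> 'b::euclidean_space) \<Rightarrow> nat \<Rightarrow> nat
     \<Rightarrow> ('a \<times> 'b) set set" where
  "staircase_triangulation e f r s =
     {convex hull ((\<lambda>(i, j). (e i, f j)) ` \<sigma>) | \<sigma>. \<sigma> \<in> partial_lattice_paths r s}"

definition barycentre_plane :: "(nat \<Rightarrow> 'a::euclidean_space) \<Rightarrow> nat \<Rightarrow> ('a \<times> 'b) set" where
  "barycentre_plane e r = {\<Sum>i=1..r. (1 / real r) *\<^sub>R e i} \<times> UNIV"

definition staircase_complex ::
  "(nat \<Rightarrow> 'a::euclidean_space) \<Rightarrow> (nat \<Rightarrow> 'b::euclidean_space) \<Rightarrow> nat \<Rightarrow> nat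
     \<Rightarrow> ('a \<times> 'b) set set" where
  "staircase_complex e f r s =
     {S \<inter> barycentre_plane e r | S.
        S \<in> staircase_triangulation e f r s \<and> S \<inter> barycentre_plane e r \<noteq> {}}"


section \<open>Cyclic polytopes and their polars\<close>

text \<open>Since the dimension \<open>d\<close> may be \<open>0\<close>, whereas every type of class \<open>euclidean_space\<close> has
  positive dimension, \<open>d\<close>-dimensional space is realised as the coordinate subspace spanned by
  distinct standard basis vectors \<open>b 1, \<dots>, b d\<close> of some Euclidean space.\<close>

definition moment_curve :: "(nat \<Rightarrow> 'a::euclidean_space) \<Rightarrow> nat \<Rightarrow> real \<Rightarrow> 'a" where
  "moment_curve b d t = (\<Sum>k=1..d. t ^ k *\<^sub>R b k)"

definition cyclic_polytope ::
  "(nat \<Rightarrow> 'a::euclidean_space) \<Rightarrow> nat \<Rightarrow> nat \<Rightarrow> (nat \<Rightarrow> real) \<Rightarrow> 'a set" where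
  "cyclic_polytope b d n t = convex hull ((\<lambda>i. moment_curve b d (t i)) ` {1..n})"

text \<open>Unlike \<open>facet_of\<close>, this admits the empty set as the facet of a single point, which is
  the case \<open>d = 0\<close>.\<close>

definition polytope_facet :: "'a::euclidean_space set \<Rightarrow> 'a set \<Rightarrow> bool" where
  "polytope_facet F P \<longleftrightarrow> F face_of P \<and> aff_dim F = aff_dim P - 1"

definition end_set :: "nat set \<Rightarrow> nat set" where
  "end_set I = {i \<in> I. {i..Max I} \<subseteq> I}"

definition lower_facet ::
  "(nat \<Rightarrow> 'a::euclidean_space) \<Rightarrow> nat \<Rightarrow> nat \<Rightarrow> (nat \<Rightarrow> real) \<Rightarrow> 'a set \<Rightarrow> bool" where
  "lower_facet b d n t F \<longleftrightarrow>
     polytope_facet F (cyclic_polytope b d n t) \<and>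
     even (card (end_set {i \<in> {1..n}. moment_curve b d (t i) \<in> F}))"

text \<open>The polar of \<open>P\<close> within the linear subspace \<open>V\<close>, after moving the point \<open>p\<close> in the
  relative interior of \<open>P\<close> to the origin. A vertex \<open>y\<close> of it is dual to the facet of \<open>P\<close> on
  which the inequality given by \<open>y\<close> is tight.\<close>

definition polar_polytope :: "'a::euclidean_space set \<Rightarrow> 'a set \<Rightarrow> 'a \<Rightarrow> 'a set" where
  "polar_polytope V P p = {y \<in> V. \<forall>x\<in>P. (x - p) \<bullet> y \<le> 1}"

definition dual_facet :: "'a::euclidean_space set \<Rightarrow> 'a \<Rightarrow> 'a \<Rightarrow> 'a set" where
  "dual_facet P p y = {x \<in> P. (x - p) \<bullet> y = 1}"

definition induced_subcomplex :: "'a::euclidean_space set \<Rightarrow> 'a set \<Rightarrow> 'a set set" where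
  "induced_subcomplex Q W =
     {G. G face_of Q \<and> G \<noteq> {} \<and> {y. y extreme_point_of G} \<subseteq> W}"

definition polar_cyclic_polytope ::
  "(nat \<Rightarrow> 'a::euclidean_space) \<Rightarrow> nat \<Rightarrow> nat \<Rightarrow> (nat \<Rightarrow> real) \<Rightarrow> 'a \<Rightarrow> 'a set" where
  "polar_cyclic_polytope b d n t p =
     polar_polytope (span (b ` {1..d})) (cyclic_polytope b d n t) p"

definition lower_vertices ::
  "(nat \<Rightarrow> 'a::euclidean_space) \<Rightarrow> nat \<Rightarrow> nat \<Rightarrow> (nat \<Rightarrow> real) \<Rightarrow> 'a \<Rightarrow> 'a set" where
  "lower_vertices b d n t p =
     {y. y extreme_point_of polar_cyclic_polytope b d n t p \<and>
         lower_facet b d n t (dual_facet (cyclic_polytope b d n t) p y)}"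

definition lower_complex ::
  "(nat \<Rightarrow> 'a::euclidean_space) \<Rightarrow> nat \<Rightarrow> nat \<Rightarrow> (nat \<Rightarrow> real) \<Rightarrow> 'a \<Rightarrow> 'a set set" where
  "lower_complex b d n t p =
     induced_subcomplex (polar_cyclic_polytope b d n t p) (lower_vertices b d n t p)"

end

(* A point of a cell of the staircase section has unique barycentric coordinates (north-west corner
   rule), so the cells correspond to the chains in [r] x [s] that meet every row. Dually, a point of
   the polar of the cyclic polytope is a polynomial of degree at most d that is non-negative at the
   nodes, and faces are given by sets of nodes at which it vanishes; the complement of such a set is
   a union of gaps of facets. The map (i, j) |-> i + 2 (j - 1) carries chains that meet every row to
   the subsets of [n] containing gap sets of lower facets but none of upper facets, which identifies
   the two face posets. The 1-skeleton depends only on the face poset, since a polytope is a segment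
   iff it has exactly two vertices, and for chains the edges are read off directly. *)
theory Submission
  imports Defs
begin

section \<open>Graphs of polytopal complexes\<close>

text \<open>The position map is dictated by Gale's evenness condition. As d is even, d elements of
  [n] span a facet exactly when the parities of the r omitted elements alternate; the facet is lower
  if the smallest omitted element is odd and upper if it is even. Doubling the column gives a
  position the parity of its row, and the corners (1, 1) and (r, s) get the positions 1 and n. One
  point from each row of a chain therefore yields the gap set of a lower facet. Conversely, r
  alternating positions of a chain must occupy the rows 1, ..., r in this order, so they start with
  an odd number and never form an upper gap set. The obstacle is the way back: a position does not
  determine a grid point, as (3, 1) and (1, 2) share the position 3, so a chain must be rebuilt from
  its whole set of positions. The row of a position x turns out to be the number of elements up to x
  in the lower gap set of least sum.\<close>

definition minimal_cells :: "'a set set \<Rightarrow> 'a set set" where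
  "minimal_cells P = {a \<in> P. \<forall>c\<in>P. c \<subseteq> a \<longrightarrow> c = a}"

text \<open>An edge is recognised by having exactly two minimal cells below it, not by its
  dimension, so the graph depends on the order alone.\<close>

definition cell_graph :: "'a set set \<Rightarrow> 'a set graph" where
  "cell_graph P =
     (minimal_cells P,
      {{a, b} | a b. a \<noteq> b \<and> (\<exists>c\<in>P. {m \<in> minimal_cells P. m \<subseteq> c} = {a, b})})"

text \<open>\<open>inv_into\<close> undoes \<open>f\<close> only on the vertex set; the second
  hypothesis makes it undo \<open>f\<close> on edges too.\<close>

lemma graph_iso_sym:
  assumes "graph_iso G H" and "\<Union>(snd G) \<subseteq> fst G"
  shows "graph_iso H G"
proof -
  obtain f where f: "bij_betw f (fst G) (fst H)" "(\<lambda>e. f ` e) ` snd G = snd H"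
    using assms(1) unfolding graph_iso_def by blast
  let ?g = "inv_into (fst G) f"
  have "?g ` f ` e = e" if "e \<in> snd G" for e
  proof -
    have "e \<subseteq> fst G" using that assms(2) by blast
    then show ?thesis using f(1) inv_into_image_cancel[of f "fst G" e] by (simp add: bij_betw_def)
  qed
  then have "(\<lambda>e. ?g ` e) ` snd H = snd G"
    unfolding f(2)[symmetric] image_image by simp
  then show ?thesis
    using bij_betw_inv_into[OF f(1)] unfolding graph_iso_def by blast
qed

lemma graph_iso_trans:
  assumes "graph_iso G H" and "graph_iso H K"
  shows "graph_iso G K"
proof -
  obtain f where f: "bij_betw f (fst G) (fst H)" "(\<lambda>e. f ` e) ` snd G = snd H"
    using assms(1) unfolding graph_iso_def by blast
  obtain g where g: "bij_betw g (fst H) (fst K)" "(\<lambda>e. g ` e) ` snd H = snd K"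
    using assms(2) unfolding graph_iso_def by blast
  have "(\<lambda>e. (g \<circ> f) ` e) ` snd G = snd K"
    unfolding g(2)[symmetric] f(2)[symmetric] image_image image_comp by simp
  then show ?thesis
    using bij_betw_trans[OF f(1) g(1)] unfolding graph_iso_def by blast
qed

lemma complex_iso_sym:
  assumes "complex_iso K L"
  shows "complex_iso L K"
proof -
  obtain \<phi> where \<phi>: "bij_betw \<phi> K L" "\<forall>A\<in>K. \<forall>B\<in>K. A \<subseteq> B \<longleftrightarrow> \<phi> A \<subseteq> \<phi> B"
    using assms unfolding complex_iso_def by blast
  let ?g = "inv_into K \<phi>"
  have g: "bij_betw ?g L K" by (rule bij_betw_inv_into[OF \<phi>(1)])
  have "A \<subseteq> B \<longleftrightarrow> ?g A \<subseteq> ?g B" if "A \<in> L" "B \<in> L" for A B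
    using that \<phi>(2) bij_betw_apply[OF g] bij_betw_inv_into_right[OF \<phi>(1)] by metis
  then show ?thesis using g unfolding complex_iso_def by blast
qed

lemma complex_iso_trans:
  assumes "complex_iso K L" and "complex_iso L M"
  shows "complex_iso K M"
proof -
  obtain \<phi> where \<phi>: "bij_betw \<phi> K L" "\<forall>A\<in>K. \<forall>B\<in>K. A \<subseteq> B \<longleftrightarrow> \<phi> A \<subseteq> \<phi> B"
    using assms(1) unfolding complex_iso_def by blast
  obtain \<psi> where \<psi>: "bij_betw \<psi> L M" "\<forall>A\<in>L. \<forall>B\<in>L. A \<subseteq> B \<longleftrightarrow> \<psi> A \<subseteq> \<psi> B"
    using assms(2) unfolding complex_iso_def by blast
  have "\<forall>A\<in>K. \<forall>B\<in>K. A \<subseteq> B \<longleftrightarrow> (\<psi> \<circ> \<phi>) A \<subseteq> (\<psi> \<circ> \<phi>) B"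
    using \<phi> \<psi>(2) bij_betw_apply[OF \<phi>(1)] by simp
  then show ?thesis
    using bij_betw_trans[OF \<phi>(1) \<psi>(1)] unfolding complex_iso_def by blast
qed

text \<open>A polytope is a segment iff it has exactly two vertices, so the graph can be read off the
  face poset.\<close>

lemma graph_iso_one_skeleton:
  fixes K :: "'a::euclidean_space set set"
  assumes iso: "complex_iso P K"
    and cell: "\<And>G. G \<in> K \<Longrightarrow> compact G \<and> convex G \<and> G \<noteq> {}"
    and ext: "\<And>G x. G \<in> K \<Longrightarrow> x extreme_point_of G \<longleftrightarrow> x \<in> G \<and> {x} \<in> K"
  shows "graph_iso (one_skeleton K) (cell_graph P)"
proof -
  obtain \<phi> where \<phi>: "bij_betw \<phi> P K" and ord: "\<forall>A\<in>P. \<forall>B\<in>P. A \<subseteq> B \<longleftrightarrow> \<phi> A \<subseteq> \<phi> B"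
    using iso unfolding complex_iso_def by blast
  have \<phi>K: "\<phi> a \<in> K" if "a \<in> P" for a using bij_betw_apply[OF \<phi> that] .
  have surj: "\<exists>a\<in>P. \<phi> a = G" if "G \<in> K" for G using \<phi> that by (auto simp: bij_betw_def)
  have inj: "a = b" if "a \<in> P" "b \<in> P" "\<phi> a = \<phi> b" for a b
    using \<phi> that by (auto simp: bij_betw_def dest: inj_onD)
  \<comment> \<open>An extreme point of a cell is itself a cell by \<open>ext\<close>, so a minimal
    cell must be a singleton.\<close>
  have min_iff: "a \<in> minimal_cells P \<longleftrightarrow> (\<exists>v. \<phi> a = {v})" if a: "a \<in> P" for a
  proof
    assume min: "a \<in> minimal_cells P"
    obtain v where v: "v extreme_point_of \<phi> a"
      using extreme_point_exists_convex cell[OF \<phi>K[OF a]] by metis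
    then have vK: "v \<in> \<phi> a" "{v} \<in> K" using ext[OF \<phi>K[OF a]] by auto
    obtain c where c: "c \<in> P" "\<phi> c = {v}" using surj[OF vK(2)] by auto
    have "c \<subseteq> a" using ord c a vK(1) by simp
    then have "c = a" using min c(1) unfolding minimal_cells_def by blast
    then show "\<exists>v. \<phi> a = {v}" using c by auto
  next
    assume "\<exists>v. \<phi> a = {v}"
    then obtain v where v: "\<phi> a = {v}" by auto
    have "c = a" if c: "c \<in> P" "c \<subseteq> a" for c
    proof -
      have "\<phi> c \<subseteq> {v}" using ord c a v by metis
      then have "\<phi> c = {v}" using cell[OF \<phi>K[OF c(1)]] by auto
      then show ?thesis using inj c a v by simp
    qed
    then show "a \<in> minimal_cells P" using a by (auto simp: minimal_cells_def)
  qed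
  define h where "h a = the_elem (\<phi> a)" for a
  have h: "\<phi> a = {h a}" if "a \<in> minimal_cells P" for a
    using that min_iff[of a] by (auto simp: h_def minimal_cells_def)
  have minP: "a \<in> P" if "a \<in> minimal_cells P" for a using that by (simp add: minimal_cells_def)
  have bij: "bij_betw h (minimal_cells P) {v. {v} \<in> K}"
  proof (rule bij_betw_imageI)
    show "inj_on h (minimal_cells P)"
      by (rule inj_onI) (metis h inj minP)
    show "h ` minimal_cells P = {v. {v} \<in> K}"
    proof (rule set_eqI, rule iffI)
      fix v assume "v \<in> h ` minimal_cells P"
      then show "v \<in> {v. {v} \<in> K}" using h minP \<phi>K by force
    next
      fix v assume "v \<in> {v. {v} \<in> K}"
      then obtain a where a: "a \<in> P" "\<phi> a = {v}" using surj by blast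
      then have "a \<in> minimal_cells P" using min_iff by blast
      then show "v \<in> h ` minimal_cells P" using h[of a] a by auto
    qed
  qed
  have extr: "{x. x extreme_point_of \<phi> c} = h ` {m \<in> minimal_cells P. m \<subseteq> c}" if c: "c \<in> P" for c
  proof -
    have "{x. x extreme_point_of \<phi> c} = {x \<in> \<phi> c. {x} \<in> K}" using ext[OF \<phi>K[OF c]] by auto
    also have "\<dots> = {x \<in> h ` minimal_cells P. x \<in> \<phi> c}" using bij by (auto simp: bij_betw_def)
    also have "\<dots> = h ` {m \<in> minimal_cells P. h m \<in> \<phi> c}" by auto
    also have "{m \<in> minimal_cells P. h m \<in> \<phi> c} = {m \<in> minimal_cells P. m \<subseteq> c}"
    proof -
      have "h m \<in> \<phi> c \<longleftrightarrow> m \<subseteq> c" if "m \<in> minimal_cells P" for m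
        using ord c minP[OF that] h[OF that] by simp
      then show ?thesis by blast
    qed
    finally show ?thesis .
  qed
  have edges: "(\<lambda>e. h ` e) ` snd (cell_graph P) = snd (one_skeleton K)"
  proof (rule set_eqI, rule iffI)
    fix E assume "E \<in> (\<lambda>e. h ` e) ` snd (cell_graph P)"
    then obtain a b c where ab: "a \<noteq> b" "c \<in> P" "{m \<in> minimal_cells P. m \<subseteq> c} = {a, b}" "E = {h a, h b}"
      by (auto simp: cell_graph_def)
    then have m: "a \<in> minimal_cells P" "b \<in> minimal_cells P" by auto
    have "h a \<noteq> h b" using bij ab(1) m by (auto simp: bij_betw_def dest: inj_onD)
    moreover have "\<phi> c = closed_segment (h a) (h b)"
    proof -
      \<comment> \<open>By Krein-Milman a cell is the hull of its extreme points, and two extreme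
        points span a segment.\<close>
      have "\<phi> c = convex hull {x. x extreme_point_of \<phi> c}"
        using Krein_Milman_Minkowski cell[OF \<phi>K[OF ab(2)]] by blast
      then show ?thesis unfolding extr[OF ab(2)] ab(3) by (simp add: segment_convex_hull)
    qed
    ultimately show "E \<in> snd (one_skeleton K)"
      using ab(4) \<phi>K[OF ab(2)] by (auto simp: one_skeleton_def)
  next
    fix E assume "E \<in> snd (one_skeleton K)"
    then obtain v w where vw: "v \<noteq> w" "closed_segment v w \<in> K" "E = {v, w}"
      by (auto simp: one_skeleton_def)
    obtain c where c: "c \<in> P" "\<phi> c = closed_segment v w" using surj[OF vw(2)] by auto
    have "h ` {m \<in> minimal_cells P. m \<subseteq> c} = {v, w}"
      unfolding extr[OF c(1), symmetric] c(2) by (auto simp: extreme_point_of_segment)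
    then obtain a b where "a \<in> {m \<in> minimal_cells P. m \<subseteq> c}" "b \<in> {m \<in> minimal_cells P. m \<subseteq> c}"
      and hv: "h a = v" "h b = w"
      by (smt (verit) imageE insertI1 insert_commute)
    moreover have "m = a \<or> m = b" if "m \<in> minimal_cells P" "m \<subseteq> c" for m
    proof -
      have "h m \<in> {v, w}" using \<open>h ` {m \<in> minimal_cells P. m \<subseteq> c} = {v, w}\<close> that by auto
      then have "h m = h a \<or> h m = h b" using hv by auto
      then show ?thesis
        using bij_betw_imp_inj_on[OF bij, THEN inj_onD] that calculation by auto
    qed
    ultimately have "{m \<in> minimal_cells P. m \<subseteq> c} = {a, b}" by auto
    moreover have "a \<noteq> b" using hv vw(1) by auto
    ultimately have "{a, b} \<in> snd (cell_graph P)" using c(1) by (auto simp: cell_graph_def)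
    then show "E \<in> (\<lambda>e. h ` e) ` snd (cell_graph P)"
      using hv vw(3) by (auto intro!: image_eqI[where x = "{a, b}"])
  qed
  have "graph_iso (cell_graph P) (one_skeleton K)"
    using bij edges unfolding graph_iso_def by (auto simp: cell_graph_def one_skeleton_def)
  then show ?thesis
    by (rule graph_iso_sym) (auto simp: cell_graph_def)
qed

section \<open>Chains in a grid\<close>

text \<open>Two points of the same row are always comparable, so the condition on different rows
  says that any two points are comparable in the product order.\<close>

definition grid_chain :: "nat \<Rightarrow> nat \<Rightarrow> (nat \<times> nat) set \<Rightarrow> bool" where
  "grid_chain r s \<sigma> \<longleftrightarrow>
     \<sigma> \<subseteq> {1..r} \<times> {1..s} \<and> (\<forall>x\<in>\<sigma>. \<forall>y\<in>\<sigma>. fst x < fst y \<longrightarrow> snd x \<le> snd y)"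

definition staircases :: "nat \<Rightarrow> nat \<Rightarrow> (nat \<times> nat) set set" where
  "staircases r s = {\<sigma>. grid_chain r s \<sigma> \<and> {1..r} \<subseteq> fst ` \<sigma>}"

lemma grid_chain_subset: "grid_chain r s \<tau> \<Longrightarrow> \<sigma> \<subseteq> \<tau> \<Longrightarrow> grid_chain r s \<sigma>"
  unfolding grid_chain_def by blast

lemma grid_chain_finite: "grid_chain r s \<sigma> \<Longrightarrow> finite \<sigma>"
  unfolding grid_chain_def using finite_subset by blast

text \<open>The coordinate sum is injective on a chain and takes values between 2 and
  \<open>r + s\<close>. This count is the source of the dimension bound d/2.\<close>

lemma grid_chain_card:
  assumes "grid_chain r s \<sigma>" "r \<ge> 1" "s \<ge> 1"
  shows "card \<sigma> \<le> r + s - 1"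
proof -
  have "inj_on (\<lambda>x. fst x + snd x) \<sigma>"
  proof (rule inj_onI)
    fix x y assume xy: "x \<in> \<sigma>" "y \<in> \<sigma>" "fst x + snd x = fst y + snd y"
    then have "fst x < fst y \<longrightarrow> snd x \<le> snd y" "fst y < fst x \<longrightarrow> snd y \<le> snd x"
      using assms(1) unfolding grid_chain_def by blast+
    then show "x = y" using xy(3) by (intro prod_eqI) linarith+
  qed
  moreover have "(\<lambda>x. fst x + snd x) ` \<sigma> \<subseteq> {2..r + s}"
  proof -
    have "fst x + snd x \<in> {2..r + s}" if "x \<in> \<sigma>" for x
    proof -
      have "x \<in> {1..r} \<times> {1..s}" using assms(1) that unfolding grid_chain_def by blast
      then show ?thesis by (auto simp: mem_Times_iff)
    qed
    then show ?thesis by blast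
  qed
  ultimately have "card \<sigma> \<le> card {2..r + s}" by (rule card_inj_on_le) simp
  then show ?thesis using assms by simp
qed

lemma staircases_row:
  assumes "\<sigma> \<in> staircases r s" "i \<in> {1..r}"
  obtains j where "(i, j) \<in> \<sigma>"
proof -
  have "i \<in> fst ` \<sigma>" using assms unfolding staircases_def by blast
  then show thesis using that by auto
qed

section \<open>Partial lattice paths are the chains of the grid\<close>

definition staircase_path :: "nat \<Rightarrow> nat \<Rightarrow> (nat \<times> nat) list \<Rightarrow> bool" where
  "staircase_path r s p \<longleftrightarrow>
     p \<noteq> [] \<and> hd p = (1, 1) \<and> last p = (r, s) \<and> successively unit_step p"

lemma staircase_path_snoc:
  assumes "staircase_path r s p" "unit_step (r, s) (r', s')"
  shows "staircase_path r' s' (p @ [(r', s')])"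
  using assms unfolding staircase_path_def by (auto simp: successively_append_iff)

lemma grid_chain_path:
  assumes "staircase_path r s p"
  shows "grid_chain r s (set p)"
proof -
  let ?le = "\<lambda>x y :: nat \<times> nat. fst x \<le> fst y \<and> snd x \<le> snd y"
  have "successively ?le p"
    by (rule successively_mono[of unit_step])
      (use assms in \<open>auto simp: staircase_path_def unit_step_def\<close>)
  then have s: "sorted_wrt ?le p"
    by (subst (asm) successively_conv_sorted_wrt) (auto simp: transp_def)
  have hd: "?le (hd p) x" if "x \<in> set p" for x
    using s that by (cases p) auto
  have last: "?le x (last p)" if "x \<in> set p" for x
    using s that by (cases p rule: rev_cases) (auto simp: sorted_wrt_append)
  have "?le x y \<or> ?le y x" if "x \<in> set p" "y \<in> set p" for x y
  proof -
    obtain i j where "i < length p" "x = p ! i" "j < length p" "y = p ! j"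
      using \<open>x \<in> set p\<close> \<open>y \<in> set p\<close> by (metis in_set_conv_nth)
    then show ?thesis
      using sorted_wrt_nth_less[OF s, of i j] sorted_wrt_nth_less[OF s, of j i]
      by (cases i j rule: linorder_cases) auto
  qed
  then have "\<forall>x\<in>set p. \<forall>y\<in>set p. fst x < fst y \<longrightarrow> snd x \<le> snd y"
    by (meson not_le)
  moreover have "set p \<subseteq> {1..r} \<times> {1..s}"
  proof
    fix x assume "x \<in> set p"
    then show "x \<in> {1..r} \<times> {1..s}"
      using hd[of x] last[of x] assms by (simp add: staircase_path_def mem_Times_iff)
  qed
  ultimately show ?thesis unfolding grid_chain_def by blast
qed

text \<open>Without the corner \<open>(r, s)\<close>, the chain misses the last row or the last
  column: a point of the last row and one of the last column, neither being the corner, are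
  incomparable. What is left lies in a smaller grid, whose path is prolonged by the corner.\<close>

lemma grid_chain_extends_to_path:
  assumes "grid_chain r s \<sigma>" "r \<ge> 1" "s \<ge> 1"
  shows "\<exists>p. staircase_path r s p \<and> \<sigma> \<subseteq> set p"
  using assms
proof (induction "r + s" arbitrary: r s \<sigma>)
  case 0
  then show ?case by simp
next
  case (Suc m)
  define \<sigma>' where "\<sigma>' = \<sigma> - {(r, s)}"
  have sub: "\<sigma>' \<subseteq> {1..r} \<times> {1..s}"
    and ch: "\<And>x y. x \<in> \<sigma>' \<Longrightarrow> y \<in> \<sigma>' \<Longrightarrow> fst x < fst y \<Longrightarrow> snd x \<le> snd y"
    using Suc.prems(1) unfolding grid_chain_def \<sigma>'_def by blast+
  have corner: "fst x \<noteq> r \<or> snd x \<noteq> s" if "x \<in> \<sigma>'" for x using that by (auto simp: \<sigma>'_def)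
  have box: "1 \<le> fst x \<and> fst x \<le> r \<and> 1 \<le> snd x \<and> snd x \<le> s" if "x \<in> \<sigma>'" for x
    using sub that by auto
  consider "r = 1" "s = 1" | "r > 1" "\<forall>x\<in>\<sigma>'. fst x < r" | "s > 1" "\<forall>x\<in>\<sigma>'. snd x < s"
  proof -
    have "(\<forall>x\<in>\<sigma>'. fst x < r) \<or> (\<forall>x\<in>\<sigma>'. snd x < s)"
    proof (rule ccontr)
      assume "\<not> ?thesis"
      then obtain x y where xy: "x \<in> \<sigma>'" "fst x \<ge> r" "y \<in> \<sigma>'" "snd y \<ge> s" by (meson not_le)
      then show False using box[of x] box[of y] corner[of x] corner[of y] ch[OF xy(3,1)] by linarith
    qed
    moreover have "\<forall>x\<in>\<sigma>'. snd x < s" if "r = 1"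
    proof
      fix x assume "x \<in> \<sigma>'"
      then show "snd x < s" using that box[of x] corner[of x] by linarith
    qed
    moreover have "\<forall>x\<in>\<sigma>'. fst x < r" if "s = 1"
    proof
      fix x assume "x \<in> \<sigma>'"
      then show "fst x < r" using that box[of x] corner[of x] by linarith
    qed
    ultimately show thesis using that Suc.prems(2,3) by (metis le_neq_implies_less)
  qed
  then show ?case
  proof cases
    case 1
    then have "staircase_path r s [(1, 1)]" "\<sigma> \<subseteq> set [(1, 1)]"
      using Suc.prems(1) by (auto simp: staircase_path_def grid_chain_def)
    then show ?thesis by blast
  next
    case 2
    have "grid_chain (r - 1) s \<sigma>'"
    proof -
      have "x \<in> {1..r - 1} \<times> {1..s}" if "x \<in> \<sigma>'" for x
        using 2 box[OF that] that by (auto simp: mem_Times_iff)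
      then show ?thesis using ch unfolding grid_chain_def by blast
    qed
    then obtain p where "staircase_path (r - 1) s p" "\<sigma>' \<subseteq> set p"
      using Suc.hyps(1)[of "r - 1" s \<sigma>'] Suc.hyps(2) 2 Suc.prems by fastforce
    then have "staircase_path r s (p @ [(r, s)])" "\<sigma> \<subseteq> set (p @ [(r, s)])"
      using 2 by (auto intro!: staircase_path_snoc simp: unit_step_def \<sigma>'_def)
    then show ?thesis by blast
  next
    case 3
    have "grid_chain r (s - 1) \<sigma>'"
    proof -
      have "x \<in> {1..r} \<times> {1..s - 1}" if "x \<in> \<sigma>'" for x
        using 3 box[OF that] that by (auto simp: mem_Times_iff)
      then show ?thesis using ch unfolding grid_chain_def by blast
    qed
    then obtain p where "staircase_path r (s - 1) p" "\<sigma>' \<subseteq> set p"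
      using Suc.hyps(1)[of r "s - 1" \<sigma>'] Suc.hyps(2) 3 Suc.prems by fastforce
    then have "staircase_path r s (p @ [(r, s)])" "\<sigma> \<subseteq> set (p @ [(r, s)])"
      using 3 by (auto intro!: staircase_path_snoc simp: unit_step_def \<sigma>'_def)
    then show ?thesis by blast
  qed
qed

lemma partial_lattice_paths_eq:
  assumes "r \<ge> 1" "s \<ge> 1"
  shows "partial_lattice_paths r s = {\<sigma>. grid_chain r s \<sigma>}"
proof -
  have "lattice_paths r s = {set p | p. staircase_path r s p}"
    by (simp add: lattice_paths_def staircase_path_def)
  then have "partial_lattice_paths r s = {\<sigma>. \<exists>p. staircase_path r s p \<and> \<sigma> \<subseteq> set p}"
    unfolding partial_lattice_paths_def by auto
  also have "\<dots> = {\<sigma>. grid_chain r s \<sigma>}"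
    using grid_chain_extends_to_path[OF _ assms] grid_chain_subset[OF grid_chain_path] by auto
  finally show ?thesis .
qed

section \<open>The composition graph\<close>

text \<open>A row containing two points can lose one of them and is still met, whereas a chain with
  a single point in each row can lose nothing.\<close>

lemma minimal_staircases:
  "minimal_cells (staircases r s) = {\<sigma> \<in> staircases r s. inj_on fst \<sigma>}"
proof (rule set_eqI, rule iffI)
  fix \<sigma> assume min: "\<sigma> \<in> minimal_cells (staircases r s)"
  then have \<sigma>: "\<sigma> \<in> staircases r s" by (simp add: minimal_cells_def)
  have "x = y" if xy: "x \<in> \<sigma>" "y \<in> \<sigma>" "fst x = fst y" for x y
  proof (rule ccontr)
    assume "x \<noteq> y"
    then have "fst ` (\<sigma> - {x}) = fst ` \<sigma>" using xy by (auto simp: image_iff)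
    then have "\<sigma> - {x} \<in> staircases r s"
      using \<sigma> grid_chain_subset unfolding staircases_def by auto
    then show False using min xy(1) unfolding minimal_cells_def by blast
  qed
  then show "\<sigma> \<in> {\<sigma> \<in> staircases r s. inj_on fst \<sigma>}" using \<sigma> by (simp add: inj_on_def)
next
  fix \<sigma> assume "\<sigma> \<in> {\<sigma> \<in> staircases r s. inj_on fst \<sigma>}"
  then have \<sigma>: "\<sigma> \<in> staircases r s" and inj: "inj_on fst \<sigma>" by auto
  have "\<sigma> \<subseteq> c" if c: "c \<in> staircases r s" "c \<subseteq> \<sigma>" for c
  proof
    fix x assume x: "x \<in> \<sigma>"
    then have "fst x \<in> {1..r}" using \<sigma> by (auto simp: staircases_def grid_chain_def)
    then obtain y where "y \<in> c" "fst y = fst x" using staircases_row[OF c(1)] by (metis fst_conv)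
    then show "x \<in> c" using inj c(2) x by (metis inj_onD subsetD)
  qed
  then show "\<sigma> \<in> minimal_cells (staircases r s)"
    using \<sigma> by (auto simp: minimal_cells_def)
qed

text \<open>The graph of the weakly increasing map from rows to columns that sends the next
  \<open>a ! (j - 1)\<close> consecutive rows to column \<open>j\<close>; the composition lists the
  column counts.\<close>

definition composition_cell :: "nat list \<Rightarrow> (nat \<times> nat) set" where
  "composition_cell a =
     {(i, j). 1 \<le> j \<and> j \<le> length a \<and> sum_list (take (j - 1) a) < i \<and> i \<le> sum_list (take j a)}"

lemma sum_list_take_mono:
  fixes a :: "nat list"
  assumes "j \<le> k"
  shows "sum_list (take j a) \<le> sum_list (take k a)"
proof -
  have "take k a = take j a @ take (k - j) (drop j a)"
    using assms by (metis le_add_diff_inverse take_add)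
  then show ?thesis by simp
qed

lemma sum_list_take_Suc:
  fixes a :: "nat list"
  shows "j < length a \<Longrightarrow> sum_list (take (Suc j) a) = sum_list (take j a) + a ! j"
  by (simp add: take_Suc_conv_app_nth)

lemma composition_cell_mono:
  assumes "(i, j) \<in> composition_cell a" "(i', j') \<in> composition_cell a" "i \<le> i'"
  shows "j \<le> j'"
proof (rule ccontr)
  assume "\<not> j \<le> j'"
  then have "sum_list (take j' a) \<le> sum_list (take (j - 1) a)" by (intro sum_list_take_mono) simp
  then show False using assms by (auto simp: composition_cell_def)
qed

lemma composition_cell_minimal:
  assumes "a \<in> weak_compositions r s"
  shows "composition_cell a \<in> minimal_cells (staircases r s)"
proof -
  have a: "length a = s" "sum_list a = r" using assms by (auto simp: weak_compositions_def)
  have "composition_cell a \<subseteq> {1..r} \<times> {1..s}"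
  proof
    fix x assume "x \<in> composition_cell a"
    moreover have "sum_list (take (snd x) a) \<le> sum_list (take (length a) a)" if "snd x \<le> length a"
      using that by (rule sum_list_take_mono)
    ultimately show "x \<in> {1..r} \<times> {1..s}" using a by (auto simp: composition_cell_def)
  qed
  moreover have "\<forall>x\<in>composition_cell a. \<forall>y\<in>composition_cell a. fst x < fst y \<longrightarrow> snd x \<le> snd y"
    using composition_cell_mono by fastforce
  moreover have "{1..r} \<subseteq> fst ` composition_cell a"
  proof
    fix i assume i: "i \<in> {1..r}"
    define j where "j = (LEAST j. i \<le> sum_list (take j a))"
    have s: "i \<le> sum_list (take s a)" using a i by simp
    have j: "i \<le> sum_list (take j a)" "j \<le> s"
      unfolding j_def using s by (rule LeastI, rule Least_le)
    have "j \<noteq> 0" using j(1) i by (cases j) auto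
    then have "\<not> i \<le> sum_list (take (j - 1) a)"
      using not_less_Least[of "j - 1" "\<lambda>j. i \<le> sum_list (take j a)"] by (simp add: j_def)
    then have "(i, j) \<in> composition_cell a" using j \<open>j \<noteq> 0\<close> a by (auto simp: composition_cell_def)
    then show "i \<in> fst ` composition_cell a" by force
  qed
  moreover have "inj_on fst (composition_cell a)"
  proof (rule inj_onI)
    fix x y assume xy: "x \<in> composition_cell a" "y \<in> composition_cell a" "fst x = fst y"
    obtain i j k where "x = (i, j)" "y = (i, k)" using xy(3) by (metis prod.collapse)
    then show "x = y"
      using xy composition_cell_mono[of i j a i k] composition_cell_mono[of i k a i j] by simp
  qed
  ultimately show ?thesis
    unfolding minimal_staircases by (simp add: staircases_def grid_chain_def)
qed

lemma composition_cell_column: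
  assumes "j < length a"
  shows "card {i. (i, Suc j) \<in> composition_cell a} = a ! j"
proof -
  have "{i. (i, Suc j) \<in> composition_cell a} = {sum_list (take j a)<..sum_list (take (Suc j) a)}"
    using assms by (auto simp: composition_cell_def)
  then show ?thesis using sum_list_take_Suc[OF assms] by simp
qed

lemma bij_betw_composition_cell:
  "bij_betw composition_cell (weak_compositions r s) (minimal_cells (staircases r s))"
proof (rule bij_betw_imageI)
  show "inj_on composition_cell (weak_compositions r s)"
  proof (rule inj_onI)
    fix a b assume "a \<in> weak_compositions r s" "b \<in> weak_compositions r s"
      "composition_cell a = composition_cell b"
    then show "a = b"
      using composition_cell_column[of _ a] composition_cell_column[of _ b]
      by (intro nth_equalityI) (auto simp: weak_compositions_def)
  qed
  show "composition_cell ` weak_compositions r s = minimal_cells (staircases r s)"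
  proof (intro equalityI subsetI)
    fix \<sigma> assume min: "\<sigma> \<in> minimal_cells (staircases r s)"
    then have inj: "inj_on fst \<sigma>" and "\<sigma> \<in> staircases r s" by (auto simp: minimal_staircases)
    then have sub: "\<sigma> \<subseteq> {1..r} \<times> {1..s}"
      and ch: "\<And>x y. x \<in> \<sigma> \<Longrightarrow> y \<in> \<sigma> \<Longrightarrow> fst x < fst y \<Longrightarrow> snd x \<le> snd y"
      and rows: "{1..r} \<subseteq> fst ` \<sigma>"
      by (auto simp: staircases_def grid_chain_def)
    have fin: "finite \<sigma>" using sub finite_subset by blast
    define a where "a = map (\<lambda>j. card {i. (i, Suc j) \<in> \<sigma>}) [0..<s]"
    have take: "sum_list (take j a) = card {x \<in> \<sigma>. snd x \<le> j}" if "j \<le> s" for j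
      using that
    proof (induction j)
      case 0
      have "{x \<in> \<sigma>. snd x \<le> 0} = {}" using sub by fastforce
      then show ?case by (metis card.empty sum_list.Nil take_0)
    next
      case (Suc j)
      have "{x \<in> \<sigma>. snd x \<le> Suc j} = {x \<in> \<sigma>. snd x \<le> j} \<union> (\<lambda>i. (i, Suc j)) ` {i. (i, Suc j) \<in> \<sigma>}"
        by (auto simp: image_iff le_Suc_eq)
      moreover have "card ((\<lambda>i. (i, Suc j)) ` {i. (i, Suc j) \<in> \<sigma>}) = card {i. (i, Suc j) \<in> \<sigma>}"
        by (intro card_image) (auto simp: inj_on_def)
      moreover have "finite ((\<lambda>i. (i, Suc j)) ` {i. (i, Suc j) \<in> \<sigma>})"
        by (rule finite_subset[OF _ fin]) auto
      ultimately have "card {x \<in> \<sigma>. snd x \<le> Suc j} =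
          card {x \<in> \<sigma>. snd x \<le> j} + card {i. (i, Suc j) \<in> \<sigma>}"
        using fin by (simp add: card_Un_disjoint disjoint_iff image_iff)
      then show ?case using Suc by (simp add: sum_list_take_Suc a_def del: take_Suc upt_Suc)
    qed
    have "card \<sigma> = card (fst ` \<sigma>)" using inj by (simp add: card_image)
    also have "fst ` \<sigma> = {1..r}" using rows sub by auto
    finally have "card \<sigma> = r" by simp
    moreover have "{x \<in> \<sigma>. snd x \<le> s} = \<sigma>" using sub by auto
    ultimately have awc: "a \<in> weak_compositions r s"
      using take[of s] by (simp add: weak_compositions_def a_def)
    \<comment> \<open>The rows up to \<open>i\<close> use columns up to \<open>j\<close>, and the
      columns before \<open>j\<close> use only rows before \<open>i\<close>. By \<open>take\<close>,
      these two counts are the inequalities defining \<open>composition_cell\<close>; minimality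
      then upgrades the inclusion to an equality.\<close>
    have "\<sigma> \<subseteq> composition_cell a"
    proof (rule subrelI)
      fix i j assume ij: "(i, j) \<in> \<sigma>"
      have b: "i \<in> {1..r}" "j \<in> {1..s}" using sub ij by auto
      have "{1..i} \<subseteq> fst ` {x \<in> \<sigma>. snd x \<le> j}"
      proof
        fix i' assume i': "i' \<in> {1..i}"
        then obtain x where x: "x \<in> \<sigma>" "fst x = i'" using rows b by fastforce
        have "snd x \<le> j"
          using ch[OF x(1) ij] x ij i' inj_onD[OF inj, of x "(i, j)"] by force
        then show "i' \<in> fst ` {x \<in> \<sigma>. snd x \<le> j}" using x by auto
      qed
      then have "card {1..i} \<le> card {x \<in> \<sigma>. snd x \<le> j}" using fin by (intro surj_card_le) auto
      moreover have "card {x \<in> \<sigma>. snd x \<le> j - 1} \<le> card {1..i - 1}"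
      proof (rule card_inj_on_le[of fst])
        show "inj_on fst {x \<in> \<sigma>. snd x \<le> j - 1}" using inj by (rule inj_on_subset) auto
        show "fst ` {x \<in> \<sigma>. snd x \<le> j - 1} \<subseteq> {1..i - 1}"
        proof
          fix i' assume "i' \<in> fst ` {x \<in> \<sigma>. snd x \<le> j - 1}"
          then obtain x where x: "x \<in> \<sigma>" "snd x \<le> j - 1" "fst x = i'" by auto
          have "x \<noteq> (i, j)" using x(2) b by auto
          then have "i' \<noteq> i" using inj x ij by (metis fst_conv inj_onD)
          moreover have "\<not> i < i'" using ch[OF ij x(1)] x b by auto
          ultimately show "i' \<in> {1..i - 1}" using sub x b by force
        qed
      qed simp
      ultimately show "(i, j) \<in> composition_cell a"
        using b awc take[of j] take[of "j - 1"]
        by (auto simp: composition_cell_def weak_compositions_def)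
    qed
    then have "\<sigma> = composition_cell a"
      using composition_cell_minimal[OF awc] min unfolding minimal_cells_def by blast
    then show "\<sigma> \<in> composition_cell ` weak_compositions r s" using awc by blast
  qed (use composition_cell_minimal in blast)
qed

lemma composition_adjacent_sym:
  assumes "composition_adjacent a b" "length a = length b"
  shows "composition_adjacent b a"
proof -
  obtain j k where jk: "j < k" "k < length a" "a ! j = b ! j + 1 \<or> b ! j = a ! j + 1"
    "a ! k = b ! k + 1 \<or> b ! k = a ! k + 1"
    "\<forall>i < length a. i \<noteq> j \<longrightarrow> i \<noteq> k \<longrightarrow> a ! i = b ! i" "\<forall>i. j < i \<and> i < k \<longrightarrow> a ! i = 0"
    using assms(1) unfolding composition_adjacent_def by blast
  have "b ! i = 0" if "j < i" "i < k" for i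
    using jk(5)[rule_format, of i] jk(6) jk(2) that by simp
  then show ?thesis
    unfolding composition_adjacent_def using jk assms(2)
    by (intro exI[of _ j] exI[of _ k]) auto
qed

text \<open>Exchange argument: moving row \<open>i\<close> from column \<open>j\<close> to column
  \<open>j'\<close> turns the first minimal cell into another one inside \<open>c\<close>. As
  \<open>c\<close> contains only two, this is the second, so the compositions differ by one unit
  moved from \<open>j\<close> to \<open>j'\<close>.\<close>

lemma composition_adjacent_of_edge_aux:
  assumes a: "a \<in> weak_compositions r s" and b: "b \<in> weak_compositions r s"
    and c: "c \<in> staircases r s"
    and edge: "{m \<in> minimal_cells (staircases r s). m \<subseteq> c} = {composition_cell a, composition_cell b}"
    and ij: "(i, j) \<in> composition_cell a" and ij': "(i, j') \<in> composition_cell b" and "j < j'"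
  shows "composition_adjacent a b"
proof -
  let ?\<alpha> = "composition_cell a" and ?\<beta> = "composition_cell b"
  let ?M = "minimal_cells (staircases r s)"
  have len: "length a = s" "length b = s" using a b by (auto simp: weak_compositions_def)
  have \<alpha>: "?\<alpha> \<in> ?M" "?\<alpha> \<subseteq> c" and \<beta>: "?\<beta> \<in> ?M" "?\<beta> \<subseteq> c" using edge by blast+
  have inj: "inj_on fst ?\<alpha>" using \<alpha>(1) by (simp add: minimal_staircases)
  define \<gamma> where "\<gamma> = insert (i, j') (?\<alpha> - {(i, j)})"
  have "\<gamma> \<subseteq> c" using \<alpha> \<beta> ij' by (auto simp: \<gamma>_def)
  then have "grid_chain r s \<gamma>" using c grid_chain_subset by (auto simp: staircases_def)
  moreover have "fst ` \<gamma> = fst ` ?\<alpha>" using image_insert[of fst "(i, j)" "?\<alpha> - {(i, j)}"] ij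
    by (simp add: \<gamma>_def insert_absorb)
  moreover have "inj_on fst \<gamma>"
  proof -
    have "x = (i, j)" if "x \<in> ?\<alpha>" "fst x = i" for x
      using inj_onD[OF inj, of x "(i, j)"] that ij by simp
    then have "i \<notin> fst ` (?\<alpha> - {(i, j)})" by blast
    then show ?thesis
      unfolding \<gamma>_def inj_on_insert using inj by (auto intro: inj_on_subset)
  qed
  ultimately have "\<gamma> \<in> ?M"
    using \<alpha>(1) unfolding minimal_staircases by (simp add: staircases_def)
  then have "\<gamma> = ?\<alpha> \<or> \<gamma> = ?\<beta>" using edge \<open>\<gamma> \<subseteq> c\<close> by blast
  moreover have "(i, j) \<notin> \<gamma>" using \<open>j < j'\<close> by (simp add: \<gamma>_def)
  ultimately have \<gamma>: "?\<beta> = insert (i, j') (?\<alpha> - {(i, j)})" using ij \<gamma>_def by blast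
  have j: "1 \<le> j" "j' \<le> s" using ij ij' len by (auto simp: composition_cell_def)
  have notin: "(i, j') \<notin> ?\<alpha>" using inj_onD[OF inj, of "(i, j)" "(i, j')"] ij \<open>j < j'\<close> by auto
  have fin: "finite {i. (i, x) \<in> ?\<alpha>}" for x
  proof (rule finite_subset)
    show "{i. (i, x) \<in> ?\<alpha>} \<subseteq> {..sum_list (take x a)}" by (auto simp: composition_cell_def)
  qed simp
  have col: "a ! (x - 1) = card {i. (i, x) \<in> ?\<alpha>}" "b ! (x - 1) = card {i. (i, x) \<in> ?\<beta>}"
    if "1 \<le> x" "x \<le> s" for x
    using that len composition_cell_column[of "x - 1" a] composition_cell_column[of "x - 1" b] by auto
  have "{i. (i, j) \<in> ?\<alpha>} = insert i {i. (i, j) \<in> ?\<beta>}" "i \<notin> {i. (i, j) \<in> ?\<beta>}"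
    unfolding \<gamma> using ij \<open>j < j'\<close> by auto
  then have 1: "a ! (j - 1) = b ! (j - 1) + 1"
  proof -
    have "finite {i. (i, j) \<in> ?\<beta>}"
      by (rule finite_subset[OF _ fin[of j]]) (use \<open>{i. (i, j) \<in> ?\<alpha>} = insert i {i. (i, j) \<in> ?\<beta>}\<close> in blast)
    then have "card {i. (i, j) \<in> ?\<alpha>} = Suc (card {i. (i, j) \<in> ?\<beta>})"
      using \<open>{i. (i, j) \<in> ?\<alpha>} = insert i {i. (i, j) \<in> ?\<beta>}\<close> \<open>i \<notin> {i. (i, j) \<in> ?\<beta>}\<close> by simp
    then show ?thesis using col[of j] j \<open>j < j'\<close> by simp
  qed
  have "{i. (i, j') \<in> ?\<beta>} = insert i {i. (i, j') \<in> ?\<alpha>}"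
    unfolding \<gamma> using \<open>j < j'\<close> by auto
  then have 2: "b ! (j' - 1) = a ! (j' - 1) + 1"
    using col[of j'] j \<open>j < j'\<close> fin[of j'] notin by simp
  have 3: "a ! x = b ! x" if "x < s" "x \<noteq> j - 1" "x \<noteq> j' - 1" for x
  proof -
    have "{i. (i, Suc x) \<in> ?\<alpha>} = {i. (i, Suc x) \<in> ?\<beta>}" unfolding \<gamma> using that by auto
    then show ?thesis using col[of "Suc x"] that by simp
  qed
  \<comment> \<open>A point strictly between the two columns would belong to both cells.
    Monotonicity of the first puts it in a row after \<open>i\<close>, monotonicity of the second in
    a row before \<open>i\<close>.\<close>
  have 4: "a ! x = 0" if x: "j - 1 < x" "x < j' - 1" for x
  proof -
    have "(k, Suc x) \<notin> ?\<alpha>" for k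
    proof
      assume k: "(k, Suc x) \<in> ?\<alpha>"
      then have "(k, Suc x) \<in> ?\<beta>" unfolding \<gamma> using x by auto
      then show False
        using composition_cell_mono[OF k ij] composition_cell_mono[OF ij', of k "Suc x"] x by linarith
    qed
    then have "{i. (i, Suc x) \<in> ?\<alpha>} = {}" by blast
    then show ?thesis using col(1)[of "Suc x"] x j by simp
  qed
  show ?thesis
    unfolding composition_adjacent_def
    by (intro exI[of _ "j - 1"] exI[of _ "j' - 1"]) (use 1 2 3 4 j \<open>j < j'\<close> len in auto)
qed

lemma composition_adjacent_of_edge:
  assumes a: "a \<in> weak_compositions r s" and b: "b \<in> weak_compositions r s"
    and ne: "composition_cell a \<noteq> composition_cell b" and c: "c \<in> staircases r s"
    and edge: "{m \<in> minimal_cells (staircases r s). m \<subseteq> c} = {composition_cell a, composition_cell b}"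
  shows "composition_adjacent a b"
proof -
  have \<alpha>: "composition_cell a \<in> minimal_cells (staircases r s)"
    and \<beta>: "composition_cell b \<in> minimal_cells (staircases r s)"
    using a b composition_cell_minimal by auto
  have "\<not> composition_cell a \<subseteq> composition_cell b"
    using ne \<alpha> \<beta> unfolding minimal_cells_def by blast
  then obtain i j where ij: "(i, j) \<in> composition_cell a" "(i, j) \<notin> composition_cell b" by auto
  have "composition_cell a \<subseteq> {1..r} \<times> {1..s}"
    using \<alpha> by (simp add: minimal_cells_def staircases_def grid_chain_def)
  then have "i \<in> {1..r}" using ij(1) by blast
  then obtain j' where j': "(i, j') \<in> composition_cell b"
    using staircases_row[of "composition_cell b" r s i] \<beta> by (auto simp: minimal_cells_def)
  have "j \<noteq> j'" using ij(2) j' by blast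
  then have "j < j' \<or> j' < j" by linarith
  then show ?thesis
  proof
    assume "j < j'"
    then show ?thesis using composition_adjacent_of_edge_aux[OF a b c edge ij(1) j'] by simp
  next
    assume "j' < j"
    then have "composition_adjacent b a"
      using composition_adjacent_of_edge_aux[OF b a c _ j' ij(1)] edge by (simp add: insert_commute)
    then show ?thesis using a b by (auto intro: composition_adjacent_sym simp: weak_compositions_def)
  qed
qed

text \<open>The edge is the union of the two minimal cells: the zeros between \<open>j\<close> and
  \<open>k\<close> make these cells differ in a single row only.\<close>

lemma edge_of_composition_adjacent_aux:
  assumes a: "a \<in> weak_compositions r s" and b: "b \<in> weak_compositions r s"
    and jk: "j < k" "k < s" "a ! j = b ! j + 1" "a ! k = b ! k + 1 \<or> b ! k = a ! k + 1"
    and eq: "\<And>i. i < s \<Longrightarrow> i \<noteq> j \<Longrightarrow> i \<noteq> k \<Longrightarrow> a ! i = b ! i"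
    and zero: "\<And>i. j < i \<Longrightarrow> i < k \<Longrightarrow> a ! i = 0"
  shows "\<exists>c\<in>staircases r s.
    {m \<in> minimal_cells (staircases r s). m \<subseteq> c} = {composition_cell a, composition_cell b}"
proof -
  let ?\<alpha> = "composition_cell a" and ?\<beta> = "composition_cell b"
  let ?M = "minimal_cells (staircases r s)"
  have len: "length a = s" "length b = s" and sums: "sum_list a = r" "sum_list b = r"
    using a b by (auto simp: weak_compositions_def)
  \<comment> \<open>Both compositions have sum \<open>r\<close>, so the changes at \<open>j\<close>
    and at \<open>k\<close> cancel.\<close>
  have "(\<Sum>i<s. int (a ! i) - int (b ! i)) = (\<Sum>i\<in>{j, k}. int (a ! i) - int (b ! i))"
    by (rule sum.mono_neutral_right) (use jk eq in auto)
  moreover have "(\<Sum>i<s. int (a ! i) - int (b ! i)) = 0"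
    using sums len unfolding sum_list_sum_nth atLeast0LessThan
    by (simp add: sum_subtractf flip: of_nat_sum)
  ultimately have bk: "b ! k = a ! k + 1" using jk by auto
  have take: "sum_list (take x a) = sum_list (take x b) + (if j < x \<and> x \<le> k then 1 else 0)"
    if "x \<le> s" for x
    using that
  proof (induction x)
    case (Suc x)
    then show ?case
      using eq[of x] jk bk len
      by (cases "x = j"; cases "x = k") (auto simp: sum_list_take_Suc split: if_splits)
  qed simp
  \<comment> \<open>The last row of the block of column \<open>Suc j\<close> in the cell of
    \<open>a\<close>; this is the row that moves to column \<open>Suc k\<close>.\<close>
  define i where "i = sum_list (take (Suc j) a)"
  have const: "sum_list (take x a) = i" if "j < x" "x \<le> k" for x
    using that
  proof (induction x)
    case (Suc x)
    then show ?case
      using zero[of x] jk len by (cases "x = j") (auto simp: sum_list_take_Suc i_def)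
  qed simp
  have diff: "?\<alpha> - ?\<beta> \<subseteq> {(i, Suc j)}" "?\<beta> - ?\<alpha> \<subseteq> {(i, Suc k)}"
  proof -
    have "(x, y) = (i, Suc j)" if xy: "(x, y) \<in> ?\<alpha>" "(x, y) \<notin> ?\<beta>" for x y
    proof -
      have y: "1 \<le> y" "y \<le> s" "sum_list (take (y - 1) a) < x" "x \<le> sum_list (take y a)"
        using xy(1) len by (auto simp: composition_cell_def)
      have "\<not> x \<le> sum_list (take y b)"
        using xy(2) y len take[of "y - 1"] by (auto simp: composition_cell_def split: if_splits)
      then have "j < y" "y \<le> k" "x = sum_list (take y a)"
        using y take[of y] by (auto split: if_splits)
      moreover have "\<not> j < y - 1"
      proof
        assume "j < y - 1"
        then show False using const[of y] const[of "y - 1"] calculation y(3) by (simp add: le_diff_conv)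
      qed
      ultimately show ?thesis using const[of y] by auto
    qed
    then show "?\<alpha> - ?\<beta> \<subseteq> {(i, Suc j)}" by auto
    have "(x, y) = (i, Suc k)" if xy: "(x, y) \<in> ?\<beta>" "(x, y) \<notin> ?\<alpha>" for x y
    proof -
      have y: "1 \<le> y" "y \<le> s" "sum_list (take (y - 1) b) < x" "x \<le> sum_list (take y b)"
        using xy(1) len by (auto simp: composition_cell_def)
      have "\<not> sum_list (take (y - 1) a) < x"
        using xy(2) y len take[of y] by (auto simp: composition_cell_def split: if_splits)
      then have *: "j < y - 1" "y - 1 \<le> k" "x = sum_list (take (y - 1) a)"
        using y take[of "y - 1"] by (auto split: if_splits)
      moreover have "\<not> y \<le> k" using less_le_trans[OF *(1) diff_le_self] const[of y] take[of y] * y const[of "y - 1"] by auto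
      ultimately show ?thesis using const[of "y - 1"] by auto
    qed
    then show "?\<beta> - ?\<alpha> \<subseteq> {(i, Suc k)}" by auto
  qed
  have \<alpha>: "?\<alpha> \<in> ?M" and \<beta>: "?\<beta> \<in> ?M" using a b composition_cell_minimal by auto
  have \<alpha>s: "?\<alpha> \<in> staircases r s" and \<beta>s: "?\<beta> \<in> staircases r s"
    using \<alpha> \<beta> by (auto simp: minimal_cells_def)
  have "snd x \<le> snd y" if "x \<in> ?\<alpha> \<union> ?\<beta>" "y \<in> ?\<alpha> \<union> ?\<beta>" "fst x < fst y" for x y
  proof -
    \<comment> \<open>A pair lying in neither cell as a whole consists of the two exceptional
      points, which share row \<open>i\<close>.\<close>
    have "x \<in> ?\<alpha> \<and> y \<in> ?\<alpha> \<or> x \<in> ?\<beta> \<and> y \<in> ?\<beta>"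
    proof (rule ccontr)
      assume "\<not> ?thesis"
      then have "x \<in> {(i, Suc j), (i, Suc k)} \<and> y \<in> {(i, Suc j), (i, Suc k)}" using that diff by blast
      then show False using that(3) by auto
    qed
    then show ?thesis using \<alpha>s \<beta>s that(3) unfolding staircases_def grid_chain_def by blast
  qed
  then have "?\<alpha> \<union> ?\<beta> \<in> staircases r s"
    using \<alpha>s \<beta>s unfolding staircases_def grid_chain_def by auto
  moreover have "{m \<in> ?M. m \<subseteq> ?\<alpha> \<union> ?\<beta>} = {?\<alpha>, ?\<beta>}"
  proof -
    have "m = ?\<alpha> \<or> m = ?\<beta>" if m: "m \<in> ?M" "m \<subseteq> ?\<alpha> \<union> ?\<beta>" for m
    proof -
      have "inj_on fst m" "m \<in> staircases r s" using m(1) by (auto simp: minimal_staircases)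
      then have "\<not> ((i, Suc j) \<in> m \<and> (i, Suc k) \<in> m)"
        using jk inj_onD[of fst m "(i, Suc j)" "(i, Suc k)"] by auto
      then have "m \<subseteq> ?\<alpha> \<or> m \<subseteq> ?\<beta>" using m(2) diff by blast
      then show ?thesis
        using \<alpha> \<beta> \<open>m \<in> staircases r s\<close> unfolding minimal_cells_def by blast
    qed
    then show ?thesis using \<alpha> \<beta> by blast
  qed
  ultimately show ?thesis by blast
qed

lemma edge_of_composition_adjacent:
  assumes a: "a \<in> weak_compositions r s" and b: "b \<in> weak_compositions r s"
    and adj: "composition_adjacent a b"
  shows "composition_cell a \<noteq> composition_cell b \<and> (\<exists>c\<in>staircases r s.
    {m \<in> minimal_cells (staircases r s). m \<subseteq> c} = {composition_cell a, composition_cell b})"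
proof -
  have len: "length a = s" "length b = s" using a b by (auto simp: weak_compositions_def)
  obtain j k where jk: "j < k" "k < s" "a ! j = b ! j + 1 \<or> b ! j = a ! j + 1"
    "a ! k = b ! k + 1 \<or> b ! k = a ! k + 1"
    and eq: "\<And>i. i < s \<Longrightarrow> i \<noteq> j \<Longrightarrow> i \<noteq> k \<Longrightarrow> a ! i = b ! i"
    and zero: "\<And>i. j < i \<Longrightarrow> i < k \<Longrightarrow> a ! i = 0"
    using adj len unfolding composition_adjacent_def by blast
  have zero': "b ! i = 0" if "j < i" "i < k" for i using eq[of i] zero[OF that] that jk(2) by simp
  have "a \<noteq> b" using jk(3) by auto
  then have "composition_cell a \<noteq> composition_cell b"
    using bij_betw_imp_inj_on[OF bij_betw_composition_cell, THEN inj_onD] a b by blast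
  moreover have "\<exists>c\<in>staircases r s.
    {m \<in> minimal_cells (staircases r s). m \<subseteq> c} = {composition_cell a, composition_cell b}"
    using jk(3)
  proof
    assume "a ! j = b ! j + 1"
    then show ?thesis using edge_of_composition_adjacent_aux[OF a b jk(1,2) _ jk(4) eq zero] by blast
  next
    assume "b ! j = a ! j + 1"
    then show ?thesis
      using edge_of_composition_adjacent_aux[OF b a jk(1,2) _ _ eq[symmetric] zero'] jk(4)
      by (simp add: insert_commute disj_commute)
  qed
  ultimately show ?thesis by blast
qed

lemma graph_iso_composition_graph:
  "graph_iso (cell_graph (staircases r s)) (composition_graph r s)"
proof -
  let ?W = "weak_compositions r s" and ?M = "minimal_cells (staircases r s)"
  have edge: "(\<exists>c\<in>staircases r s. {m \<in> ?M. m \<subseteq> c} = {composition_cell a, composition_cell b})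
      \<and> composition_cell a \<noteq> composition_cell b \<longleftrightarrow> composition_adjacent a b"
    if "a \<in> ?W" "b \<in> ?W" for a b
  proof
    assume "(\<exists>c\<in>staircases r s. {m \<in> ?M. m \<subseteq> c} = {composition_cell a, composition_cell b})
      \<and> composition_cell a \<noteq> composition_cell b"
    then obtain c where "c \<in> staircases r s"
      "{m \<in> ?M. m \<subseteq> c} = {composition_cell a, composition_cell b}"
      "composition_cell a \<noteq> composition_cell b" by (elim conjE bexE)
    then show "composition_adjacent a b" using composition_adjacent_of_edge[OF that] by simp
  next
    assume "composition_adjacent a b"
    then show "(\<exists>c\<in>staircases r s. {m \<in> ?M. m \<subseteq> c} = {composition_cell a, composition_cell b})
      \<and> composition_cell a \<noteq> composition_cell b"
      using edge_of_composition_adjacent[OF that] by simp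
  qed
  have "snd (cell_graph (staircases r s)) = {{composition_cell a, composition_cell b} | a b.
      a \<in> ?W \<and> b \<in> ?W \<and> composition_adjacent a b}" (is "?E = ?F")
  proof (intro equalityI subsetI)
    fix E assume "E \<in> ?E"
    then obtain \<alpha> \<beta> c where E: "E = {\<alpha>, \<beta>}" "\<alpha> \<noteq> \<beta>" "c \<in> staircases r s" "{m \<in> ?M. m \<subseteq> c} = {\<alpha>, \<beta>}"
      by (auto simp: cell_graph_def)
    then have "\<alpha> \<in> composition_cell ` ?W" "\<beta> \<in> composition_cell ` ?W"
      using bij_betw_imp_surj_on[OF bij_betw_composition_cell, of r s] by auto
    then obtain a b where "a \<in> ?W" "b \<in> ?W" "\<alpha> = composition_cell a" "\<beta> = composition_cell b"
      by blast
    then show "E \<in> ?F" using E edge[of a b] by blast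
  next
    fix E assume "E \<in> ?F"
    then obtain a b where "E = {composition_cell a, composition_cell b}" "a \<in> ?W" "b \<in> ?W"
      "composition_adjacent a b" by blast
    then show "E \<in> ?E" using edge[of a b] unfolding cell_graph_def snd_conv by blast
  qed
  then have "(\<lambda>e. composition_cell ` e) ` snd (composition_graph r s) = snd (cell_graph (staircases r s))"
    unfolding composition_graph_def by (auto simp: image_def)
  then have "graph_iso (composition_graph r s) (cell_graph (staircases r s))"
    unfolding graph_iso_def using bij_betw_composition_cell[of r s]
    by (auto simp: composition_graph_def cell_graph_def)
  then show ?thesis by (rule graph_iso_sym) (auto simp: composition_graph_def)
qed

section \<open>Chains and gaps of facets\<close>

definition path_pos :: "nat \<times> nat \<Rightarrow> nat" where
  "path_pos x = fst x + 2 * (snd x - 1)"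

lemma even_path_pos: "even (path_pos x + fst x)"
  by (simp add: path_pos_def)

lemma path_pos_less_imp_le:
  assumes "grid_chain r s \<sigma>" "x \<in> \<sigma>" "y \<in> \<sigma>" "path_pos x < path_pos y"
  shows "fst x \<le> fst y"
proof (rule ccontr)
  assume "\<not> fst x \<le> fst y"
  then have "fst y < fst x" by simp
  then have "snd y \<le> snd x" using assms(1-3) unfolding grid_chain_def by blast
  then show False using assms(4) \<open>fst y < fst x\<close> by (simp add: path_pos_def)
qed

text \<open>Equal positions in different rows need the smaller row to have the larger column, which
  a chain forbids.\<close>

lemma inj_on_path_pos:
  assumes "grid_chain r s \<sigma>"
  shows "inj_on path_pos \<sigma>"
proof (rule inj_onI)
  fix x y assume xy: "x \<in> \<sigma>" "y \<in> \<sigma>" "path_pos x = path_pos y"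
  have "x \<in> {1..r} \<times> {1..s}" "y \<in> {1..r} \<times> {1..s}"
    using assms xy unfolding grid_chain_def by blast+
  then have pos: "1 \<le> snd x" "1 \<le> snd y" by (auto simp: mem_Times_iff)
  have "fst x < fst y \<longrightarrow> snd x \<le> snd y" "fst y < fst x \<longrightarrow> snd y \<le> snd x"
    using assms xy unfolding grid_chain_def by blast+
  then show "x = y" using xy(3) pos unfolding path_pos_def by (intro prod_eqI) linarith+
qed

lemma strictly_increasing_self_map:
  fixes f :: "nat \<Rightarrow> nat"
  assumes "\<And>k. k \<in> {1..r} \<Longrightarrow> f k \<in> {1..r}"
    and "\<And>k. 1 \<le> k \<Longrightarrow> k < r \<Longrightarrow> f k < f (Suc k)" and k: "k \<in> {1..r}"
  shows "f k = k"
proof -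
  have step: "f l + m \<le> f (l + m)" if "1 \<le> l" "l + m \<le> r" for l m
    using that
  proof (induction m)
    case (Suc m)
    then show ?case using assms(2)[of "l + m"] by simp
  qed simp
  show ?thesis
    using step[of 1 "k - 1"] step[of k "r - k"] assms(1)[of 1] assms(1)[of r] k by auto
qed

text \<open>Along increasing positions of a chain the row never decreases, and a change of parity of
  the position is a change of parity of the row. So the row strictly increases at each step, and
  \<open>r\<close> strictly increasing rows in \<open>{1..r}\<close> are
  \<open>1, ..., r\<close>.\<close>

lemma alternating_rows:
  assumes \<sigma>: "grid_chain r s \<sigma>"
    and h: "\<And>k. k \<in> {1..r} \<Longrightarrow> h k \<in> path_pos ` \<sigma>"
    and inc: "\<And>k. 1 \<le> k \<Longrightarrow> k < r \<Longrightarrow> h k < h (Suc k) \<and> odd (h k + h (Suc k))"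
    and k: "k \<in> {1..r}"
  obtains j where "(k, j) \<in> \<sigma>" "h k = path_pos (k, j)"
proof -
  have "\<forall>k\<in>{1..r}. \<exists>x\<in>\<sigma>. h k = path_pos x" using h by blast
  then obtain x where x: "\<And>k. k \<in> {1..r} \<Longrightarrow> x k \<in> \<sigma> \<and> h k = path_pos (x k)" by metis
  have "fst (x k) = k"
  proof (rule strictly_increasing_self_map[where r = r and f = "\<lambda>k. fst (x k)"])
    fix l assume "l \<in> {1..r}"
    then have "x l \<in> {1..r} \<times> {1..s}" using x \<sigma> unfolding grid_chain_def by blast
    then show "fst (x l) \<in> {1..r}" by (auto simp: mem_Times_iff)
  next
    fix l assume l: "1 \<le> l" "l < r"
    then have xl: "x l \<in> \<sigma>" "h l = path_pos (x l)" "x (Suc l) \<in> \<sigma>" "h (Suc l) = path_pos (x (Suc l))"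
      using x by auto
    then have "fst (x l) \<le> fst (x (Suc l))"
      using path_pos_less_imp_le[OF \<sigma>] inc[OF l] by simp
    moreover have "odd (fst (x l) + fst (x (Suc l)))"
      using even_path_pos[of "x l"] even_path_pos[of "x (Suc l)"] inc[OF l] xl by (simp add: even_add)
    then have "fst (x l) \<noteq> fst (x (Suc l))" by auto
    ultimately show "fst (x l) < fst (x (Suc l))" by simp
  qed (rule k)
  then have "x k = (k, snd (x k))" by (simp add: prod_eq_iff)
  then show thesis using that[of "snd (x k)"] x[OF k] by simp
qed

lemma staircase_transversal:
  assumes \<sigma>: "\<sigma> \<in> staircases r s" and x: "x \<in> \<sigma>"
  obtains c where "\<And>k. k \<in> {1..r} \<Longrightarrow> (k, c k) \<in> \<sigma>" "c (fst x) = snd x"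
    "\<And>k l. 1 \<le> k \<Longrightarrow> k < l \<Longrightarrow> l \<le> r \<Longrightarrow> path_pos (k, c k) < path_pos (l, c l)"
proof -
  have "\<forall>k\<in>{1..r}. \<exists>j. (k, j) \<in> \<sigma>" using staircases_row[OF \<sigma>] by metis
  then obtain c0 where c0: "\<And>k. k \<in> {1..r} \<Longrightarrow> (k, c0 k) \<in> \<sigma>" by metis
  \<comment> \<open>Overriding the choice in one row forces the transversal through
    \<open>x\<close>.\<close>
  define c where "c = c0(fst x := snd x)"
  have c: "(k, c k) \<in> \<sigma>" if "k \<in> {1..r}" for k using c0[OF that] x by (simp add: c_def)
  have "path_pos (k, c k) < path_pos (l, c l)" if "1 \<le> k" "k < l" "l \<le> r" for k l
  proof -
    have "\<forall>x\<in>\<sigma>. \<forall>y\<in>\<sigma>. fst x < fst y \<longrightarrow> snd x \<le> snd y"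
      using \<sigma> by (simp add: staircases_def grid_chain_def)
    moreover have "(k, c k) \<in> \<sigma>" "(l, c l) \<in> \<sigma>" using c that by auto
    ultimately have "c k \<le> c l" using that by fastforce
    then show ?thesis using that by (simp add: path_pos_def)
  qed
  then show thesis using that[of c] c by (simp add: c_def)
qed

text \<open>Positions alone do not name grid points, so a transversal of \<open>\<sigma>\<close>
  through \<open>x\<close> is used: its alternating positions also occur in \<open>\<tau>\<close>,
  where \<open>alternating_rows\<close> puts each of them in the same row, and row and position
  determine the column.\<close>

lemma staircases_path_pos_mono:
  assumes \<sigma>: "\<sigma> \<in> staircases r s" and \<tau>: "\<tau> \<in> staircases r s"
    and sub: "path_pos ` \<sigma> \<subseteq> path_pos ` \<tau>"
  shows "\<sigma> \<subseteq> \<tau>"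
proof
  fix x assume x: "x \<in> \<sigma>"
  obtain c where c: "\<And>k. k \<in> {1..r} \<Longrightarrow> (k, c k) \<in> \<sigma>" "c (fst x) = snd x"
    "\<And>k l. 1 \<le> k \<Longrightarrow> k < l \<Longrightarrow> l \<le> r \<Longrightarrow> path_pos (k, c k) < path_pos (l, c l)"
    using staircase_transversal[OF \<sigma> x] by blast
  have boxes: "\<sigma> \<subseteq> {1..r} \<times> {1..s}" "\<tau> \<subseteq> {1..r} \<times> {1..s}" and \<tau>g: "grid_chain r s \<tau>"
    using \<sigma> \<tau> by (auto simp: staircases_def grid_chain_def)
  have fx: "fst x \<in> {1..r}" using x boxes by auto
  obtain j where j: "(fst x, j) \<in> \<tau>" "path_pos (fst x, c (fst x)) = path_pos (fst x, j)"
  proof (rule alternating_rows[OF \<tau>g, where h = "\<lambda>k. path_pos (k, c k)" and k = "fst x"])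
    fix k assume "k \<in> {1..r}"
    then show "path_pos (k, c k) \<in> path_pos ` \<tau>" using c(1) sub by blast
  next
    fix k assume "1 \<le> k" "k < r"
    then show "path_pos (k, c k) < path_pos (Suc k, c (Suc k)) \<and>
        odd (path_pos (k, c k) + path_pos (Suc k, c (Suc k)))"
      using c(3)[of k "Suc k"] by (simp add: path_pos_def)
  qed (use fx in auto)
  have "1 \<le> j" "1 \<le> snd x" using j(1) x boxes by auto
  then have "j = snd x" using j(2) c(2) by (simp add: path_pos_def)
  then show "x \<in> \<tau>" using j(1) by simp
qed

section \<open>Rank functions and gap sets of facets\<close>

definition rank_in :: "nat set \<Rightarrow> nat \<Rightarrow> nat" where
  "rank_in R x = card {y \<in> R. y \<le> x}"

lemma rank_in_mono: "finite R \<Longrightarrow> x \<le> y \<Longrightarrow> rank_in R x \<le> rank_in R y"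
  unfolding rank_in_def by (intro card_mono) auto

lemma rank_in_le_card: "finite R \<Longrightarrow> rank_in R x \<le> card R"
  unfolding rank_in_def by (intro card_mono) auto

lemma rank_in_add_card_greater:
  assumes "finite R"
  shows "rank_in R x + card {y \<in> R. x < y} = card R"
proof -
  have "R = {y \<in> R. y \<le> x} \<union> {y \<in> R. x < y}" by auto
  moreover have "card ({y \<in> R. y \<le> x} \<union> {y \<in> R. x < y}) = rank_in R x + card {y \<in> R. x < y}"
    unfolding rank_in_def using assms by (intro card_Un_disjoint) auto
  ultimately show ?thesis by simp
qed

text \<open>The indicators stand on both sides to avoid truncated subtraction.\<close>

lemma rank_in_swap:
  assumes "finite R" "p \<in> R" "x \<notin> R"
  shows "rank_in (insert x (R - {p})) y + (if p \<le> y then 1 else 0) = rank_in R y + (if x \<le> y then 1 else 0)"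
proof -
  have "{z \<in> insert x (R - {p}). z \<le> y} =
      (if x \<le> y then insert x ({z \<in> R. z \<le> y} - {p}) else {z \<in> R. z \<le> y} - {p})" by auto
  moreover have "card ({z \<in> R. z \<le> y} - {p}) + (if p \<le> y then 1 else 0) = card {z \<in> R. z \<le> y}"
  proof (cases "p \<le> y")
    case True
    then have "p \<in> {z \<in> R. z \<le> y}" using assms by simp
    then show ?thesis using True assms(1) card_Suc_Diff1[of "{z \<in> R. z \<le> y}" p] by simp
  qed simp
  ultimately show ?thesis unfolding rank_in_def using assms by auto
qed

lemma rank_in_image:
  assumes "\<And>k l. 1 \<le> k \<Longrightarrow> k < l \<Longrightarrow> l \<le> r \<Longrightarrow> h k < h l" and k: "k \<in> {1..r}"
  shows "rank_in (h ` {1..r}) (h k) = k"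
proof -
  have less: "h l \<le> h k \<longleftrightarrow> l \<le> k" if "l \<in> {1..r}" for l
    using assms(1)[of l k] assms(1)[of k l] that k
    by (cases l k rule: linorder_cases) auto
  have "{y \<in> h ` {1..r}. y \<le> h k} = h ` {1..k}"
    using less k by (auto simp: image_iff)
  moreover have "inj_on h {1..k}"
  proof (rule inj_onI)
    fix a b assume "a \<in> {1..k}" "b \<in> {1..k}" "h a = h b"
    then show "a = b" using assms(1)[of a b] assms(1)[of b a] k
      by (cases a b rule: linorder_cases) auto
  qed
  ultimately show ?thesis by (simp add: rank_in_def card_image)
qed

lemma rank_in_enumeration:
  fixes R :: "nat set"
  assumes "finite R"
  obtains h where "R = h ` {1..card R}"
    "\<And>k l. 1 \<le> k \<Longrightarrow> k < l \<Longrightarrow> l \<le> card R \<Longrightarrow> h k < h l"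
proof -
  obtain g where g: "bij_betw g {..<card R} R" "strict_mono_on {..<card R} g"
    using ex_bij_betw_strict_mono_card[OF assms] .
  have "{..<card R} = (\<lambda>k. k - 1) ` {1..card R}"
    by (auto simp: image_iff intro!: bexI[of _ "Suc _"])
  then have "R = (\<lambda>k. g (k - 1)) ` {1..card R}"
    using bij_betw_imp_surj_on[OF g(1)] by (simp add: image_image)
  moreover have "g (k - 1) < g (l - 1)" if "1 \<le> k" "k < l" "l \<le> card R" for k l
    using strict_mono_onD[OF g(2), of "k - 1" "l - 1"] that by simp
  ultimately show thesis using that by blast
qed

text \<open>Complements of lower and of upper facets: by Gale's evenness condition, the parities of the
  elements of the complement of a facet alternate.\<close>

definition lower_gaps :: "nat \<Rightarrow> nat set \<Rightarrow> bool" where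
  "lower_gaps r R \<longleftrightarrow> finite R \<and> card R = r \<and> (\<forall>x\<in>R. even (x + rank_in R x))"

definition upper_gaps :: "nat \<Rightarrow> nat set \<Rightarrow> bool" where
  "upper_gaps r R \<longleftrightarrow> finite R \<and> card R = r \<and> (\<forall>x\<in>R. odd (x + rank_in R x))"

text \<open>By \<open>alternating_rows\<close> the least element of \<open>R\<close> would lie in
  row 1 and be odd, but the least element of an upper gap set is even.\<close>

lemma staircases_no_upper_gaps:
  assumes \<sigma>: "\<sigma> \<in> staircases r s" and "r \<ge> 1" and R: "R \<subseteq> path_pos ` \<sigma>"
  shows "\<not> upper_gaps r R"
proof
  assume up: "upper_gaps r R"
  then have fin: "finite R" and card: "card R = r" by (auto simp: upper_gaps_def)
  obtain h where h: "R = h ` {1..r}" "\<And>k l. 1 \<le> k \<Longrightarrow> k < l \<Longrightarrow> l \<le> r \<Longrightarrow> h k < h l"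
    using rank_in_enumeration[OF fin] card by metis
  have odd: "odd (h k + k)" if "k \<in> {1..r}" for k
  proof -
    have "h k \<in> R" using h(1) that by blast
    moreover have "rank_in R (h k) = k" unfolding h(1) by (rule rank_in_image[where h = h]) (use h(2) that in auto)
    ultimately show ?thesis using up unfolding upper_gaps_def by metis
  qed
  have \<sigma>g: "grid_chain r s \<sigma>" using \<sigma> by (simp add: staircases_def)
  obtain j where j: "h 1 = path_pos (1, j)"
  proof (rule alternating_rows[OF \<sigma>g, where h = h and k = 1])
    fix k assume "k \<in> {1..r}"
    then show "h k \<in> path_pos ` \<sigma>" using h(1) R by blast
  next
    fix k assume "1 \<le> k" "k < r"
    then show "h k < h (Suc k) \<and> odd (h k + h (Suc k))"
      using h(2)[of k "Suc k"] odd[of k] odd[of "Suc k"] by auto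
  qed (use \<open>r \<ge> 1\<close> in auto)
  then have "even (h 1 + 1)" using even_path_pos[of "(1, j)"] by simp
  then show False using odd[of 1] \<open>r \<ge> 1\<close> by simp
qed

text \<open>The \<open>k\<close>-th position of a transversal comes from row \<open>k\<close> and
  hence has the parity of its rank.\<close>

lemma staircases_lower_gaps:
  assumes \<sigma>: "\<sigma> \<in> staircases r s" and x: "x \<in> \<sigma>"
  obtains R where "R \<subseteq> path_pos ` \<sigma>" "lower_gaps r R" "path_pos x \<in> R"
proof -
  obtain c where c: "\<And>k. k \<in> {1..r} \<Longrightarrow> (k, c k) \<in> \<sigma>" "c (fst x) = snd x"
    "\<And>k l. 1 \<le> k \<Longrightarrow> k < l \<Longrightarrow> l \<le> r \<Longrightarrow> path_pos (k, c k) < path_pos (l, c l)"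
    using staircase_transversal[OF \<sigma> x] by blast
  define h where "h k = path_pos (k, c k)" for k
  have h: "h k < h l" if "1 \<le> k" "k < l" "l \<le> r" for k l using c(3)[OF that] by (simp add: h_def)
  have "inj_on h {1..r}"
  proof (rule inj_onI)
    fix a b assume "a \<in> {1..r}" "b \<in> {1..r}" "h a = h b"
    then show "a = b" using h[of a b] h[of b a] by (cases a b rule: linorder_cases) auto
  qed
  moreover have "even (h k + rank_in (h ` {1..r}) (h k))" if "k \<in> {1..r}" for k
  proof -
    have "rank_in (h ` {1..r}) (h k) = k" by (rule rank_in_image[where h = h]) (use h that in auto)
    then show ?thesis using even_path_pos[of "(k, c k)"] by (simp add: h_def)
  qed
  ultimately have "lower_gaps r (h ` {1..r})" by (auto simp: lower_gaps_def card_image)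
  moreover have "fst x \<in> {1..r}" using \<sigma> x by (auto simp: staircases_def grid_chain_def)
  then have "path_pos x \<in> h ` {1..r}"
    using c(2) by (intro image_eqI[of _ _ "fst x"]) (auto simp: h_def)
  moreover have "h ` {1..r} \<subseteq> path_pos ` \<sigma>" using c(1) by (auto simp: h_def)
  ultimately show thesis using that by blast
qed

text \<open>Inverts the passage to positions. Row and position determine the column, so it is enough
  to find for each position a row of the right parity; exchanges between \<open>S\<close> and an
  extremal lower gap set \<open>R\<close> show that the rank in \<open>R\<close> is such a
  row.\<close>

lemma staircase_of_gaps:
  assumes r: "r \<ge> 1" and s: "s \<ge> 1" and S: "S \<subseteq> {1..r + 2 * (s - 1)}"
    and low: "\<exists>R\<subseteq>S. lower_gaps r R" and up: "\<And>R. R \<subseteq> S \<Longrightarrow> \<not> upper_gaps r R"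
  obtains \<sigma> where "\<sigma> \<in> staircases r s" "path_pos ` \<sigma> = S"
proof -
  text \<open>The lower set with the smallest sum consists of the first elements of the maximal runs of
    elements of equal parity, so its rank function numbers the runs.\<close>
  obtain R where R: "R \<subseteq> S" "lower_gaps r R"
    and least: "\<And>R'. R' \<subseteq> S \<Longrightarrow> lower_gaps r R' \<Longrightarrow> \<Sum>R \<le> \<Sum>R'"
  proof -
    obtain R0 where R0: "R0 \<subseteq> S \<and> lower_gaps r R0" using low by blast
    have "\<exists>R. (R \<subseteq> S \<and> lower_gaps r R) \<and> (\<forall>R'. R' \<subseteq> S \<and> lower_gaps r R' \<longrightarrow> \<Sum>R \<le> \<Sum>R')"
      by (rule ex_has_least_nat[where P = "\<lambda>R. R \<subseteq> S \<and> lower_gaps r R"]) (rule R0)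
    then show thesis using that by meson
  qed
  have fin: "finite R" and card: "card R = r" and ev: "\<And>x. x \<in> R \<Longrightarrow> even (x + rank_in R x)"
    using R(2) by (auto simp: lower_gaps_def)
  have ne: "R \<noteq> {}" using card r by auto
  have key: "1 \<le> rank_in R x \<and> even (x + rank_in R x)" if x: "x \<in> S" for x
  proof (cases "x \<in> R")
    case True
    then have "{x} \<subseteq> {y \<in> R. y \<le> x}" by auto
    then have "card {x} \<le> rank_in R x" unfolding rank_in_def using fin by (intro card_mono) auto
    then show ?thesis using ev True by simp
  next
    case False
    let ?swap = "\<lambda>p. insert x (R - {p})"
    have sub: "?swap p \<subseteq> S" for p using R(1) x by blast
    have swap: "finite (?swap p)" "card (?swap p) = r" if "p \<in> R" for p
      using fin card False that r by (auto simp: card_insert_if card_Diff_singleton)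
    \<comment> \<open>Suppose the parity is wrong. If \<open>R\<close> has an element beyond
      \<open>x\<close>, replacing the next one by \<open>x\<close> gives a lower gap set of smaller
      sum. If not, dropping \<open>Min R\<close> and appending \<open>x\<close> lowers the ranks of
      all kept elements by one, which gives an upper gap set.\<close>
    have "even (x + rank_in R x)"
    proof (rule ccontr)
      assume odd: "odd (x + rank_in R x)"
      show False
      proof (cases "{y \<in> R. x < y} = {}")
        case True
        then have lt: "y < x" if "y \<in> R" for y using that False by (cases y x rule: linorder_cases) auto
        define p where "p = Min R"
        have p: "p \<in> R" "\<And>y. y \<in> R \<Longrightarrow> p \<le> y" using fin ne by (auto simp: p_def)
        have "odd (y + rank_in (?swap p) y)" if "y \<in> ?swap p" for y
        proof (cases "y = x")
          case True
          then show ?thesis using rank_in_swap[OF fin p(1) False, of y] lt[OF p(1)] odd by simp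
        next
          case False
          then have y: "y \<in> R" using that by simp
          have "rank_in (?swap p) y + 1 = rank_in R y"
            using rank_in_swap[OF fin p(1) \<open>x \<notin> R\<close>, of y] lt[OF y] p(2)[OF y] by simp
          then show ?thesis using ev[OF y] by presburger
        qed
        then have "upper_gaps r (?swap p)" using swap[OF p(1)] by (simp add: upper_gaps_def)
        then show False using up sub by blast
      next
        case ne': False
        define p where "p = Min {y \<in> R. x < y}"
        have "p \<in> {y \<in> R. x < y}" unfolding p_def using fin ne' by (intro Min_in) auto
        then have p: "p \<in> R" "x < p" by auto
        have pmin: "p \<le> y" if "y \<in> R" "x < y" for y
          unfolding p_def using fin that by (intro Min_le) auto
        have "even (y + rank_in (?swap p) y)" if "y \<in> ?swap p" for y
        proof (cases "y = x")
          case True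
          then show ?thesis using rank_in_swap[OF fin p(1) False, of y] p odd by simp
        next
          case ne'': False
          then have y: "y \<in> R" "y \<noteq> p" using that by auto
          have "p \<le> y \<longleftrightarrow> x \<le> y" using pmin[OF y(1)] p(2) ne'' by auto
          then show ?thesis using rank_in_swap[OF fin p(1) False, of y] ev[OF y(1)] by simp
        qed
        then have "lower_gaps r (?swap p)" using swap[OF p(1)] by (simp add: lower_gaps_def)
        then have "\<Sum>R \<le> \<Sum>(?swap p)" using least sub by blast
        moreover have "\<Sum>(?swap p) = x + \<Sum>(R - {p})" using fin False by simp
        moreover have "\<Sum>R = p + \<Sum>(R - {p})" using fin p(1) by (rule sum.remove)
        ultimately show False using p(2) by simp
      qed
    qed
    \<comment> \<open>Otherwise \<open>x\<close> is even and precedes all of \<open>R\<close>;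
      putting it in place of \<open>Max R\<close> raises the ranks of the kept elements by one and
      gives an upper gap set.\<close>
    moreover have "rank_in R x \<noteq> 0"
    proof
      assume "rank_in R x = 0"
      then have "{y \<in> R. y \<le> x} = {}" using fin by (simp add: rank_in_def)
      then have gt: "x < y" if "y \<in> R" for y using that by force
      define p where "p = Max R"
      have p: "p \<in> R" "\<And>y. y \<in> R \<Longrightarrow> y \<le> p" using fin ne by (auto simp: p_def)
      have "odd (y + rank_in (?swap p) y)" if "y \<in> ?swap p" for y
      proof (cases "y = x")
        case True
        then show ?thesis
          using rank_in_swap[OF fin p(1) False, of y] gt[OF p(1)] \<open>rank_in R x = 0\<close>
            \<open>even (x + rank_in R x)\<close> by simp
      next
        case ne': False
        then have y: "y \<in> R" "y \<noteq> p" using that by auto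
        then have "\<not> p \<le> y" "x \<le> y" using p(2)[OF y(1)] gt[OF y(1)] by auto
        then show ?thesis using rank_in_swap[OF fin p(1) False, of y] ev[OF y(1)] by simp
      qed
      then have "upper_gaps r (?swap p)" using swap[OF p(1)] by (simp add: upper_gaps_def)
      then show False using up sub by blast
    qed
    ultimately show ?thesis by simp
  qed
  have Rpos: "R \<subseteq> {1..r + 2 * (s - 1)}" using R(1) S by blast
  have le: "rank_in R x \<le> x" for x
  proof -
    have "card {y \<in> R. y \<le> x} \<le> card {1..x}" using Rpos by (intro card_mono) auto
    then show ?thesis by (simp add: rank_in_def)
  qed
  \<comment> \<open>All but \<open>rank_in R x\<close> of the \<open>r\<close> elements of
    \<open>R\<close> lie beyond \<open>x\<close>, which leaves at most \<open>2 * (s - 1)\<close>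
    for the difference. This keeps the column at most \<open>s\<close>.\<close>
  have bound: "x - rank_in R x \<le> 2 * (s - 1)" if "x \<in> S" for x
  proof -
    have "card {y \<in> R. x < y} \<le> card {x<..r + 2 * (s - 1)}" using Rpos by (intro card_mono) auto
    moreover have "x \<le> r + 2 * (s - 1)" using that S by auto
    ultimately show ?thesis using rank_in_add_card_greater[OF fin, of x] card by simp
  qed
  \<comment> \<open>The rank grows by at most one per unit, so \<open>x - rank_in R x\<close> is
    monotone, and with it the column.\<close>
  have lip: "rank_in R y \<le> rank_in R x + (y - x)" if "x \<le> y" for x y
  proof -
    have "{z \<in> R. z \<le> y} \<subseteq> {z \<in> R. z \<le> x} \<union> {x<..y}" by auto
    then have "rank_in R y \<le> card ({z \<in> R. z \<le> x} \<union> {x<..y})"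
      unfolding rank_in_def using fin by (intro card_mono) auto
    also have "\<dots> \<le> rank_in R x + card {x<..y}" unfolding rank_in_def by (rule card_Un_le)
    finally show ?thesis by simp
  qed
  \<comment> \<open>The row is the rank, and the column solves the equation defining
    \<open>path_pos\<close>; the division is exact by \<open>key\<close>.\<close>
  define g where "g x = (rank_in R x, (x - rank_in R x) div 2 + 1)" for x
  have pos: "path_pos (g x) = x" if "x \<in> S" for x
    using key[OF that] le[of x] by (auto simp: path_pos_def g_def)
  have "g ` S \<subseteq> {1..r} \<times> {1..s}"
  proof
    fix z assume "z \<in> g ` S"
    then obtain x where x: "x \<in> S" "z = g x" by auto
    then show "z \<in> {1..r} \<times> {1..s}"
      using key[OF x(1)] rank_in_le_card[OF fin, of x] card bound[OF x(1)] s by (auto simp: g_def)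
  qed
  moreover have "\<forall>x\<in>g ` S. \<forall>y\<in>g ` S. fst x < fst y \<longrightarrow> snd x \<le> snd y"
  proof (intro ballI impI)
    fix u v assume "u \<in> g ` S" "v \<in> g ` S" and lt: "fst u < fst v"
    then obtain x y where xy: "u = g x" "v = g y" by auto
    have "x < y" using lt rank_in_mono[OF fin, of y x] xy by (force simp: g_def)
    then have "x - rank_in R x \<le> y - rank_in R y" using lip[of x y] le[of x] by simp
    then show "snd u \<le> snd v" unfolding xy g_def by (simp add: div_le_mono)
  qed
  moreover have "{1..r} \<subseteq> fst ` g ` S"
  proof
    fix k assume k: "k \<in> {1..r}"
    obtain h where h: "R = h ` {1..r}" "\<And>k l. 1 \<le> k \<Longrightarrow> k < l \<Longrightarrow> l \<le> r \<Longrightarrow> h k < h l"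
      using rank_in_enumeration[OF fin] card by metis
    have "rank_in R (h k) = k" unfolding h(1) by (rule rank_in_image[where h = h]) (use h(2) k in auto)
    moreover have "h k \<in> S" using h(1) k R(1) by blast
    ultimately show "k \<in> fst ` g ` S" unfolding g_def image_image by force
  qed
  ultimately have "g ` S \<in> staircases r s" by (simp add: staircases_def grid_chain_def)
  moreover have "path_pos ` g ` S = S" using pos by (force simp: image_image)
  ultimately show thesis using that by blast
qed

text \<open>Translates Gale's count into ranks: beyond \<open>x\<close> there are
  \<open>n - x\<close> numbers, of which \<open>card R - rank_in R x\<close> lie in
  \<open>R\<close>, so the count plus \<open>x\<close> is \<open>d + rank_in R x\<close>.\<close>

lemma even_card_greater_iff:
  assumes R: "R \<subseteq> {1..n}" "card R + d = n" and d: "even d" and x: "x \<in> R"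
  shows "even (card {k \<in> {1..n} - R. x < k}) \<longleftrightarrow> even (x + rank_in R x)"
proof -
  have fin: "finite R" using R(1) finite_subset by blast
  have "{x<..n} = {k \<in> {1..n} - R. x < k} \<union> {k \<in> R. x < k}" using R(1) by auto
  then have "card {x<..n} = card {k \<in> {1..n} - R. x < k} + card {k \<in> R. x < k}"
    using fin by (simp add: card_Un_disjoint disjoint_iff)
  then have "card {k \<in> {1..n} - R. x < k} + x = d + rank_in R x"
  proof -
    have "1 \<le> x" "x \<le> n" using R(1) x by auto
    moreover have "card {x<..n} = n - x" by simp
    ultimately show ?thesis
      using rank_in_add_card_greater[OF fin, of x] R(2)
        \<open>card {x<..n} = card {k \<in> {1..n} - R. x < k} + card {k \<in> R. x < k}\<close> by linarith
  qed
  then have "even (card {k \<in> {1..n} - R. x < k} + x) = even (d + rank_in R x)" by simp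
  then show ?thesis using d by (auto simp: even_add)
qed

section \<open>The polar of a cyclic polytope\<close>

text \<open>Allows a point of the polar to be perturbed in either direction without violating the
  finitely many inequalities that are strict there.\<close>

lemma finite_small_scalar:
  fixes a c :: "'i \<Rightarrow> real"
  assumes "finite A" "\<And>i. i \<in> A \<Longrightarrow> 0 < a i"
  obtains \<epsilon> where "\<epsilon> > 0" "\<And>i. i \<in> A \<Longrightarrow> \<epsilon> * \<bar>c i\<bar> \<le> a i"
proof -
  have "\<exists>\<epsilon>>0. \<forall>i\<in>A. \<epsilon> * \<bar>c i\<bar> \<le> a i"
    using assms
  proof (induction A rule: finite_induct)
    case empty
    show ?case by (auto intro: exI[of _ 1])
  next
    case (insert x F)
    then obtain \<epsilon> where \<epsilon>: "\<epsilon> > 0" "\<forall>i\<in>F. \<epsilon> * \<bar>c i\<bar> \<le> a i" by auto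
    \<comment> \<open>The added 1 keeps the denominator positive when
      \<open>c x = 0\<close>.\<close>
    define \<delta> where "\<delta> = a x / (\<bar>c x\<bar> + 1)"
    have \<delta>: "\<delta> > 0" using insert.prems[of x] by (simp add: \<delta>_def add_nonneg_pos)
    have "\<delta> * \<bar>c x\<bar> \<le> \<delta> * (\<bar>c x\<bar> + 1)" using \<delta> by (intro mult_left_mono) auto
    also have "\<dots> = a x" using add_nonneg_pos[of "\<bar>c x\<bar>" 1] by (simp add: \<delta>_def)
    finally have "\<delta> * \<bar>c x\<bar> \<le> a x" .
    moreover have "min \<epsilon> \<delta> * \<bar>c i\<bar> \<le> \<epsilon> * \<bar>c i\<bar>" "min \<epsilon> \<delta> * \<bar>c i\<bar> \<le> \<delta> * \<bar>c i\<bar>" for i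
      by (intro mult_right_mono; simp)+
    ultimately show ?case using \<epsilon> \<delta>
      by (intro exI[of _ "min \<epsilon> \<delta>"]) (auto intro: order_trans)
  qed
  then show thesis using that by blast
qed

locale cyclic_polar =
  fixes b :: "nat \<Rightarrow> 'c::euclidean_space" and r d n :: nat and t :: "nat \<Rightarrow> real" and p :: 'c
  assumes inj_b: "inj_on b {1..d}" and b_Basis: "b ` {1..d} \<subseteq> Basis"
    and r: "r \<ge> 1" and n: "n = r + d" and d: "even d"
    and t: "strict_mono_on {1..n} t"
    and p: "p \<in> rel_interior (cyclic_polytope b d n t)"
begin

abbreviation "V \<equiv> span (b ` {1..d})"
abbreviation "P \<equiv> cyclic_polytope b d n t"
abbreviation "Q \<equiv> polar_cyclic_polytope b d n t p"
abbreviation "m i \<equiv> moment_curve b d (t i)"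

text \<open>The value at node \<open>i\<close> of the affine function attached to \<open>y\<close>,
  normalised to take the value 1 at \<open>p\<close>.\<close>

definition slack :: "'c \<Rightarrow> nat \<Rightarrow> real" where
  "slack y i = 1 - (m i - p) \<bullet> y"

definition tight :: "'c \<Rightarrow> nat set" where
  "tight y = {i \<in> {1..n}. slack y i = 0}"

text \<open>Different index sets may cut out the same face; the canonical choice is the tight set of
  a generic point of it.\<close>

definition face :: "nat set \<Rightarrow> 'c set" where
  "face I = {y \<in> Q. I \<subseteq> tight y}"

lemma tight_subset: "tight y \<subseteq> {1..n}"
  by (auto simp: tight_def)

lemma finite_tight: "finite (tight y)"
  using tight_subset finite_subset by blast

lemma inner_b:
  assumes "k \<in> {1..d}" "l \<in> {1..d}"
  shows "b k \<bullet> b l = (if k = l then 1 else 0)"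
proof -
  have "b k \<in> Basis" "b l \<in> Basis" using b_Basis assms by blast+
  then show ?thesis using inj_onD[OF inj_b _ assms] by (auto simp: inner_Basis)
qed

lemma moment_curve_in_V: "moment_curve b d x \<in> V"
  unfolding moment_curve_def by (intro span_sum span_scale span_base) auto

lemma V_eq_0:
  assumes "z \<in> V" "\<And>k. k \<in> {1..d} \<Longrightarrow> z \<bullet> b k = 0"
  shows "z = 0"
proof -
  have "orthogonal z z"
    by (rule orthogonal_to_span[OF assms(1)]) (use assms(2) in \<open>auto simp: orthogonal_def\<close>)
  then show ?thesis by (simp add: orthogonal_def)
qed

lemma dim_V: "dim V = d"
proof -
  have "independent (b ` {1..d})" using b_Basis independent_Basis independent_mono by blast
  then show ?thesis using inj_b by (simp add: dim_eq_card_independent card_image)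
qed

lemma inner_moment_curve: "z \<bullet> moment_curve b d x = (\<Sum>k=1..d. (z \<bullet> b k) * x ^ k)"
  by (simp add: moment_curve_def inner_sum_right mult.commute)

text \<open>Affine functions restricted to the moment curve are exactly the polynomials of degree at most
  \<open>d\<close>.\<close>

lemma polynomial_of_affine:
  assumes "z \<in> V" "c \<noteq> 0 \<or> z \<noteq> 0"
  obtains q :: "real poly" where "q \<noteq> 0" "degree q \<le> d"
    "\<forall>x. poly q x = c + z \<bullet> moment_curve b d x"
proof -
  define q where "q = [:c:] + (\<Sum>k=1..d. monom (z \<bullet> b k) k)"
  have "degree (\<Sum>k=1..d. monom (z \<bullet> b k) k) \<le> d"
    by (rule degree_sum_le) (auto intro: order_trans[OF degree_monom_le])
  then have "degree q \<le> d" unfolding q_def by (intro degree_add_le) auto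
  moreover have "poly q x = c + z \<bullet> moment_curve b d x" for x
    by (simp add: q_def poly_sum poly_monom inner_moment_curve)
  moreover have "q \<noteq> 0"
  proof
    assume "q = 0"
    have "coeff q k = (if k = 0 then c else 0) + (if k \<in> {1..d} then z \<bullet> b k else 0)" for k
      by (auto simp: q_def coeff_sum coeff_pCons split: nat.splits)
    then have coeffs: "(if k = 0 then c else 0) + (if k \<in> {1..d} then z \<bullet> b k else 0) = 0" for k
      using \<open>q = 0\<close> by simp
    have "c = 0" using coeffs[of 0] by simp
    moreover have "z = 0" by (rule V_eq_0[OF assms(1)]) (use coeffs in \<open>force split: if_splits\<close>)
    ultimately show False using assms(2) by simp
  qed
  ultimately show thesis using that by blast
qed

lemma affine_of_polynomial:
  fixes q :: "real poly"
  assumes "degree q \<le> d" "q \<noteq> 0"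
  obtains c z where "z \<in> V" "c \<noteq> 0 \<or> z \<noteq> 0" "\<forall>x. poly q x = c + z \<bullet> moment_curve b d x"
proof -
  define z where "z = (\<Sum>k=1..d. coeff q k *\<^sub>R b k)"
  have zV: "z \<in> V" unfolding z_def by (intro span_sum span_scale span_base) auto
  have zb: "z \<bullet> b k = coeff q k" if k: "k \<in> {1..d}" for k
  proof -
    have "z \<bullet> b k = (\<Sum>l=1..d. coeff q l * (if l = k then 1 else 0))"
      unfolding z_def inner_sum_left inner_scaleR_left
      by (rule sum.cong) (use inner_b k in auto)
    also have "\<dots> = coeff q k" using k by (simp add: if_distrib[of "times _"] cong: if_cong)
    finally show ?thesis .
  qed
  have eval: "poly q x = coeff q 0 + z \<bullet> moment_curve b d x" for x
  proof -
    have "poly q x = (\<Sum>k\<le>d. coeff q k * x ^ k)"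
      unfolding poly_altdef using assms(1)
      by (intro sum.mono_neutral_left) (auto simp: coeff_eq_0)
    also have "{..d} = insert 0 {1..d}" by auto
    also have "(\<Sum>k\<in>insert 0 {1..d}. coeff q k * x ^ k) = coeff q 0 + (\<Sum>k=1..d. coeff q k * x ^ k)"
      by simp
    also have "(\<Sum>k=1..d. coeff q k * x ^ k) = z \<bullet> moment_curve b d x"
      unfolding inner_moment_curve using zb by (intro sum.cong) auto
    finally show ?thesis .
  qed
  have "coeff q 0 \<noteq> 0 \<or> z \<noteq> 0"
  proof (rule ccontr)
    assume "\<not> ?thesis"
    then have "poly q x = 0" for x using eval by simp
    then show False using assms(2) poly_all_0_iff_0 by blast
  qed
  then show thesis using that zV eval by blast
qed

lemma inj_t: "inj_on t {1..n}"
  using t by (rule strict_mono_on_imp_inj_on)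

lemma card_roots:
  fixes q :: "real poly"
  assumes "q \<noteq> 0" "degree q \<le> d" "A \<subseteq> {1..n}" "\<And>i. i \<in> A \<Longrightarrow> poly q (t i) = 0"
  shows "card A \<le> d"
proof -
  have "card A = card (t ` A)" using inj_t assms(3) by (metis card_image inj_on_subset)
  also have "\<dots> \<le> card {x. poly q x = 0}"
    using assms(4) poly_roots_finite[OF assms(1)] by (intro card_mono) auto
  also have "\<dots> \<le> degree q" using assms(1) by (rule card_poly_roots_bound)
  finally show ?thesis using assms(2) by simp
qed

lemma card_affine_roots:
  assumes "z \<in> V" "c \<noteq> 0 \<or> z \<noteq> 0" "A \<subseteq> {1..n}" "\<And>i. i \<in> A \<Longrightarrow> c + z \<bullet> m i = 0"
  shows "card A \<le> d"
proof -
  obtain q :: "real poly" where "q \<noteq> 0" "degree q \<le> d"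
    "\<forall>x. poly q x = c + z \<bullet> moment_curve b d x"
    by (rule polynomial_of_affine[OF assms(1,2)])
  then show ?thesis using card_roots[of q A] assms(3,4) by simp
qed

section \<open>Points of the polar as polynomials non-negative at the nodes\<close>

lemma P_eq: "P = convex hull (m ` {1..n})"
  by (simp add: cyclic_polytope_def image_image)

lemma m_in_P: "i \<in> {1..n} \<Longrightarrow> m i \<in> P"
  unfolding P_eq by (intro hull_inc) auto

lemma convex_P: "convex P"
  unfolding P_eq by (rule convex_convex_hull)

text \<open>A direction in \<open>V\<close> orthogonal to all differences of the points would give a
  non-zero polynomial of degree at most \<open>d\<close> vanishing at all \<open>n > d\<close>
  nodes.\<close>

lemma affine_hull_P: "affine hull P = V"
proof -
  let ?D = "(\<lambda>x. - m 1 + x) ` (m ` {1..n} - {m 1})"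
  have 1: "1 \<in> {1..n}" using r n by simp
  have sub: "span ?D \<subseteq> V"
    by (rule span_minimal) (use span_diff[OF moment_curve_in_V moment_curve_in_V] in auto)
  have "span ?D = V"
  proof (rule ccontr)
    assume "span ?D \<noteq> V"
    then have "span ?D \<subset> V" using sub by blast
    then obtain z where z: "z \<noteq> 0" "z \<in> V" "\<And>y. y \<in> span ?D \<Longrightarrow> orthogonal z y"
      using orthogonal_to_subspace_exists_gen by metis
    have "- (z \<bullet> m 1) + z \<bullet> m i = 0" if "i \<in> {1..n}" for i
    proof (cases "m i = m 1")
      case False
      then have "- m 1 + m i \<in> span ?D" using that by (intro span_base) auto
      then have "orthogonal z (- m 1 + m i)" by (rule z(3))
      then show ?thesis by (simp add: orthogonal_def inner_diff_right)
    qed simp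
    then have "card {1..n} \<le> d" using card_affine_roots[OF z(2), of _ "{1..n}"] z(1) by blast
    then show False using r n by simp
  qed
  then have "affine hull P = (+) (m 1) ` V"
    unfolding P_eq affine_hull_convex_hull using affine_hull_span2[of "m 1" "m ` {1..n}"] 1 by simp
  also have "\<dots> = V"
  proof (intro equalityI subsetI)
    fix v assume "v \<in> V"
    then have "v = m 1 + (v - m 1)" "v - m 1 \<in> V" using moment_curve_in_V by (auto intro: span_diff)
    then show "v \<in> (+) (m 1) ` V" by blast
  qed (use moment_curve_in_V in \<open>auto intro: span_add\<close>)
  finally show ?thesis .
qed

lemma p_in_P: "p \<in> P"
  using p rel_interior_subset by blast

lemma p_in_V: "p \<in> V"
  using p_in_P hull_subset[of P affine] unfolding affine_hull_P by (rule rev_subsetD)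

lemma aff_dim_P: "aff_dim P = int d"
  using aff_dim_affine_hull[of P] aff_dim_subspace[of V] dim_V by (simp add: affine_hull_P)

lemma P_le:
  assumes "\<And>i. i \<in> {1..n} \<Longrightarrow> a \<bullet> m i \<le> c" "x \<in> P"
  shows "a \<bullet> x \<le> c"
proof -
  have "P \<subseteq> {x. a \<bullet> x \<le> c}"
    unfolding P_eq using assms(1) by (intro hull_minimal convex_halfspace_le) auto
  then show ?thesis using assms(2) by blast
qed

text \<open>This is where the centre being a relative interior point is used.\<close>

lemma affine_pos_at_p:
  assumes "z \<in> V" "c \<noteq> 0 \<or> z \<noteq> 0" "\<And>i. i \<in> {1..n} \<Longrightarrow> 0 \<le> c + z \<bullet> m i"
  shows "0 < c + z \<bullet> p"
proof (rule ccontr)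
  assume "\<not> ?thesis"
  have le: "(- z) \<bullet> x \<le> c" if "x \<in> P" for x
    by (rule P_le[OF _ that]) (use assms(3) in \<open>fastforce simp: inner_simps\<close>)
  from this[OF p_in_P] have "(- z) \<bullet> p = c" using \<open>\<not> 0 < c + z \<bullet> p\<close> by simp
  \<comment> \<open>The zero set of the affine function is a face through the relative interior
    point \<open>p\<close>, hence all of \<open>P\<close>, which again gives too many roots.\<close>
  then have "P \<inter> {x. (- z) \<bullet> x = c} \<inter> rel_interior P \<noteq> {}" using p p_in_P by blast
  moreover have "P \<inter> {x. (- z) \<bullet> x = c} face_of P"
    using convex_P le by (rule face_of_Int_supporting_hyperplane_le)
  ultimately have "P \<inter> {x. (- z) \<bullet> x = c} = P" using face_of_disjoint_rel_interior by blast
  then have "c + z \<bullet> m i = 0" if "i \<in> {1..n}" for i using m_in_P[OF that] by force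
  then have "card {1..n} \<le> d" using card_affine_roots[OF assms(1,2)] by blast
  then show False using r n by simp
qed

lemma slack_affine: "slack y i = (1 + p \<bullet> y) + (- y) \<bullet> m i"
  by (simp add: slack_def inner_simps inner_commute)

lemma mem_Q: "y \<in> Q \<longleftrightarrow> y \<in> V \<and> (\<forall>i\<in>{1..n}. 0 \<le> slack y i)"
proof
  assume "y \<in> Q"
  then show "y \<in> V \<and> (\<forall>i\<in>{1..n}. 0 \<le> slack y i)"
    using m_in_P by (auto simp: polar_cyclic_polytope_def polar_polytope_def slack_def)
next
  assume y: "y \<in> V \<and> (\<forall>i\<in>{1..n}. 0 \<le> slack y i)"
  have "(x - p) \<bullet> y \<le> 1" if "x \<in> P" for x
  proof -
    have "y \<bullet> x \<le> 1 + p \<bullet> y"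
      by (rule P_le[OF _ that]) (use y in \<open>fastforce simp: slack_affine\<close>)
    then show ?thesis by (simp add: inner_simps inner_commute)
  qed
  then show "y \<in> Q" using y by (simp add: polar_cyclic_polytope_def polar_polytope_def)
qed

text \<open>The non-negative polynomials form a cone, of which the polar is the slice with value 1
  at \<open>p\<close>. Positivity at \<open>p\<close> permits the rescaling into that slice.\<close>

lemma Q_of_polynomial:
  fixes q :: "real poly"
  assumes q: "degree q \<le> d" "q \<noteq> 0" "\<And>i. i \<in> {1..n} \<Longrightarrow> 0 \<le> poly q (t i)"
  obtains y where "y \<in> Q" "tight y = {i \<in> {1..n}. poly q (t i) = 0}"
proof -
  obtain c z where z: "z \<in> V" "c \<noteq> 0 \<or> z \<noteq> 0" "\<forall>x. poly q x = c + z \<bullet> moment_curve b d x"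
    by (rule affine_of_polynomial[OF q(1,2)])
  define L where "L = c + z \<bullet> p"
  have L: "L > 0" unfolding L_def using z q(3) by (intro affine_pos_at_p) auto
  define y where "y = (- 1 / L) *\<^sub>R z"
  have slack: "slack y i = poly q (t i) / L" for i
    using L by (simp add: slack_def y_def z(3) inner_simps field_simps)
      (simp add: L_def inner_simps inner_commute algebra_simps)
  have "y \<in> Q" unfolding mem_Q using z(1) q(3) L slack by (simp add: y_def span_scale span_neg)
  moreover have "tight y = {i \<in> {1..n}. poly q (t i) = 0}" using L by (simp add: tight_def slack)
  ultimately show thesis using that by blast
qed

lemma polynomial_of_slack:
  assumes "y \<in> V"
  obtains q :: "real poly" where "q \<noteq> 0" "degree q \<le> d" "\<forall>i. poly q (t i) = slack y i"
proof -
  have "- y \<in> V" using assms by (rule span_neg)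
  \<comment> \<open>If \<open>y = 0\<close>, the constant term is 1, so the polynomial of a slack
    function is never zero.\<close>
  moreover have "1 + p \<bullet> y \<noteq> 0 \<or> - y \<noteq> 0" by auto
  ultimately obtain q :: "real poly" where "q \<noteq> 0" "degree q \<le> d"
    "\<forall>x. poly q x = (1 + p \<bullet> y) + (- y) \<bullet> moment_curve b d x"
    by (rule polynomial_of_affine)
  then show thesis using that[of q] slack_affine[of y] by simp
qed

lemma card_tight:
  assumes "y \<in> V"
  shows "card (tight y) \<le> d"
proof -
  obtain q :: "real poly" where "q \<noteq> 0" "degree q \<le> d" "\<forall>i. poly q (t i) = slack y i"
    by (rule polynomial_of_slack[OF assms])
  then show ?thesis using card_roots[OF _ _ tight_subset, of q y] by (simp add: tight_def)
qed

lemma slack_convex: "slack ((1 - u) *\<^sub>R x + u *\<^sub>R y) i = (1 - u) * slack x i + u * slack y i"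
  by (simp add: slack_def inner_simps algebra_simps)

lemma slack_add: "slack (y + z) i = slack y i - (m i - p) \<bullet> z"
  by (simp add: slack_def inner_simps)

lemma Q_convex_combination:
  assumes "x \<in> Q" "y \<in> Q" "0 \<le> u" "u \<le> 1"
  shows "(1 - u) *\<^sub>R x + u *\<^sub>R y \<in> Q"
  unfolding mem_Q
proof (intro conjI ballI)
  show "(1 - u) *\<^sub>R x + u *\<^sub>R y \<in> V"
    using assms by (intro span_add span_scale) (simp_all add: mem_Q)
next
  fix i assume "i \<in> {1..n}"
  then have "0 \<le> slack x i" "0 \<le> slack y i" using assms(1,2) by (simp_all add: mem_Q)
  then show "0 \<le> slack ((1 - u) *\<^sub>R x + u *\<^sub>R y) i" using assms(3,4) by (simp add: slack_convex)
qed

lemma tight_convex_combination: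
  assumes "x \<in> Q" "y \<in> Q" "0 < u" "u < 1"
  shows "tight ((1 - u) *\<^sub>R x + u *\<^sub>R y) = tight x \<inter> tight y"
proof -
  have "(1 - u) * slack x i + u * slack y i = 0 \<longleftrightarrow> slack x i = 0 \<and> slack y i = 0"
    if "i \<in> {1..n}" for i
  proof -
    have "0 \<le> slack x i" "0 \<le> slack y i" using assms(1,2) that by (auto simp: mem_Q)
    then have "0 \<le> (1 - u) * slack x i" "0 \<le> u * slack y i" using assms(3,4) by simp_all
    then show ?thesis using assms(3,4) by (simp add: add_nonneg_eq_0_iff)
  qed
  then show ?thesis by (auto simp: tight_def slack_convex)
qed

section \<open>Faces and vertices of the polar\<close>

lemma convex_Q: "convex Q"
  unfolding convex_alt by (simp add: Q_convex_combination)

lemma compact_Q: "compact Q"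
proof -
  have "Q = V \<inter> (\<Inter>i\<in>{1..n}. {y. (m i - p) \<bullet> y \<le> 1})"
    by (auto simp: mem_Q slack_def)
  moreover have "closed (V \<inter> (\<Inter>i\<in>{1..n}. {y. (m i - p) \<bullet> y \<le> 1}))"
    by (intro closed_Int closed_INT ballI closed_halfspace_le closed_subspace subspace_span)
  ultimately have "closed Q" by simp
  obtain e where e: "e > 0" "cball p e \<inter> affine hull P \<subseteq> P"
    using p by (auto simp: mem_rel_interior_cball)
  have "norm y \<le> 1 / e" if y: "y \<in> Q" for y
  proof (cases "y = 0")
    case False
    \<comment> \<open>The point at distance \<open>e\<close> from \<open>p\<close> in the direction
      of \<open>y\<close> is still in \<open>P\<close>, and its inequality reads
      \<open>e * norm y \<le> 1\<close>.\<close>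
    define x where "x = p + (e / norm y) *\<^sub>R y"
    have "y \<in> V" using y by (simp add: mem_Q)
    then have "x \<in> V" unfolding x_def by (intro span_add span_scale p_in_V)
    moreover have "x \<in> cball p e" using e False by (simp add: x_def dist_norm)
    ultimately have "x \<in> P" using e affine_hull_P by blast
    then have "(x - p) \<bullet> y \<le> 1"
      using y by (simp add: polar_cyclic_polytope_def polar_polytope_def)
    then have "e * norm y \<le> 1"
      using False by (simp add: x_def dot_square_norm power2_eq_square)
    then show ?thesis using e by (simp add: field_simps)
  qed (use e in simp)
  then have "bounded Q" by (auto simp: bounded_iff)
  then show ?thesis using \<open>closed Q\<close> by (simp add: compact_eq_bounded_closed)
qed

lemma face_face_of: "face I face_of Q"
  unfolding face_of_def
proof (intro conjI ballI impI)
  show "face I \<subseteq> Q" by (auto simp: face_def)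
  show "convex (face I)"
    unfolding convex_alt
  proof (intro ballI allI impI)
    fix x y :: 'c and u :: real assume x: "x \<in> face I" and y: "y \<in> face I" and u: "0 \<le> u \<and> u \<le> 1"
    have "(1 - u) *\<^sub>R x + u *\<^sub>R y \<in> Q" using x y u Q_convex_combination by (simp add: face_def)
    moreover have "I \<subseteq> tight ((1 - u) *\<^sub>R x + u *\<^sub>R y)"
      using x y unfolding face_def tight_def by (fastforce simp: slack_convex)
    ultimately show "(1 - u) *\<^sub>R x + u *\<^sub>R y \<in> face I" by (simp add: face_def)
  qed
next
  fix a c x assume ac: "a \<in> Q" "c \<in> Q" and x: "x \<in> face I" "x \<in> open_segment a c"
  obtain u where u: "0 < u" "u < 1" "x = (1 - u) *\<^sub>R a + u *\<^sub>R c" using x(2) by (auto simp: in_segment)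
  then have "I \<subseteq> tight a \<inter> tight c" using tight_convex_combination[OF ac u(1,2)] x(1) by (simp add: face_def)
  then show "a \<in> face I" "c \<in> face I" using ac by (auto simp: face_def)
qed

text \<open>Take a point of \<open>G\<close> with the fewest tight indices. Midpoints with other
  points of \<open>G\<close> intersect tight sets, so its tight set lies in all others. Conversely,
  every segment in \<open>face (tight y)\<close> ending at \<open>y\<close> can be prolonged
  slightly beyond \<open>y\<close> inside the polar, and the face property captures its
  start.\<close>

lemma face_of_Q_eq_face:
  assumes G: "G face_of Q" "G \<noteq> {}"
  obtains y where "y \<in> G" "G = face (tight y)"
proof -
  have GQ: "G \<subseteq> Q" using G(1) by (rule face_of_imp_subset)
  have "convex G" using G(1) by (rule face_of_imp_convex)
  obtain y where y: "y \<in> G" "\<And>y'. y' \<in> G \<Longrightarrow> card (tight y) \<le> card (tight y')"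
    using G(2) ex_has_least_nat[of "\<lambda>y. y \<in> G" _ "\<lambda>y. card (tight y)"] by blast
  have "G = face (tight y)"
  proof (intro equalityI subsetI)
    fix y' assume y': "y' \<in> G"
    let ?z = "(1 - 1/2) *\<^sub>R y + (1/2) *\<^sub>R y' :: 'c"
    have "?z \<in> G" using \<open>convex G\<close> y(1) y' by (intro convexD_alt) auto
    then have "card (tight y) \<le> card (tight ?z)" by (rule y(2))
    also have "tight ?z = tight y \<inter> tight y'"
      using y(1) y' GQ by (intro tight_convex_combination) auto
    finally have "card (tight y) \<le> card (tight y \<inter> tight y')" .
    then have "tight y \<inter> tight y' = tight y" by (intro card_seteq finite_tight) auto
    then show "y' \<in> face (tight y)" using y' GQ by (auto simp: face_def)
  next
    fix y' assume "y' \<in> face (tight y)"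
    then have y': "y' \<in> Q" "tight y \<subseteq> tight y'" by (auto simp: face_def)
    have yQ: "y \<in> Q" using y(1) GQ by blast
    show "y' \<in> G"
    proof (cases "y' = y")
      case False
      obtain \<epsilon> where \<epsilon>: "\<epsilon> > 0"
        "\<And>i. i \<in> {1..n} - tight y \<Longrightarrow> \<epsilon> * \<bar>slack y' i - slack y i\<bar> \<le> slack y i"
      proof (rule finite_small_scalar[of "{1..n} - tight y" "slack y" "\<lambda>i. slack y' i - slack y i"])
        fix i assume "i \<in> {1..n} - tight y"
        then show "0 < slack y i" using yQ by (force simp: mem_Q tight_def)
      qed auto
      \<comment> \<open>The point slightly beyond \<open>y\<close> on the line from
        \<open>y'\<close>. The inequalities tight at \<open>y\<close> are tight at \<open>y'\<close>
        too and stay tight; \<open>\<epsilon>\<close> is small enough for the others.\<close>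
      define w where "w = (1 + \<epsilon>) *\<^sub>R y - \<epsilon> *\<^sub>R y'"
      have slack: "slack w i = slack y i - \<epsilon> * (slack y' i - slack y i)" for i
        by (simp add: w_def slack_def inner_simps algebra_simps)
      have "0 \<le> slack w i" if i: "i \<in> {1..n}" for i
      proof (cases "i \<in> tight y")
        case True
        then have "slack y i = 0" "slack y' i = 0" using y'(2) by (auto simp: tight_def)
        then show ?thesis by (simp add: slack)
      next
        case False
        have "\<epsilon> * (slack y' i - slack y i) \<le> \<epsilon> * \<bar>slack y' i - slack y i\<bar>"
          using \<epsilon>(1) by (intro mult_left_mono) auto
        then show ?thesis using \<epsilon>(2)[of i] False i unfolding slack by auto
      qed
      then have "w \<in> Q" using yQ y'(1) by (auto simp: mem_Q w_def intro!: span_diff span_scale)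
      moreover have "y \<in> open_segment y' w"
      proof -
        have "w \<noteq> y'"
        proof
          assume "w = y'"
          then have "(1 + \<epsilon>) *\<^sub>R (y - y') = 0" by (simp add: w_def algebra_simps)
          then show False using \<epsilon>(1) False by simp
        qed
        moreover have "y = (1 - 1 / (1 + \<epsilon>)) *\<^sub>R y' + (1 / (1 + \<epsilon>)) *\<^sub>R w"
        proof -
          have "(1 / (1 + \<epsilon>)) *\<^sub>R w = y - (\<epsilon> / (1 + \<epsilon>)) *\<^sub>R y'"
            using \<epsilon>(1) by (simp add: w_def scaleR_diff_right)
          moreover have "1 - 1 / (1 + \<epsilon>) = \<epsilon> / (1 + \<epsilon>)" using \<epsilon>(1) by (simp add: field_simps)
          ultimately show ?thesis by simp
        qed
        moreover have "0 < 1 / (1 + \<epsilon>)" "1 / (1 + \<epsilon>) < 1" using \<epsilon>(1) by simp_all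
        ultimately show ?thesis unfolding in_segment by metis
      qed
      ultimately show ?thesis using G(1) y'(1) y(1) unfolding face_of_def by blast
    qed (use y(1) in simp)
  qed
  then show thesis using that y(1) by blast
qed

text \<open>If the tight normals did not span, a direction \<open>z\<close> orthogonal to them could
  be followed a little both ways, making \<open>y\<close> the midpoint of a segment.\<close>

lemma extreme_span:
  assumes y: "y extreme_point_of Q"
  shows "span ((\<lambda>i. m i - p) ` tight y) = V"
proof (rule ccontr)
  let ?S = "(\<lambda>i. m i - p) ` tight y"
  assume "span ?S \<noteq> V"
  moreover have "span ?S \<subseteq> V"
    by (rule span_minimal) (use moment_curve_in_V p_in_V in \<open>auto intro: span_diff\<close>)
  ultimately have "span ?S \<subset> V" by blast
  then obtain z where z: "z \<noteq> 0" "z \<in> V" "\<And>x. x \<in> span ?S \<Longrightarrow> orthogonal z x"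
    using orthogonal_to_subspace_exists_gen by metis
  have yQ: "y \<in> Q" using y by (simp add: extreme_point_of_def)
  obtain \<epsilon> where \<epsilon>: "\<epsilon> > 0" "\<And>i. i \<in> {1..n} - tight y \<Longrightarrow> \<epsilon> * \<bar>(m i - p) \<bullet> z\<bar> \<le> slack y i"
  proof (rule finite_small_scalar[of "{1..n} - tight y" "slack y" "\<lambda>i. (m i - p) \<bullet> z"])
    fix i assume "i \<in> {1..n} - tight y"
    then show "0 < slack y i" using yQ by (force simp: mem_Q tight_def)
  qed auto
  have "y + \<delta> *\<^sub>R z \<in> Q" if \<delta>: "\<bar>\<delta>\<bar> = \<epsilon>" for \<delta>
    unfolding mem_Q
  proof (intro conjI ballI)
    show "y + \<delta> *\<^sub>R z \<in> V" using yQ z(2) by (auto simp: mem_Q intro: span_add span_scale)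
  next
    fix i assume i: "i \<in> {1..n}"
    have slack: "slack (y + \<delta> *\<^sub>R z) i = slack y i - \<delta> * ((m i - p) \<bullet> z)"
      by (simp add: slack_add)
    show "0 \<le> slack (y + \<delta> *\<^sub>R z) i"
    proof (cases "i \<in> tight y")
      case True
      then have "m i - p \<in> span ?S" by (intro span_base) auto
      then have "orthogonal z (m i - p)" by (rule z(3))
      then have "(m i - p) \<bullet> z = 0" by (simp add: orthogonal_def inner_commute)
      then show ?thesis using True by (simp add: slack tight_def)
    next
      case False
      have "\<delta> * ((m i - p) \<bullet> z) \<le> \<epsilon> * \<bar>(m i - p) \<bullet> z\<bar>"
        using \<delta> by (metis abs_ge_self abs_mult)
      then show ?thesis using \<epsilon>(2)[of i] i False by (simp add: slack)
    qed
  qed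
  from this[of \<epsilon>] this[of "- \<epsilon>"]
  have "y + \<epsilon> *\<^sub>R z \<in> Q" "y + (- \<epsilon>) *\<^sub>R z \<in> Q" using \<epsilon>(1) by simp_all
  moreover have "y \<in> open_segment (y + \<epsilon> *\<^sub>R z) (y + (- \<epsilon>) *\<^sub>R z)"
  proof -
    have "y + \<epsilon> *\<^sub>R z \<noteq> y + (- \<epsilon>) *\<^sub>R z" using \<epsilon>(1) z(1) by (simp add: eq_neg_iff_add_eq_0 flip: scaleR_add_left)
    moreover have "y = (1 - 1/2) *\<^sub>R (y + \<epsilon> *\<^sub>R z) + (1/2) *\<^sub>R (y + (- \<epsilon>) *\<^sub>R z)"
    proof -
      have "(y + \<epsilon> *\<^sub>R z) + (y + (- \<epsilon>) *\<^sub>R z) = 2 *\<^sub>R y" by (simp add: scaleR_2)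
      then have "(1/2) *\<^sub>R (y + \<epsilon> *\<^sub>R z) + (1/2) *\<^sub>R (y + (- \<epsilon>) *\<^sub>R z) = (1/2) *\<^sub>R 2 *\<^sub>R y"
        unfolding scaleR_add_right[symmetric] by (rule arg_cong)
      then show ?thesis by simp
    qed
    ultimately show ?thesis unfolding in_segment by (intro conjI exI[of _ "1/2"]) auto
  qed
  ultimately show False using y unfolding extreme_point_of_def by blast
qed

text \<open>The polar is simple: a non-zero polynomial of degree at most \<open>d\<close> has at
  most \<open>d\<close> roots, and spanning \<open>V\<close> takes at least \<open>d\<close>
  normals.\<close>

lemma extreme_card:
  assumes "y extreme_point_of Q"
  shows "card (tight y) = d"
proof (rule antisym)
  have "y \<in> V" using assms by (simp add: extreme_point_of_def mem_Q)
  then show "card (tight y) \<le> d" by (rule card_tight)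
  have "dim V \<le> card ((\<lambda>i. m i - p) ` tight y)"
    using extreme_span[OF assms] finite_tight by (intro dim_le_card) auto
  then show "d \<le> card (tight y)" using dim_V card_image_le[OF finite_tight, of "\<lambda>i. m i - p" y] by linarith
qed

lemma extreme_independent:
  assumes "y extreme_point_of Q"
  shows "independent ((\<lambda>i. m i - p) ` tight y)" "inj_on (\<lambda>i. m i - p) (tight y)"
proof -
  let ?S = "(\<lambda>i. m i - p) ` tight y"
  have le: "card ?S \<le> d" using extreme_card[OF assms] card_image_le[OF finite_tight] by metis
  show "independent ?S"
  proof (rule card_le_dim_spanning)
    show "?S \<subseteq> V" using extreme_span[OF assms] span_superset[of ?S] by simp
    show "V \<subseteq> span ?S" using extreme_span[OF assms] by simp
  qed (use le dim_V finite_tight in auto)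
  then have "card ?S = d"
    using dim_span_eq_card_independent extreme_span[OF assms] dim_V by metis
  then show "inj_on (\<lambda>i. m i - p) (tight y)"
    using extreme_card[OF assms] finite_tight eq_card_imp_inj_on by metis
qed

text \<open>At a simple vertex the tight normals are independent, so each of the equations in
  \<open>I\<close> lowers the dimension by one. The face lies in \<open>y\<close> plus the
  orthogonal complement of these normals.\<close>

lemma aff_dim_face:
  assumes y: "y extreme_point_of Q" and I: "I \<subseteq> tight y"
  shows "aff_dim (face I) + int (card I) \<le> int d"
proof -
  let ?S = "(\<lambda>i. m i - p) ` I"
  let ?W = "{z \<in> V. \<forall>x\<in>span ?S. orthogonal x z}"
  have "independent ?S"
    using extreme_independent(1)[OF y] by (rule independent_mono) (use I in auto)
  moreover have "card ?S = card I"
    by (rule card_image) (rule inj_on_subset[OF extreme_independent(2)[OF y] I])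
  ultimately have dimS: "dim (span ?S) = card I" by (simp add: dim_eq_card_independent)
  have "span ?S \<subseteq> V" using span_mono[OF image_mono[OF I], of "\<lambda>i. m i - p"] extreme_span[OF y] by (rule order_trans[OF _ equalityD1])
  then have dimW: "dim ?W + card I = d"
    using dim_subspace_orthogonal_to_vectors[of "span ?S" V] dimS dim_V by simp
  have "face I \<subseteq> (+) y ` ?W"
  proof
    fix x assume x: "x \<in> face I"
    have "x \<in> V" "y \<in> V" using x y by (simp_all add: face_def extreme_point_of_def mem_Q)
    then have "x - y \<in> V" by (rule span_diff)
    moreover have "orthogonal w (x - y)" if "w \<in> span ?S" for w
    proof -
      have "orthogonal (x - y) w"
      proof (rule orthogonal_to_span[OF that])
        fix v assume "v \<in> ?S"
        then obtain i where i: "i \<in> I" "v = m i - p" by auto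
        then have "slack x i = 0" "slack y i = 0" using x I by (auto simp: face_def tight_def)
        then have "(m i - p) \<bullet> x = (m i - p) \<bullet> y" by (simp add: slack_def)
        then show "orthogonal (x - y) v"
          by (simp add: i(2) orthogonal_def inner_diff_left inner_diff_right inner_commute)
      qed
      then show ?thesis by (simp add: orthogonal_commute)
    qed
    ultimately have "x - y \<in> ?W" by blast
    then show "x \<in> (+) y ` ?W" by (intro image_eqI[of _ _ "x - y"]) auto
  qed
  then have "aff_dim (face I) \<le> aff_dim ((+) y ` ?W)" by (rule aff_dim_subset)
  also have "\<dots> = aff_dim ?W" by (rule aff_dim_translation_eq)
  also have "0 \<in> affine hull ?W"
    by (rule hull_inc) (simp add: span_zero orthogonal_def)
  then have "aff_dim ?W = int (dim ?W)" by (rule aff_dim_zero)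
  finally show ?thesis using dimW by linarith
qed

end

section \<open>Gale's evenness condition\<close>

context cyclic_polar
begin

definition node_poly :: "nat set \<Rightarrow> real poly" where
  "node_poly K = (\<Prod>k\<in>K. [:- t k, 1:])"

lemma poly_node_poly: "poly (node_poly K) x = (\<Prod>k\<in>K. x - t k)"
  by (simp add: node_poly_def poly_prod)

lemma node_poly_nonzero: "node_poly K \<noteq> 0"
  unfolding node_poly_def by (cases "finite K") auto

lemma degree_node_poly: "degree (node_poly K) \<le> card K"
proof (cases "finite K")
  case True
  have "degree (node_poly K) \<le> sum (degree \<circ> (\<lambda>k. [:- t k, 1:])) K"
    unfolding node_poly_def using True by (rule degree_prod_sum_le)
  then show ?thesis by simp
qed (simp add: node_poly_def)

text \<open>The factor of \<open>k\<close> is negative at \<open>t i\<close> exactly if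
  \<open>i < k\<close>.\<close>

lemma node_poly_sign:
  assumes "K \<subseteq> {1..n}" "i \<in> {1..n} - K"
  shows "0 < (- 1) ^ card {k \<in> K. i < k} * poly (node_poly K) (t i)"
proof -
  have "finite K" using assms(1) finite_subset by blast
  then show ?thesis using assms
  proof (induction K rule: finite_induct)
    case empty
    then show ?case by (simp add: poly_node_poly)
  next
    case (insert k K)
    have IH: "0 < (- 1) ^ card {k \<in> K. i < k} * poly (node_poly K) (t i)"
      using insert.IH insert.prems by simp
    have poly: "poly (node_poly (insert k K)) (t i) = (t i - t k) * poly (node_poly K) (t i)"
      using insert.hyps by (simp add: poly_node_poly)
    have ki: "k \<noteq> i" "k \<in> {1..n}" "i \<in> {1..n}" using insert.prems by auto
    show ?case
    proof (cases "i < k")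
      case True
      then have "{l \<in> insert k K. i < l} = insert k {l \<in> K. i < l}" by auto
      then have c: "card {l \<in> insert k K. i < l} = Suc (card {l \<in> K. i < l})"
        using insert.hyps by simp
      have "t i < t k" using strict_mono_onD[OF t ki(3,2) True] .
      then have "0 < (t k - t i) * ((- 1) ^ card {k \<in> K. i < k} * poly (node_poly K) (t i))"
        using IH by simp
      then show ?thesis unfolding c poly by (simp add: algebra_simps)
    next
      case False
      then have "{l \<in> insert k K. i < l} = {l \<in> K. i < l}" by auto
      moreover have "t k < t i" using strict_mono_onD[OF t ki(2,3)] False ki(1) by simp
      then have "0 < (t i - t k) * ((- 1) ^ card {k \<in> K. i < k} * poly (node_poly K) (t i))"
        using IH by simp
      ultimately show ?thesis unfolding poly by (simp add: mult.left_commute)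
    qed
  qed
qed

lemma even_card_greater:
  assumes "R \<subseteq> {1..n}" "card R = r" "i \<in> R"
  shows "even (card {k \<in> {1..n} - R. i < k}) \<longleftrightarrow> even (i + rank_in R i)"
  using even_card_greater_iff[OF assms(1) _ d assms(3)] assms(2) n by simp

text \<open>The polynomial of a vertex has the same \<open>d\<close> roots among the nodes as the
  node polynomial of its tight set, so the two are proportional. Hence the node polynomial has
  constant sign on the gaps, and its sign at a gap is the parity of the rank condition
  there.\<close>

lemma gale_evenness:
  assumes y: "y extreme_point_of Q"
  shows "lower_gaps r ({1..n} - tight y) \<or> upper_gaps r ({1..n} - tight y)"
proof -
  let ?K = "tight y" and ?R = "{1..n} - tight y"
  have yQ: "y \<in> Q" using y by (simp add: extreme_point_of_def)
  have cardK: "card ?K = d" by (rule extreme_card[OF y])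
  have cardR: "card ?R = r"
    using card_Diff_subset[OF finite_tight tight_subset, of y] cardK n card_atLeastAtMost[of 1 n]
    by linarith
  have K: "{1..n} - ?R = ?K" using tight_subset by auto
  obtain q :: "real poly" where q: "q \<noteq> 0" "degree q \<le> d" "\<forall>i. poly q (t i) = slack y i"
  proof (rule polynomial_of_slack)
    show "y \<in> V" using yQ by (simp add: mem_Q)
  qed
  let ?N = "node_poly ?K"
  have same: "even (card {k \<in> ?K. i < k}) = even (card {k \<in> ?K. j < k})"
    if i: "i \<in> ?R" and j: "j \<in> ?R" for i j
  proof -
    \<comment> \<open>This combination vanishes at the \<open>d\<close> tight nodes and, by the
      choice of coefficients, at \<open>j\<close>: one root too many for its degree.\<close>
    define w where "w = smult (poly ?N (t j)) q - smult (poly q (t j)) ?N"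
    have roots: "poly w (t k) = 0" if "k \<in> insert j ?K" for k
    proof (cases "k = j")
      case False
      then have "k \<in> ?K" using that by simp
      then have "poly q (t k) = 0" "poly ?N (t k) = 0"
        using q(3) finite_tight by (auto simp: tight_def poly_node_poly)
      then show ?thesis by (simp add: w_def)
    qed (simp add: w_def)
    have "w = 0"
    proof (rule ccontr)
      assume "w \<noteq> 0"
      moreover have "degree w \<le> d" unfolding w_def
        using q(2) degree_node_poly[of ?K] cardK by (intro degree_diff_le) (auto intro: order_trans[OF degree_smult_le])
      moreover have "insert j ?K \<subseteq> {1..n}" using j tight_subset by auto
      ultimately have "card (insert j ?K) \<le> d" using roots by (rule card_roots)
      then show False using cardK j finite_tight by simp
    qed
    then have eq: "poly ?N (t j) * slack y i = slack y j * poly ?N (t i)"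
      using q(3) unfolding w_def by (metis eq_iff_diff_eq_0 poly_smult)
    have "0 < slack y i" "0 < slack y j" using i j yQ by (force simp: mem_Q tight_def)+
    moreover have "0 < (- 1) ^ card {k \<in> ?K. i < k} * poly ?N (t i)"
      "0 < (- 1) ^ card {k \<in> ?K. j < k} * poly ?N (t j)"
      using node_poly_sign[OF tight_subset] i j by auto
    moreover have "0 < poly ?N (t j) \<longleftrightarrow> 0 < poly ?N (t i)" "poly ?N (t j) < 0 \<longleftrightarrow> poly ?N (t i) < 0"
      using eq calculation(1,2) by (smt (verit) mult_pos_pos mult_neg_pos mult_pos_neg mult_eq_0_iff)+
    ultimately show ?thesis
      by (cases "even (card {k \<in> ?K. i < k})"; cases "even (card {k \<in> ?K. j < k})") auto
  qed
  have "even (card {k \<in> ?K. i < k}) \<longleftrightarrow> even (i + rank_in ?R i)" if "i \<in> ?R" for i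
    using even_card_greater[OF Diff_subset cardR that] unfolding K .
  then have eq: "even (i + rank_in ?R i) \<longleftrightarrow> even (j + rank_in ?R j)" if "i \<in> ?R" "j \<in> ?R" for i j
    using same[OF that] that by blast
  have fin: "finite ?R" by simp
  show ?thesis
  proof (cases "\<exists>i\<in>?R. even (i + rank_in ?R i)")
    case True
    then obtain j where "j \<in> ?R" "even (j + rank_in ?R j)" by (elim bexE)
    then have "\<forall>i\<in>?R. even (i + rank_in ?R i)" using eq by blast
    then show ?thesis using cardR fin unfolding lower_gaps_def by blast
  next
    case False
    then show ?thesis using cardR fin unfolding upper_gaps_def by blast
  qed
qed

text \<open>Converse of Gale's condition: up to the sign \<open>e\<close>, the node polynomial of
  the complement of \<open>R\<close> is positive on \<open>R\<close> and zero at the other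
  nodes.\<close>

lemma Q_of_gaps:
  assumes R: "R \<subseteq> {1..n}" and gaps: "lower_gaps r R \<or> upper_gaps r R"
  obtains y where "y \<in> Q" "tight y = {1..n} - R"
proof -
  let ?K = "{1..n} - R"
  have cardR: "card R = r" and fin: "finite R"
    using gaps by (auto simp: lower_gaps_def upper_gaps_def)
  have cardK: "card ?K = d" using cardR n R fin by (simp add: card_Diff_subset)
  define e :: real where "e = (if lower_gaps r R then 1 else - 1)"
  define q where "q = smult e (node_poly ?K)"
  have zero: "poly q (t i) = 0" if "i \<in> ?K" for i
    using that by (simp add: q_def poly_node_poly) (metis DiffI atLeastAtMost_iff)
  have pos: "0 < poly q (t i)" if i: "i \<in> R" for i
  proof -
    have sign: "0 < (- 1) ^ card {k \<in> ?K. i < k} * poly (node_poly ?K) (t i)"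
      using R i by (intro node_poly_sign) auto
    show ?thesis
    proof (cases "lower_gaps r R")
      case True
      then have "even (card {k \<in> ?K. i < k})"
        using even_card_greater[OF R cardR i] i by (simp add: lower_gaps_def)
      then show ?thesis using sign True by (simp add: q_def e_def)
    next
      case False
      then have "odd (card {k \<in> ?K. i < k})"
        using even_card_greater[OF R cardR i] i gaps by (simp add: upper_gaps_def)
      then show ?thesis using sign False by (simp add: q_def e_def)
    qed
  qed
  have "e \<noteq> 0" by (simp add: e_def)
  obtain y where y: "y \<in> Q" "tight y = {i \<in> {1..n}. poly q (t i) = 0}"
  proof (rule Q_of_polynomial)
    show "degree q \<le> d" using degree_node_poly[of ?K] cardK \<open>e \<noteq> 0\<close> by (simp add: q_def)
    show "q \<noteq> 0" using node_poly_nonzero \<open>e \<noteq> 0\<close> by (simp add: q_def)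
    show "0 \<le> poly q (t i)" if "i \<in> {1..n}" for i
      using zero[of i] pos[of i] that by (cases "i \<in> R") auto
  qed
  have "tight y = ?K" unfolding y(2) using zero pos by force
  then show thesis using that y(1) by blast
qed

section \<open>Dual facets and the end-set criterion\<close>

lemma inner_shift: "(x - p) \<bullet> y = y \<bullet> x - p \<bullet> y"
  by (simp add: inner_diff_left inner_commute[of x])

lemma dual_facet_eq: "dual_facet P p y = P \<inter> {x. y \<bullet> x = 1 + p \<bullet> y}"
  unfolding dual_facet_def inner_shift by auto

text \<open>The face is proper as it misses \<open>p\<close>, and it contains \<open>d\<close>
  affinely independent points of the curve. For \<open>d = 0\<close> it is the empty facet of a
  point.\<close>

lemma polytope_facet_dual_facet:
  assumes y: "y extreme_point_of Q"
  shows "polytope_facet (dual_facet P p y) P"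
proof -
  let ?F = "dual_facet P p y"
  have yQ: "y \<in> Q" using y by (simp add: extreme_point_of_def)
  have "y \<bullet> x \<le> 1 + p \<bullet> y" if "x \<in> P" for x
    using yQ that inner_shift[of x y] by (force simp: polar_cyclic_polytope_def polar_polytope_def)
  with convex_P have face: "?F face_of P"
    unfolding dual_facet_eq by (rule face_of_Int_supporting_hyperplane_le)
  have "p \<notin> ?F" by (simp add: dual_facet_def)
  then have "?F \<noteq> P" using p_in_P by blast
  then have "aff_dim ?F < int d" using face_of_aff_dim_lt[OF convex_P face] aff_dim_P by simp
  moreover have "int d - 1 \<le> aff_dim ?F"
  proof -
    let ?S = "(\<lambda>i. m i - p) ` tight y"
    have "card ?S = d" using extreme_independent(2)[OF y] extreme_card[OF y] by (simp add: card_image)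
    moreover have "\<not> affine_dependent ?S"
      using extreme_independent(1)[OF y] affine_dependent_imp_dependent by blast
    ultimately have "aff_dim ?S = int d - 1" using aff_dim_affine_independent by fastforce
    moreover have "?S = (\<lambda>x. x - p) ` (m ` tight y)" by (simp add: image_image)
    ultimately have "aff_dim (m ` tight y) = int d - 1" by (simp add: aff_dim_translation_eq_subtract)
    moreover have "m ` tight y \<subseteq> ?F"
      using m_in_P by (auto simp: dual_facet_def tight_def slack_def)
    ultimately show ?thesis using aff_dim_subset by metis
  qed
  ultimately show ?thesis using face aff_dim_P by (simp add: polytope_facet_def)
qed

text \<open>The end-set consists of the elements beyond the last gap before \<open>Max K\<close>,
  which serves as \<open>i\<close>. If there is no such gap, \<open>K\<close> is an initial segment
  and its own end-set: then its cardinality \<open>d\<close> and the count 0 at any gap are both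
  even. The empty set, whose maximum is unspecified, is treated there as well.\<close>

lemma card_end_set:
  assumes K: "K \<subseteq> {1..n}" "card K = d" and x: "x \<in> {1..n} - K"
  shows "\<exists>i\<in>{1..n} - K. even (card (end_set K)) = even (card {k \<in> K. i < k})"
proof (cases "\<exists>i\<in>{1..n} - K. i < Max K \<and> K \<noteq> {}")
  case True
  have fin: "finite K" using K(1) finite_subset by blast
  define i where "i = Max {i \<in> {1..n} - K. i < Max K}"
  have "{i \<in> {1..n} - K. i < Max K} \<noteq> {}" using True by auto
  then have "i \<in> {i \<in> {1..n} - K. i < Max K}" unfolding i_def by (intro Max_in) auto
  then have i: "i \<in> {1..n} - K" "i < Max K" by auto
  have max: "j \<le> i" if "j \<in> {1..n} - K" "j < Max K" for j
    unfolding i_def using that by (intro Max_ge) auto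
  have MaxK: "Max K \<in> K" "Max K \<le> n" using True fin K(1) Max_in[OF fin] by auto
  have "end_set K = {k \<in> K. i < k}"
  proof (intro equalityI subsetI)
    fix k assume k: "k \<in> end_set K"
    then have "i \<notin> {k..Max K}" using i(1) unfolding end_set_def by blast
    then show "k \<in> {k \<in> K. i < k}" using k i(2) by (auto simp: end_set_def)
  next
    fix k assume k: "k \<in> {k \<in> K. i < k}"
    have "j \<in> K" if j: "j \<in> {k..Max K}" for j
    proof (rule ccontr)
      assume "j \<notin> K"
      moreover have "j \<noteq> Max K" using MaxK(1) \<open>j \<notin> K\<close> by blast
      moreover have "1 \<le> j" using k j by auto
      ultimately have "j \<le> i" using max[of j] j MaxK by auto
      then show False using j k by auto
    qed
    then show "k \<in> end_set K" using k by (auto simp: end_set_def)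
  qed
  then show ?thesis using i(1) by auto
next
  case False
  have fin: "finite K" using K(1) finite_subset by blast
  have all: "k < i" if k: "k \<in> K" and i: "i \<in> {1..n} - K" for k i
  proof -
    have "\<not> i < Max K" using False i k by blast
    then have "k \<le> i" using Max_ge[OF fin k] by simp
    moreover have "k \<noteq> i" using i k by blast
    ultimately show ?thesis by simp
  qed
  have "j \<in> K" if "k \<in> K" "j \<in> {k..Max K}" for k j
  proof (rule ccontr)
    assume "j \<notin> K"
    have "Max K \<in> K" using Max_in[OF fin] that(1) by blast
    moreover have "j \<in> {1..n} - K" using \<open>j \<notin> K\<close> that K(1) calculation by force
    ultimately have "Max K < j" using all by blast
    then show False using that(2) by simp
  qed
  then have "end_set K = K" by (auto simp: end_set_def)
  moreover have "card {k \<in> K. x < k} = 0" using all[OF _ x] by (force intro: card_eq_0_iff[THEN iffD2])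
  ultimately have "even (card (end_set K)) = even (card {k \<in> K. x < k})" using K(2) d by simp
  then show ?thesis using x by blast
qed

text \<open>The end-set has the parity of Gale's count at one gap, and by
  \<open>gale_evenness\<close> one gap decides about all.\<close>

lemma lower_facet_iff:
  assumes y: "y extreme_point_of Q"
  shows "lower_facet b d n t (dual_facet P p y) \<longleftrightarrow> lower_gaps r ({1..n} - tight y)"
proof -
  let ?K = "tight y" and ?R = "{1..n} - tight y"
  have K: "{i \<in> {1..n}. m i \<in> dual_facet P p y} = ?K"
    using m_in_P by (auto simp: dual_facet_def tight_def slack_def)
  have cardK: "card ?K = d" by (rule extreme_card[OF y])
  have cardR: "card ?R = r"
    using card_Diff_subset[OF finite_tight tight_subset, of y] cardK n card_atLeastAtMost[of 1 n]
    by linarith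
  then obtain x where "x \<in> ?R" using r by (metis card.empty ex_in_conv not_one_le_zero)
  then obtain i where i: "i \<in> ?R" "even (card (end_set ?K)) = even (card {k \<in> ?K. i < k})"
    using card_end_set[OF tight_subset cardK] by blast
  have "{1..n} - ?R = ?K" using tight_subset by auto
  then have "even (card {k \<in> ?K. i < k}) = even (i + rank_in ?R i)"
    using even_card_greater[of ?R i] cardR i(1) by auto
  also have "\<dots> \<longleftrightarrow> lower_gaps r ?R"
  proof
    assume "even (i + rank_in ?R i)"
    then have "\<not> upper_gaps r ?R" using i(1) unfolding upper_gaps_def by blast
    then show "lower_gaps r ?R" using gale_evenness[OF y] by blast
  next
    assume "lower_gaps r ?R"
    then show "even (i + rank_in ?R i)" using i(1) unfolding lower_gaps_def by blast
  qed
  finally show ?thesis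
    using i(2) polytope_facet_dual_facet[OF y] unfolding lower_facet_def K by simp
qed

section \<open>The subcomplex induced on the lower vertices\<close>

lemma lower_complex_iff:
  "G \<in> lower_complex b d n t p \<longleftrightarrow> G face_of Q \<and> G \<noteq> {} \<and>
     (\<forall>y\<in>G. y extreme_point_of Q \<longrightarrow> lower_gaps r ({1..n} - tight y))"
proof (cases "G face_of Q")
  case True
  have "y extreme_point_of G \<longleftrightarrow> y \<in> G \<and> y extreme_point_of Q" for y
    using extreme_point_of_face[OF True] by auto
  then show ?thesis
    using lower_facet_iff
    unfolding lower_complex_def induced_subcomplex_def lower_vertices_def by auto
qed (simp add: lower_complex_def induced_subcomplex_def)

lemma extreme_point_of_lower_complex:
  assumes G: "G \<in> lower_complex b d n t p"
  shows "y extreme_point_of G \<longleftrightarrow> y \<in> G \<and> {y} \<in> lower_complex b d n t p"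
proof -
  have face: "G face_of Q" using G by (simp add: lower_complex_iff)
  show ?thesis
    using G extreme_point_of_face[OF face, of y] by (auto simp: lower_complex_iff face_of_singleton)
qed

lemma lower_complex_cell:
  assumes "G \<in> lower_complex b d n t p"
  shows "compact G \<and> convex G \<and> G \<noteq> {}"
  using assms face_of_imp_compact[OF convex_Q compact_Q] face_of_imp_convex
  by (auto simp: lower_complex_iff)

lemma face_has_extreme_point:
  assumes "G face_of Q" "G \<noteq> {}"
  obtains y where "y \<in> G" "y extreme_point_of Q"
proof -
  have "compact G" "convex G"
    using face_of_imp_compact[OF convex_Q compact_Q assms(1)] face_of_imp_convex[OF assms(1)] by auto
  then obtain y where "y extreme_point_of G" using extreme_point_exists_convex assms(2) by blast
  then show thesis using that extreme_point_of_face[OF assms(1)] by blast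
qed

text \<open>Repeated midpoints intersect the tight sets.\<close>

lemma Q_tight_Inter:
  assumes "finite A" "A \<noteq> {}" "A \<subseteq> Q"
  shows "\<exists>y\<in>Q. tight y = (\<Inter>a\<in>A. tight a)"
  using assms
proof (induction A rule: finite_ne_induct)
  case (insert a A)
  then obtain y where y: "y \<in> Q" "tight y = (\<Inter>a\<in>A. tight a)" by auto
  let ?z = "(1 - 1/2) *\<^sub>R a + (1/2) *\<^sub>R y :: 'c"
  have "?z \<in> Q" using insert.prems y(1) by (intro Q_convex_combination) auto
  moreover have "tight ?z = tight a \<inter> tight y"
    using insert.prems y(1) by (intro tight_convex_combination) auto
  ultimately show ?case using y(2) by auto
qed auto

end

section \<open>Chains of the grid as faces of the polar\<close>

locale staircase_polar = cyclic_polar +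
  fixes s :: nat
  assumes s: "s \<ge> 1" and d_eq: "d = 2 * (s - 1)"
begin

text \<open>The vertices of this face are the vertices of the polar whose gaps are all positions of
  the chain.\<close>

definition polar_cell :: "(nat \<times> nat) set \<Rightarrow> 'a set" where
  "polar_cell \<sigma> = face ({1..n} - path_pos ` \<sigma>)"

lemma path_pos_range:
  assumes "\<sigma> \<in> staircases r s"
  shows "path_pos ` \<sigma> \<subseteq> {1..n}"
proof
  fix z assume "z \<in> path_pos ` \<sigma>"
  then obtain x where x: "x \<in> \<sigma>" "z = path_pos x" by blast
  then have "x \<in> {1..r} \<times> {1..s}" using assms by (auto simp: staircases_def grid_chain_def)
  then show "z \<in> {1..n}" unfolding x(2) n d_eq path_pos_def by (auto simp: mem_Times_iff)
qed

text \<open>Provides a generic point of the cell: for each position of the chain a lower gap set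
  through it gives a point that is not tight there, and the points are combined by
  \<open>Q_tight_Inter\<close>.\<close>

lemma staircase_tight:
  assumes \<sigma>: "\<sigma> \<in> staircases r s"
  obtains y where "y \<in> Q" "tight y = {1..n} - path_pos ` \<sigma>"
proof -
  let ?S = "path_pos ` \<sigma>"
  have "\<exists>y\<in>Q. {1..n} - ?S \<subseteq> tight y \<and> z \<notin> tight y" if z: "z \<in> ?S" for z
  proof -
    obtain x where x: "x \<in> \<sigma>" "z = path_pos x" using z by blast
    obtain R where R: "R \<subseteq> ?S" "lower_gaps r R" "z \<in> R"
      using staircases_lower_gaps[OF \<sigma> x(1)] x(2) by metis
    obtain y where "y \<in> Q" "tight y = {1..n} - R"
      using Q_of_gaps[of R] R path_pos_range[OF \<sigma>] by blast
    then show ?thesis using R by blast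
  qed
  then obtain Y where Y: "\<And>z. z \<in> ?S \<Longrightarrow> Y z \<in> Q \<and> {1..n} - ?S \<subseteq> tight (Y z) \<and> z \<notin> tight (Y z)"
    by metis
  have "\<sigma> \<noteq> {}" "finite \<sigma>"
    using \<sigma> r grid_chain_finite by (auto simp: staircases_def)
  then obtain y where y: "y \<in> Q" "tight y = (\<Inter>a\<in>Y ` ?S. tight a)"
    using Q_tight_Inter[of "Y ` ?S"] Y by auto
  have "tight y = {1..n} - ?S"
  proof
    show "tight y \<subseteq> {1..n} - ?S"
    proof
      fix z assume z: "z \<in> tight y"
      then have "z \<notin> ?S" using Y[of z] unfolding y(2) by blast
      then show "z \<in> {1..n} - ?S" using z tight_subset by blast
    qed
    show "{1..n} - ?S \<subseteq> tight y" unfolding y(2) using Y by (intro INT_greatest) blast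
  qed
  then show thesis using that y(1) by blast
qed

lemma polar_cell_mono:
  assumes \<sigma>: "\<sigma> \<in> staircases r s" and \<tau>: "\<tau> \<in> staircases r s"
  shows "\<sigma> \<subseteq> \<tau> \<longleftrightarrow> polar_cell \<sigma> \<subseteq> polar_cell \<tau>"
proof
  assume "\<sigma> \<subseteq> \<tau>"
  then show "polar_cell \<sigma> \<subseteq> polar_cell \<tau>" by (auto simp: polar_cell_def face_def)
next
  assume sub: "polar_cell \<sigma> \<subseteq> polar_cell \<tau>"
  obtain y where "y \<in> Q" "tight y = {1..n} - path_pos ` \<sigma>" by (rule staircase_tight[OF \<sigma>])
  moreover from this have "y \<in> polar_cell \<sigma>" by (simp add: polar_cell_def face_def)
  then have "y \<in> polar_cell \<tau>" using sub by blast
  ultimately have "{1..n} - path_pos ` \<tau> \<subseteq> {1..n} - path_pos ` \<sigma>"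
    unfolding polar_cell_def face_def by simp
  then have "path_pos ` \<sigma> \<subseteq> path_pos ` \<tau>" using path_pos_range[OF \<sigma>] by blast
  then show "\<sigma> \<subseteq> \<tau>" by (rule staircases_path_pos_mono[OF \<sigma> \<tau>])
qed

lemma polar_cell_lower:
  assumes \<sigma>: "\<sigma> \<in> staircases r s"
  shows "polar_cell \<sigma> \<in> lower_complex b d n t p"
  unfolding lower_complex_iff
proof (intro conjI ballI impI)
  show "polar_cell \<sigma> face_of Q" unfolding polar_cell_def by (rule face_face_of)
  show "polar_cell \<sigma> \<noteq> {}"
  proof -
    obtain y where "y \<in> Q" "tight y = {1..n} - path_pos ` \<sigma>" by (rule staircase_tight[OF \<sigma>])
    then show ?thesis by (auto simp: polar_cell_def face_def)
  qed
next
  fix y assume y: "y \<in> polar_cell \<sigma>" "y extreme_point_of Q"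
  then have "{1..n} - tight y \<subseteq> path_pos ` \<sigma>" by (auto simp: polar_cell_def face_def)
  then have "\<not> upper_gaps r ({1..n} - tight y)" by (rule staircases_no_upper_gaps[OF \<sigma> r])
  then show "lower_gaps r ({1..n} - tight y)" using gale_evenness[OF y(2)] by blast
qed

text \<open>Let \<open>y\<close> be a generic point of \<open>G\<close>. The non-tight indices of
  \<open>y\<close> contain the gap set of a vertex of \<open>G\<close>, which is lower, and no upper
  gap set, since its vertex would also lie in \<open>G\<close>. So \<open>staircase_of_gaps\<close>
  applies.\<close>

lemma lower_complex_polar_cell:
  assumes G: "G \<in> lower_complex b d n t p"
  shows "G \<in> polar_cell ` staircases r s"
proof -
  have face: "G face_of Q" "G \<noteq> {}"
    and low: "\<And>y. y \<in> G \<Longrightarrow> y extreme_point_of Q \<Longrightarrow> lower_gaps r ({1..n} - tight y)"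
    using G by (auto simp: lower_complex_iff)
  obtain y where y: "y \<in> G" "G = face (tight y)" using face_of_Q_eq_face[OF face] .
  let ?S = "{1..n} - tight y"
  have "\<exists>R\<subseteq>?S. lower_gaps r R"
  proof -
    obtain v where v: "v \<in> G" "v extreme_point_of Q" using face_has_extreme_point[OF face] .
    then have "tight y \<subseteq> tight v" using y(2) by (auto simp: face_def)
    then show ?thesis using low[OF v] by (intro exI[of _ "{1..n} - tight v"]) auto
  qed
  moreover have "\<not> upper_gaps r R" if R: "R \<subseteq> ?S" for R
  proof
    assume up: "upper_gaps r R"
    have Rn: "R \<subseteq> {1..n}" using R by blast
    obtain x where x: "x \<in> Q" "tight x = {1..n} - R" using Q_of_gaps[OF Rn] up by blast
    have "x \<in> face ({1..n} - R)" using x by (simp add: face_def)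
    \<comment> \<open>An extreme point of this face is tight at the \<open>d\<close> indices outside
      \<open>R\<close> and, by \<open>extreme_card\<close>, at no others, so its gap set is exactly
      \<open>R\<close>.\<close>
    then obtain v where v: "v \<in> face ({1..n} - R)" "v extreme_point_of Q"
      using face_has_extreme_point[OF face_face_of] by blast
    have sub: "{1..n} - R \<subseteq> tight v" using v(1) by (simp add: face_def)
    have finR: "finite R" and cardR: "card R = r" using up by (auto simp: upper_gaps_def)
    have "card ({1..n} - R) = d" using Rn finR cardR n by (simp add: card_Diff_subset)
    then have "{1..n} - R = tight v"
      using sub extreme_card[OF v(2)] finite_tight by (intro card_subset_eq) auto
    then have vR: "{1..n} - tight v = R" using Rn by blast
    have "tight y \<subseteq> tight v" using sub R tight_subset[of y] by blast
    then have "v \<in> G" unfolding y(2) using v(2) by (simp add: face_def extreme_point_of_def)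
    then have "lower_gaps r R" using low[OF _ v(2)] vR by simp
    moreover obtain z where "z \<in> R" using cardR r by (metis card.empty ex_in_conv not_one_le_zero)
    ultimately show False using up by (auto simp: lower_gaps_def upper_gaps_def)
  qed
  ultimately obtain \<sigma> where \<sigma>: "\<sigma> \<in> staircases r s" "path_pos ` \<sigma> = ?S"
    using staircase_of_gaps[OF r s, of ?S] n d_eq by (metis Diff_subset)
  have "{1..n} - path_pos ` \<sigma> = tight y" using \<sigma>(2) tight_subset[of y] by blast
  then have "polar_cell \<sigma> = G" by (simp add: polar_cell_def y(2))
  then show ?thesis using \<sigma>(1) by blast
qed

lemma complex_iso_lower_complex: "complex_iso (staircases r s) (lower_complex b d n t p)"
proof -
  have "inj_on polar_cell (staircases r s)"
  proof (rule inj_onI)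
    fix \<sigma> \<tau> assume "\<sigma> \<in> staircases r s" "\<tau> \<in> staircases r s" "polar_cell \<sigma> = polar_cell \<tau>"
    then show "\<sigma> = \<tau>" using polar_cell_mono by (metis order_refl subset_antisym)
  qed
  moreover have "polar_cell ` staircases r s = lower_complex b d n t p"
    using polar_cell_lower lower_complex_polar_cell by blast
  ultimately have "bij_betw polar_cell (staircases r s) (lower_complex b d n t p)"
    by (simp add: bij_betw_def)
  then show ?thesis unfolding complex_iso_def using polar_cell_mono by blast
qed

text \<open>A chain has at most \<open>r + s - 1\<close> points, so at least
  \<open>n - (r + s - 1) = s - 1\<close> inequalities are tight on the cell, and the dimension is at
  most \<open>d - (s - 1) = s - 1\<close>.\<close>

lemma aff_dim_lower_complex:
  assumes "G \<in> lower_complex b d n t p"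
  shows "real_of_int (aff_dim G) \<le> real d / 2"
proof -
  obtain \<sigma> where \<sigma>: "\<sigma> \<in> staircases r s" "G = polar_cell \<sigma>"
    using imageE[OF lower_complex_polar_cell[OF assms]] by metis
  let ?I = "{1..n} - path_pos ` \<sigma>"
  have g: "grid_chain r s \<sigma>" using \<sigma>(1) by (simp add: staircases_def)
  have "card (path_pos ` \<sigma>) = card \<sigma>" using inj_on_path_pos[OF g] by (rule card_image)
  then have cardI: "card ?I = n - card \<sigma>" "card \<sigma> \<le> n"
    using path_pos_range[OF \<sigma>(1)] grid_chain_finite[OF g] card_mono[OF _ path_pos_range[OF \<sigma>(1)]]
    by (auto simp: card_Diff_subset)
  obtain y where y: "y \<in> G" "y extreme_point_of Q"
    using face_has_extreme_point[of G] assms by (auto simp: lower_complex_iff)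
  then have "?I \<subseteq> tight y" by (simp add: \<sigma>(2) polar_cell_def face_def)
  then have "aff_dim G + int (card ?I) \<le> int d"
    unfolding \<sigma>(2) polar_cell_def by (rule aff_dim_face[OF y(2)])
  then have "aff_dim G \<le> int (s - 1)"
    using cardI grid_chain_card[OF g r s] n r s by linarith
  moreover have "real d / 2 = real (s - 1)" by (simp add: d_eq)
  ultimately show ?thesis by linarith
qed

end

section \<open>The section of the staircase triangulation\<close>

lemma inner_sum_enumerated_basis:
  fixes e :: "nat \<Rightarrow> 'a::euclidean_space"
  assumes "bij_betw e {1..r} Basis" "k \<in> {1..r}"
  shows "(\<Sum>i=1..r. a i *\<^sub>R e i) \<bullet> e k = a k"
proof -
  have "e i \<bullet> e k = (if i = k then 1 else 0)" if "i \<in> {1..r}" for i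
  proof -
    have "e i \<in> Basis" "e k \<in> Basis" using assms that by (auto simp: bij_betw_def)
    moreover have "e i = e k \<longleftrightarrow> i = k"
      using assms that by (auto simp: bij_betw_def inj_on_eq_iff)
    ultimately show ?thesis by (simp add: inner_Basis)
  qed
  then have "(\<Sum>i=1..r. a i *\<^sub>R e i) \<bullet> e k = (\<Sum>i=1..r. if i = k then a i else 0)"
    unfolding inner_sum_left inner_scaleR_left by (intro sum.cong) auto
  then show ?thesis using assms(2) by simp
qed

locale staircase_section =
  fixes e :: "nat \<Rightarrow> 'a::euclidean_space" and f :: "nat \<Rightarrow> 'b::euclidean_space"
    and r s :: nat
  assumes r: "r \<ge> 1" and s: "s \<ge> 1"
    and e: "bij_betw e {1..r} Basis" and f: "bij_betw f {1..s} Basis"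
begin

text \<open>Barycentric coordinates of the points of the cell of \<open>\<sigma>\<close>.\<close>

definition weights :: "(nat \<times> nat) set \<Rightarrow> (nat \<times> nat \<Rightarrow> real) set" where
  "weights \<sigma> = {w. (\<forall>x. 0 \<le> w x) \<and> (\<forall>x. x \<notin> \<sigma> \<longrightarrow> w x = 0) \<and>
     (\<forall>i\<in>{1..r}. (\<Sum>j=1..s. w (i, j)) = 1 / real r)}"

text \<open>For \<open>w\<close> in \<open>weights \<sigma>\<close> this is the convex combination
  of the vertices with coefficients \<open>w\<close>; its first component is already
  evaluated.\<close>

definition point :: "(nat \<times> nat \<Rightarrow> real) \<Rightarrow> 'a \<times> 'b" where
  "point w = ((\<Sum>i=1..r. (1 / real r) *\<^sub>R e i), (\<Sum>i=1..r. \<Sum>j=1..s. w (i, j) *\<^sub>R f j))"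

definition vertex :: "nat \<times> nat \<Rightarrow> 'a \<times> 'b" where
  "vertex = (\<lambda>(i, j). (e i, f j))"

definition cell :: "(nat \<times> nat) set \<Rightarrow> ('a \<times> 'b) set" where
  "cell \<sigma> = convex hull (vertex ` \<sigma>) \<inter> barycentre_plane e r"

lemma weights_nonneg: "w \<in> weights \<sigma> \<Longrightarrow> 0 \<le> w x"
  unfolding weights_def by blast

lemma weights_off: "w \<in> weights \<sigma> \<Longrightarrow> x \<notin> \<sigma> \<Longrightarrow> w x = 0"
  unfolding weights_def by blast

lemma weights_row: "w \<in> weights \<sigma> \<Longrightarrow> i \<in> {1..r} \<Longrightarrow> (\<Sum>j=1..s. w (i, j)) = 1 / real r"
  unfolding weights_def by blast

lemma weightsI:
  assumes "\<And>x. 0 \<le> w x" "\<And>x. x \<notin> \<sigma> \<Longrightarrow> w x = 0"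
    and "\<And>i. i \<in> {1..r} \<Longrightarrow> (\<Sum>j=1..s. w (i, j)) = 1 / real r"
  shows "w \<in> weights \<sigma>"
  using assms unfolding weights_def by blast

lemma weights_mono: "\<sigma> \<subseteq> \<tau> \<Longrightarrow> weights \<sigma> \<subseteq> weights \<tau>"
  unfolding weights_def by blast

lemma sum_vertex:
  assumes \<sigma>: "\<sigma> \<subseteq> {1..r} \<times> {1..s}" and w: "\<And>x. x \<notin> \<sigma> \<Longrightarrow> w x = 0"
  shows "(\<Sum>x\<in>\<sigma>. w x *\<^sub>R vertex x) =
    (\<Sum>i=1..r. (\<Sum>j=1..s. w (i, j)) *\<^sub>R e i, \<Sum>i=1..r. \<Sum>j=1..s. w (i, j) *\<^sub>R f j)"
proof -
  have "(\<Sum>x\<in>\<sigma>. w x *\<^sub>R vertex x) = (\<Sum>x\<in>{1..r} \<times> {1..s}. w x *\<^sub>R vertex x)"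
    by (rule sum.mono_neutral_left) (use \<sigma> w in auto)
  also have "\<dots> = (\<Sum>i=1..r. \<Sum>j=1..s. w (i, j) *\<^sub>R vertex (i, j))"
    by (simp add: sum.cartesian_product split_def)
  finally show ?thesis
    by (simp add: prod_eq_iff fst_sum snd_sum vertex_def scaleR_sum_left)
qed

lemma sum_weights:
  assumes "w \<in> weights \<sigma>" and \<sigma>: "\<sigma> \<subseteq> {1..r} \<times> {1..s}"
  shows "sum w \<sigma> = 1"
proof -
  have "sum w \<sigma> = sum w ({1..r} \<times> {1..s})"
    by (rule sum.mono_neutral_left) (use \<sigma> weights_off[OF assms(1)] in auto)
  also have "\<dots> = (\<Sum>i=1..r. \<Sum>j=1..s. w (i, j))" by (simp add: sum.cartesian_product split_def)
  also have "\<dots> = (\<Sum>i=1..r. 1 / real r)" using weights_row[OF assms(1)] by (intro sum.cong) auto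
  finally show ?thesis using r by simp
qed

text \<open>The row sums are the coefficients of the basis vectors \<open>e i\<close> in the first
  component, so lying in the barycentre plane means that every row has mass
  \<open>1 / r\<close>.\<close>

lemma cell_eq:
  assumes g: "grid_chain r s \<sigma>"
  shows "cell \<sigma> = point ` weights \<sigma>"
proof -
  have \<sigma>: "\<sigma> \<subseteq> {1..r} \<times> {1..s}" and fin: "finite \<sigma>"
    using g grid_chain_finite by (auto simp: grid_chain_def)
  show ?thesis
  proof (intro equalityI subsetI)
    fix y assume y: "y \<in> cell \<sigma>"
    have "inj_on vertex \<sigma>"
    proof (rule inj_onI)
      fix x x' assume xx: "x \<in> \<sigma>" "x' \<in> \<sigma>" "vertex x = vertex x'"
      then have "x \<in> {1..r} \<times> {1..s}" "x' \<in> {1..r} \<times> {1..s}" using \<sigma> by blast+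
      then show "x = x'"
        using xx(3) bij_betw_imp_inj_on[OF e, THEN inj_onD] bij_betw_imp_inj_on[OF f, THEN inj_onD]
        by (auto simp: vertex_def)
    qed
    obtain u where u: "\<forall>v\<in>vertex ` \<sigma>. 0 \<le> u v" "(\<Sum>v\<in>vertex ` \<sigma>. u v *\<^sub>R v) = y"
      using y fin unfolding cell_def by (auto simp: convex_hull_finite)
    define w where "w x = (if x \<in> \<sigma> then u (vertex x) else 0)" for x
    have "y = (\<Sum>x\<in>\<sigma>. w x *\<^sub>R vertex x)"
      unfolding u(2)[symmetric] by (simp add: sum.reindex[OF \<open>inj_on vertex \<sigma>\<close>] w_def)
    also have "\<dots> = (\<Sum>i=1..r. (\<Sum>j=1..s. w (i, j)) *\<^sub>R e i, \<Sum>i=1..r. \<Sum>j=1..s. w (i, j) *\<^sub>R f j)"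
      by (rule sum_vertex[OF \<sigma>]) (simp add: w_def)
    finally have y': "y = (\<Sum>i=1..r. (\<Sum>j=1..s. w (i, j)) *\<^sub>R e i, \<Sum>i=1..r. \<Sum>j=1..s. w (i, j) *\<^sub>R f j)" .
    moreover have fst: "fst y = (\<Sum>i=1..r. (1 / real r) *\<^sub>R e i)"
      using y by (auto simp: cell_def barycentre_plane_def)
    ultimately have "y = point w" by (simp add: point_def prod_eq_iff)
    moreover have "(\<Sum>j=1..s. w (k, j)) = 1 / real r" if "k \<in> {1..r}" for k
    proof -
      have "(\<Sum>i=1..r. (\<Sum>j=1..s. w (i, j)) *\<^sub>R e i) = (\<Sum>i=1..r. (1 / real r) *\<^sub>R e i)"
        using fst y' by simp
      then have "(\<Sum>i=1..r. (\<Sum>j=1..s. w (i, j)) *\<^sub>R e i) \<bullet> e k = (\<Sum>i=1..r. (1 / real r) *\<^sub>R e i) \<bullet> e k"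
        by simp
      then show ?thesis unfolding inner_sum_enumerated_basis[OF e that] .
    qed
    then have "w \<in> weights \<sigma>" using u(1) by (intro weightsI) (auto simp: w_def)
    ultimately show "y \<in> point ` weights \<sigma>" by blast
  next
    fix y assume "y \<in> point ` weights \<sigma>"
    then obtain w where w: "w \<in> weights \<sigma>" "y = point w" by blast
    have "(\<Sum>x\<in>\<sigma>. w x *\<^sub>R vertex x) =
        (\<Sum>i=1..r. (\<Sum>j=1..s. w (i, j)) *\<^sub>R e i, \<Sum>i=1..r. \<Sum>j=1..s. w (i, j) *\<^sub>R f j)"
      by (rule sum_vertex[OF \<sigma>]) (rule weights_off[OF w(1)])
    also have "\<dots> = y" using weights_row[OF w(1)] by (simp add: point_def w(2))
    finally have "y = (\<Sum>x\<in>\<sigma>. w x *\<^sub>R vertex x)" by simp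
    moreover have "(\<Sum>x\<in>\<sigma>. w x *\<^sub>R vertex x) \<in> convex hull (vertex ` \<sigma>)"
      by (rule convex_sum[OF fin convex_convex_hull sum_weights[OF w(1) \<sigma>]])
        (use weights_nonneg[OF w(1)] in \<open>auto intro: hull_inc\<close>)
    moreover have "y \<in> barycentre_plane e r" using w(2) by (simp add: point_def barycentre_plane_def)
    ultimately show "y \<in> cell \<sigma>" by (simp add: cell_def)
  qed
qed

text \<open>The north-west corner rule: a weight supported on a chain is determined by its row and
  column sums, as its mass in \<open>{1..i} \<times> {1..j}\<close> is the smaller one of the masses of the first \<open>i\<close>
  rows and of the first \<open>j\<close> columns.\<close>

lemma corner_mass:
  assumes g: "grid_chain r s \<sigma>" and w: "w \<in> weights \<sigma>" and ij: "i \<le> r" "j \<le> s"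
  shows "sum w ({1..i} \<times> {1..j}) = min (sum w ({1..i} \<times> {1..s})) (sum w ({1..r} \<times> {1..j}))"
proof -
  have \<sigma>: "\<sigma> \<subseteq> {1..r} \<times> {1..s}" and ch: "\<forall>x\<in>\<sigma>. \<forall>y\<in>\<sigma>. fst x < fst y \<longrightarrow> snd x \<le> snd y"
    using g by (auto simp: grid_chain_def)
  have nonneg: "0 \<le> w x" and off: "x \<notin> \<sigma> \<Longrightarrow> w x = 0" for x using w weights_nonneg weights_off by blast+
  have le: "sum w ({1..i} \<times> {1..j}) \<le> sum w ({1..i} \<times> {1..s})"
    "sum w ({1..i} \<times> {1..j}) \<le> sum w ({1..r} \<times> {1..j})"
    by (rule sum_mono2; use ij nonneg in auto)+
  \<comment> \<open>A point of the first \<open>i\<close> rows beyond column \<open>j\<close> and a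
    point of the first \<open>j\<close> columns beyond row \<open>i\<close> are incomparable. So one
    of the two strips has its whole mass in the corner.\<close>
  have "(\<forall>x\<in>\<sigma>. fst x \<le> i \<longrightarrow> snd x \<le> j) \<or> (\<forall>x\<in>\<sigma>. snd x \<le> j \<longrightarrow> fst x \<le> i)"
    using ch by (meson le_less_trans not_le)
  then show ?thesis
  proof
    assume *: "\<forall>x\<in>\<sigma>. fst x \<le> i \<longrightarrow> snd x \<le> j"
    have "sum w ({1..i} \<times> {1..j}) = sum w ({1..i} \<times> {1..s})"
    proof (rule sum.mono_neutral_left)
      show "\<forall>x\<in>{1..i} \<times> {1..s} - {1..i} \<times> {1..j}. w x = 0"
      proof
        fix x assume x: "x \<in> {1..i} \<times> {1..s} - {1..i} \<times> {1..j}"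
        then have "x \<notin> \<sigma>" using * by (auto simp: mem_Times_iff)
        then show "w x = 0" by (rule off)
      qed
    qed (use ij in auto)
    then show ?thesis using le by simp
  next
    assume *: "\<forall>x\<in>\<sigma>. snd x \<le> j \<longrightarrow> fst x \<le> i"
    have "sum w ({1..i} \<times> {1..j}) = sum w ({1..r} \<times> {1..j})"
    proof (rule sum.mono_neutral_left)
      show "\<forall>x\<in>{1..r} \<times> {1..j} - {1..i} \<times> {1..j}. w x = 0"
      proof
        fix x assume x: "x \<in> {1..r} \<times> {1..j} - {1..i} \<times> {1..j}"
        then have "x \<notin> \<sigma>" using * by (auto simp: mem_Times_iff)
        then show "w x = 0" by (rule off)
      qed
    qed (use ij in auto)
    then show ?thesis using le by simp
  qed
qed

text \<open>Row sums are prescribed and column sums are the coordinates of the point, so all corner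
  masses agree. As the chains may differ, the point also determines the support of its
  weight.\<close>

lemma weights_unique:
  assumes \<sigma>: "grid_chain r s \<sigma>" and w: "w \<in> weights \<sigma>"
    and \<tau>: "grid_chain r s \<tau>" and w': "w' \<in> weights \<tau>" and eq: "point w = point w'"
  shows "w = w'"
proof
  have row: "sum u ({1..i} \<times> {1..s}) = (\<Sum>i=1..i. 1 / real r)" if "u \<in> weights \<rho>" "i \<le> r" for u \<rho> i
  proof -
    have "sum u ({1..i} \<times> {1..s}) = (\<Sum>i=1..i. \<Sum>j=1..s. u (i, j))"
      by (simp add: sum.cartesian_product split_def)
    also have "\<dots> = (\<Sum>i=1..i. 1 / real r)" using weights_row[OF that(1)] that(2) by (intro sum.cong) auto
    finally show ?thesis .
  qed
  have col: "sum u ({1..r} \<times> {1..j}) = (\<Sum>l=1..j. snd (point u) \<bullet> f l)" if "j \<le> s" for u j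
  proof -
    have "snd (point u) = (\<Sum>j=1..s. (\<Sum>i=1..r. u (i, j)) *\<^sub>R f j)"
      unfolding point_def snd_conv scaleR_sum_left by (rule sum.swap)
    then have "snd (point u) \<bullet> f l = (\<Sum>i=1..r. u (i, l))" if "l \<in> {1..s}" for l
      using inner_sum_enumerated_basis[OF f that] by simp
    then have "(\<Sum>l=1..j. snd (point u) \<bullet> f l) = (\<Sum>l=1..j. \<Sum>i=1..r. u (i, l))"
      using that by (intro sum.cong) auto
    also have "\<dots> = (\<Sum>i=1..r. \<Sum>l=1..j. u (i, l))" by (rule sum.swap)
    also have "\<dots> = sum u ({1..r} \<times> {1..j})" by (simp add: sum.cartesian_product split_def)
    finally show ?thesis by simp
  qed
  have corner: "(\<Sum>k=1..i. \<Sum>l=1..j. w (k, l)) = (\<Sum>k=1..i. \<Sum>l=1..j. w' (k, l))"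
    if "i \<le> r" "j \<le> s" for i j
  proof -
    have "sum w ({1..i} \<times> {1..j}) = sum w' ({1..i} \<times> {1..j})"
      unfolding corner_mass[OF \<sigma> w that] corner_mass[OF \<tau> w' that]
        row[OF w that(1)] row[OF w' that(1)] col[OF that(2)] eq ..
    then show ?thesis by (simp add: sum.cartesian_product split_def)
  qed
  fix x
  show "w x = w' x"
  proof (cases "x \<in> {1..r} \<times> {1..s}")
    case True
    then obtain a b where x: "x = (Suc a, Suc b)" "Suc a \<le> r" "Suc b \<le> s"
      by (cases x) (auto simp: Suc_le_eq elim!: less_natE dest!: Suc_le_D)
    then have "a \<le> r" "b \<le> s" by auto
    \<comment> \<open>Inclusion-exclusion recovers a single weight from four corner masses; writing
      the indices as successors allows empty corners.\<close>
    have expand: "u (Suc a, Suc b) = (\<Sum>k=1..Suc a. \<Sum>l=1..Suc b. u (k, l))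
        - (\<Sum>k=1..a. \<Sum>l=1..Suc b. u (k, l)) - (\<Sum>k=1..Suc a. \<Sum>l=1..b. u (k, l))
        + (\<Sum>k=1..a. \<Sum>l=1..b. u (k, l))" for u :: "nat \<times> nat \<Rightarrow> real"
      by simp
    show ?thesis
      unfolding x(1) expand[of w] expand[of w']
      using x(2,3) \<open>a \<le> r\<close> \<open>b \<le> s\<close> by (simp only: corner)
  next
    case False
    then have "x \<notin> \<sigma>" "x \<notin> \<tau>" using \<sigma> \<tau> by (auto simp: grid_chain_def)
    then show ?thesis using weights_off[OF w] weights_off[OF w'] by simp
  qed
qed

lemma weights_rows:
  assumes "w \<in> weights \<sigma>" "i \<in> {1..r}"
  shows "\<exists>j. w (i, j) \<noteq> 0"
proof (rule ccontr)
  assume "\<not> ?thesis"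
  then have "(\<Sum>j=1..s. w (i, j)) = 0" by simp
  then show False using weights_row[OF assms] r by simp
qed

lemma support_staircase:
  assumes g: "grid_chain r s \<sigma>" and w: "w \<in> weights \<sigma>"
  shows "{x. w x \<noteq> 0} \<in> staircases r s" "{x. w x \<noteq> 0} \<subseteq> \<sigma>" "w \<in> weights {x. w x \<noteq> 0}"
proof -
  show sub: "{x. w x \<noteq> 0} \<subseteq> \<sigma>" using weights_off[OF w] by blast
  have "{1..r} \<subseteq> fst ` {x. w x \<noteq> 0}"
  proof
    fix i assume "i \<in> {1..r}"
    then obtain j where "w (i, j) \<noteq> 0" using weights_rows[OF w] by blast
    then show "i \<in> fst ` {x. w x \<noteq> 0}" by force
  qed
  then show "{x. w x \<noteq> 0} \<in> staircases r s"
    using grid_chain_subset[OF g sub] by (simp add: staircases_def)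
  show "w \<in> weights {x. w x \<noteq> 0}"
    using weights_nonneg[OF w] weights_row[OF w] by (intro weightsI) auto
qed

lemma full_support:
  assumes \<sigma>: "\<sigma> \<in> staircases r s"
  obtains w where "w \<in> weights \<sigma>" "{x. w x \<noteq> 0} = \<sigma>"
proof -
  have sub: "\<sigma> \<subseteq> {1..r} \<times> {1..s}" using \<sigma> by (simp add: staircases_def grid_chain_def)
  define c where "c i = card {j \<in> {1..s}. (i, j) \<in> \<sigma>}" for i
  have c: "0 < c i" if i: "i \<in> {1..r}" for i
  proof -
    obtain j where j: "(i, j) \<in> \<sigma>" using staircases_row[OF \<sigma> i] .
    then have "j \<in> {j \<in> {1..s}. (i, j) \<in> \<sigma>}" using sub by auto
    then have "{j \<in> {1..s}. (i, j) \<in> \<sigma>} \<noteq> {}" by blast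
    then show ?thesis by (simp add: c_def card_gt_0_iff)
  qed
  \<comment> \<open>Each row spreads its mass \<open>1 / r\<close> evenly over its points, so every
    point of the chain gets positive weight.\<close>
  define w where "w x = (if x \<in> \<sigma> then 1 / (real r * real (c (fst x))) else 0)" for x
  have "(\<Sum>j=1..s. w (i, j)) = 1 / real r" if i: "i \<in> {1..r}" for i
  proof -
    have "(\<Sum>j=1..s. w (i, j)) = (\<Sum>j\<in>{j \<in> {1..s}. (i, j) \<in> \<sigma>}. 1 / (real r * real (c i)))"
      unfolding w_def fst_conv by (rule sum.inter_filter[symmetric]) simp
    also have "\<dots> = real (c i) * (1 / (real r * real (c i)))" by (simp add: c_def)
    also have "\<dots> = 1 / real r" using c[OF i] by simp
    finally show ?thesis .
  qed
  then have "w \<in> weights \<sigma>" by (intro weightsI) (auto simp: w_def)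
  moreover have "w x \<noteq> 0 \<longleftrightarrow> x \<in> \<sigma>" for x
  proof -
    have "fst x \<in> {1..r}" if "x \<in> \<sigma>" using sub that by auto
    then show ?thesis using c[of "fst x"] r by (auto simp: w_def)
  qed
  then have "{x. w x \<noteq> 0} = \<sigma>" by blast
  ultimately show thesis using that by blast
qed

text \<open>A point of full support in the first cell has only one weight, so if it lies in the
  second cell, its support lies in the second chain.\<close>

lemma cell_mono:
  assumes \<sigma>: "\<sigma> \<in> staircases r s" and \<tau>: "\<tau> \<in> staircases r s"
  shows "\<sigma> \<subseteq> \<tau> \<longleftrightarrow> cell \<sigma> \<subseteq> cell \<tau>"
proof
  have g: "grid_chain r s \<sigma>" "grid_chain r s \<tau>" using \<sigma> \<tau> by (auto simp: staircases_def)
  show "cell \<sigma> \<subseteq> cell \<tau>" if "\<sigma> \<subseteq> \<tau>"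
    unfolding cell_eq[OF g(1)] cell_eq[OF g(2)] using weights_mono[OF that] by (rule image_mono)
  assume sub: "cell \<sigma> \<subseteq> cell \<tau>"
  obtain w where w: "w \<in> weights \<sigma>" "{x. w x \<noteq> 0} = \<sigma>" by (rule full_support[OF \<sigma>])
  then have "point w \<in> cell \<tau>" using sub unfolding cell_eq[OF g(1)] by blast
  then obtain w' where w': "w' \<in> weights \<tau>" "point w = point w'" unfolding cell_eq[OF g(2)] by blast
  have "w = w'" by (rule weights_unique[OF g(1) w(1) g(2) w'])
  then show "\<sigma> \<subseteq> \<tau>" using w(2) support_staircase(2)[OF g(2) w'(1)] by simp
qed

text \<open>Each row must carry the mass \<open>1 / r\<close>, so exactly the chains that meet every
  row have a non-empty section.\<close>

lemma staircase_complex_eq: "staircase_complex e f r s = cell ` staircases r s"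
proof -
  have 1: "staircase_complex e f r s = {cell \<sigma> | \<sigma>. grid_chain r s \<sigma> \<and> cell \<sigma> \<noteq> {}}"
    unfolding staircase_complex_def staircase_triangulation_def partial_lattice_paths_eq[OF r s]
      cell_def vertex_def by blast
  have "cell \<sigma> \<noteq> {} \<longleftrightarrow> \<sigma> \<in> staircases r s" if g: "grid_chain r s \<sigma>" for \<sigma>
  proof
    assume "cell \<sigma> \<noteq> {}"
    then obtain w where w: "w \<in> weights \<sigma>" unfolding cell_eq[OF g] by blast
    have "{1..r} \<subseteq> fst ` {x. w x \<noteq> 0}" using support_staircase(1)[OF g w] by (simp add: staircases_def)
    also have "\<dots> \<subseteq> fst ` \<sigma>" using support_staircase(2)[OF g w] by (rule image_mono)
    finally show "\<sigma> \<in> staircases r s" using g by (simp add: staircases_def)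
  next
    assume "\<sigma> \<in> staircases r s"
    then obtain w where "w \<in> weights \<sigma>" by (rule full_support)
    then show "cell \<sigma> \<noteq> {}" unfolding cell_eq[OF g] by blast
  qed
  moreover have "grid_chain r s \<sigma>" if "\<sigma> \<in> staircases r s" for \<sigma>
    using that by (simp add: staircases_def)
  ultimately show ?thesis unfolding 1 by blast
qed

lemma complex_iso_staircase_complex: "complex_iso (staircases r s) (staircase_complex e f r s)"
proof -
  have "inj_on cell (staircases r s)"
  proof (rule inj_onI)
    fix \<sigma> \<tau> assume "\<sigma> \<in> staircases r s" "\<tau> \<in> staircases r s" "cell \<sigma> = cell \<tau>"
    then show "\<sigma> = \<tau>" using cell_mono by (metis order_refl subset_antisym)
  qed
  then have "bij_betw cell (staircases r s) (staircase_complex e f r s)"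
    by (simp add: bij_betw_def staircase_complex_eq)
  then show ?thesis unfolding complex_iso_def using cell_mono by blast
qed

lemma staircase_complex_cell:
  assumes "G \<in> staircase_complex e f r s"
  shows "compact G \<and> convex G \<and> G \<noteq> {}"
proof -
  obtain \<sigma> where \<sigma>: "\<sigma> \<in> staircases r s" "G = cell \<sigma>" using assms by (auto simp: staircase_complex_eq)
  have fin: "finite (vertex ` \<sigma>)" using \<sigma>(1) grid_chain_finite by (auto simp: staircases_def)
  have "compact G" unfolding \<sigma>(2) cell_def barycentre_plane_def
    using compact_convex_hull[OF finite_imp_compact[OF fin]]
    by (intro compact_Int_closed closed_Times) auto
  moreover have "convex G" unfolding \<sigma>(2) cell_def barycentre_plane_def
    by (intro convex_Int convex_Times) auto
  moreover have "G \<noteq> {}" using assms by (auto simp: staircase_complex_def)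
  ultimately show ?thesis by blast
qed

section \<open>Vertices of the cells of the section\<close>

lemma point_convex_combination:
  "point (\<lambda>x. (1 - u) * v x + u * w x) = (1 - u) *\<^sub>R point v + u *\<^sub>R point w"
proof -
  have "(1 - u) *\<^sub>R z + u *\<^sub>R z = z" for z :: 'a by (simp flip: scaleR_add_left)
  moreover have "(\<Sum>i=1..r. \<Sum>j=1..s. ((1 - u) * v (i, j) + u * w (i, j)) *\<^sub>R f j) =
      (1 - u) *\<^sub>R (\<Sum>i=1..r. \<Sum>j=1..s. v (i, j) *\<^sub>R f j) + u *\<^sub>R (\<Sum>i=1..r. \<Sum>j=1..s. w (i, j) *\<^sub>R f j)"
    by (simp add: scaleR_add_left sum.distrib scaleR_sum_right)
  ultimately show ?thesis unfolding point_def scaleR_Pair add_Pair by simp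
qed

lemma weights_convex_combination:
  assumes "v \<in> weights \<sigma>" "w \<in> weights \<sigma>" "0 \<le> u" "u \<le> 1"
  shows "(\<lambda>x. (1 - u) * v x + u * w x) \<in> weights \<sigma>"
proof (rule weightsI)
  fix i assume "i \<in> {1..r}"
  then have "(\<Sum>j=1..s. (1 - u) * v (i, j) + u * w (i, j)) = (1 - u) * (1 / real r) + u * (1 / real r)"
    using weights_row[OF assms(1)] weights_row[OF assms(2)]
    by (simp add: sum.distrib flip: sum_distrib_left)
  also have "\<dots> = 1 / real r" unfolding distrib_right[symmetric] by simp
  finally show "(\<Sum>j=1..s. (1 - u) * v (i, j) + u * w (i, j)) = 1 / real r" .
qed (use assms weights_nonneg[OF assms(1)] weights_nonneg[OF assms(2)]
    weights_off[OF assms(1)] weights_off[OF assms(2)] in auto)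

lemma weights_minimal:
  assumes \<tau>: "\<tau> \<in> staircases r s" and inj: "inj_on fst \<tau>"
    and v: "v \<in> weights \<tau>" and w: "w \<in> weights \<tau>"
  shows "v = w"
proof -
  have sub: "\<tau> \<subseteq> {1..r} \<times> {1..s}" using \<tau> by (simp add: staircases_def grid_chain_def)
  have val: "u (i, j) = 1 / real r" if u: "u \<in> weights \<tau>" and ij: "(i, j) \<in> \<tau>" for u i j
  proof -
    have "u (i, l) = 0" if "l \<noteq> j" for l
    proof -
      have "(i, l) \<notin> \<tau>" using inj_onD[OF inj, of "(i, j)" "(i, l)"] ij that by auto
      then show ?thesis by (rule weights_off[OF u])
    qed
    then have "(\<Sum>l=1..s. u (i, l)) = (\<Sum>l\<in>{j}. u (i, l))"
      using ij sub by (intro sum.mono_neutral_right) auto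
    moreover have "i \<in> {1..r}" using ij sub by auto
    ultimately show ?thesis using weights_row[OF u] by simp
  qed
  show ?thesis
  proof
    fix x show "v x = w x"
      using val[OF v, of "fst x" "snd x"] val[OF w, of "fst x" "snd x"]
        weights_off[OF v] weights_off[OF w]
      by (cases "x \<in> \<tau>") auto
  qed
qed

text \<open>Between two support points of one row, the mass \<open>\<epsilon>\<close> can be shifted
  either way without changing row sums. By \<open>weights_unique\<close> the two results are
  distinct points, with the given one as their midpoint.\<close>

lemma extreme_weights:
  assumes g: "grid_chain r s \<sigma>" and w: "w \<in> weights \<sigma>"
    and ext: "point w extreme_point_of cell \<sigma>"
  shows "inj_on fst {x. w x \<noteq> 0}"
proof (rule inj_onI, rule ccontr)
  fix x y assume xy: "x \<in> {x. w x \<noteq> 0}" "y \<in> {x. w x \<noteq> 0}" "fst x = fst y" "x \<noteq> y"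
  define \<epsilon> where "\<epsilon> = min (w x) (w y)"
  have nonneg: "0 \<le> w z" for z using w by (rule weights_nonneg)
  have \<epsilon>: "0 < \<epsilon>" using nonneg[of x] nonneg[of y] xy(1,2) by (simp add: \<epsilon>_def)
  define \<delta> :: "nat \<times> nat \<Rightarrow> real" where "\<delta> z = (if z = x then 1 else 0) - (if z = y then 1 else 0)" for z
  have xy\<sigma>: "x \<in> \<sigma>" "y \<in> \<sigma>" using support_staircase(2)[OF g w] xy by auto
  then have box: "snd x \<in> {1..s}" "snd y \<in> {1..s}" using g by (auto simp: grid_chain_def)
  have row\<delta>: "(\<Sum>j=1..s. \<delta> (i, j)) = 0" for i
  proof -
    have "(\<Sum>j=1..s. if (i, j) = z then 1 else 0) = (if i = fst z then 1 else (0::real))"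
      if "snd z \<in> {1..s}" for z
    proof -
      have "(\<Sum>j=1..s. if (i, j) = z then 1 else 0) =
          (\<Sum>j=1..s. if j = snd z then (if i = fst z then 1 else 0) else (0::real))"
        by (rule sum.cong) (auto simp: prod_eq_iff)
      then show ?thesis using that by simp
    qed
    then show ?thesis using box xy(3) by (simp add: \<delta>_def sum_subtractf)
  qed
  have mem: "(\<lambda>z. w z + c * \<delta> z) \<in> weights \<sigma>" if c: "\<bar>c\<bar> = \<epsilon>" for c
  proof (rule weightsI)
    fix z
    have "\<bar>c\<bar> \<le> w x" "\<bar>c\<bar> \<le> w y" using c by (auto simp: \<epsilon>_def)
    then show "0 \<le> w z + c * \<delta> z" using nonneg[of z] xy(4) by (auto simp: \<delta>_def)
  next
    fix z assume "z \<notin> \<sigma>"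
    then show "w z + c * \<delta> z = 0" using weights_off[OF w] xy\<sigma> by (auto simp: \<delta>_def)
  next
    fix i assume "i \<in> {1..r}"
    then show "(\<Sum>j=1..s. w (i, j) + c * \<delta> (i, j)) = 1 / real r"
      using weights_row[OF w] row\<delta>[of i] by (simp add: sum.distrib flip: sum_distrib_left)
  qed
  let ?v = "\<lambda>z. w z + \<epsilon> * \<delta> z" and ?v' = "\<lambda>z. w z + (- \<epsilon>) * \<delta> z"
  have v: "?v \<in> weights \<sigma>" "?v' \<in> weights \<sigma>" using mem[of \<epsilon>] mem[of "- \<epsilon>"] \<epsilon> by auto
  have "point ?v \<noteq> point ?v'"
  proof
    assume "point ?v = point ?v'"
    then have "?v = ?v'" by (rule weights_unique[OF g v(1) g v(2)])
    then have "?v x = ?v' x" by (rule fun_cong)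
    then show False using \<epsilon> xy(4) by (simp add: \<delta>_def)
  qed
  moreover have "point w = (1 - 1/2) *\<^sub>R point ?v + (1/2) *\<^sub>R point ?v'"
  proof -
    have "w = (\<lambda>z. (1 - 1/2) * ?v z + (1/2) * ?v' z)" by (simp add: field_simps)
    then show ?thesis using point_convex_combination[of "1/2" ?v ?v'] by metis
  qed
  ultimately have "point w \<in> open_segment (point ?v) (point ?v')"
    unfolding in_segment by (intro conjI exI[of _ "1/2"]) auto
  moreover have "point ?v \<in> cell \<sigma>" "point ?v' \<in> cell \<sigma>" using v unfolding cell_eq[OF g] by blast+
  ultimately show False using ext unfolding extreme_point_of_def by blast
qed

text \<open>The support of an extreme point is a transversal of the rows, whose cell is a single
  point. Conversely, if \<open>y\<close> is the cell of a smaller chain and an inner point of a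
  segment in \<open>G\<close>, the weights of both ends vanish off that chain, as they are
  non-negative, so both ends equal \<open>y\<close>.\<close>

lemma extreme_point_of_staircase_complex:
  assumes G: "G \<in> staircase_complex e f r s"
  shows "y extreme_point_of G \<longleftrightarrow> y \<in> G \<and> {y} \<in> staircase_complex e f r s"
proof -
  obtain \<sigma> where \<sigma>: "\<sigma> \<in> staircases r s" "G = cell \<sigma>" using G by (auto simp: staircase_complex_eq)
  have g: "grid_chain r s \<sigma>" using \<sigma>(1) by (simp add: staircases_def)
  show ?thesis
  proof
    assume ext: "y extreme_point_of G"
    then have "y \<in> cell \<sigma>" by (simp add: extreme_point_of_def \<sigma>(2))
    then obtain w where w: "w \<in> weights \<sigma>" "y = point w" unfolding cell_eq[OF g] by blast
    let ?\<tau> = "{x. w x \<noteq> 0}"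
    have \<tau>: "?\<tau> \<in> staircases r s" "w \<in> weights ?\<tau>" using support_staircase[OF g w(1)] by auto
    have inj: "inj_on fst ?\<tau>" using extreme_weights[OF g w(1)] ext w(2) \<sigma>(2) by simp
    have "weights ?\<tau> = {w}" using weights_minimal[OF \<tau>(1) inj _ \<tau>(2)] \<tau>(2) by blast
    moreover have "grid_chain r s ?\<tau>" using \<tau>(1) by (simp add: staircases_def)
    ultimately have "cell ?\<tau> = {y}" by (simp add: cell_eq w(2))
    then have "{y} \<in> staircase_complex e f r s" using \<tau>(1) unfolding staircase_complex_eq by blast
    then show "y \<in> G \<and> {y} \<in> staircase_complex e f r s" using ext by (simp add: extreme_point_of_def)
  next
    assume y: "y \<in> G \<and> {y} \<in> staircase_complex e f r s"
    then obtain \<tau> where \<tau>: "\<tau> \<in> staircases r s" "cell \<tau> = {y}" by (auto simp: staircase_complex_eq)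
    have g\<tau>: "grid_chain r s \<tau>" using \<tau>(1) by (simp add: staircases_def)
    have "\<tau> \<subseteq> \<sigma>" using cell_mono[OF \<tau>(1) \<sigma>(1)] \<tau>(2) y \<sigma>(2) by simp
    obtain w where w: "w \<in> weights \<tau>" "y = point w" using \<tau>(2) unfolding cell_eq[OF g\<tau>] by blast
    have "y \<notin> open_segment a c" if ac: "a \<in> G" "c \<in> G" for a c
    proof
      assume seg: "y \<in> open_segment a c"
      obtain u where u: "a \<noteq> c" "0 < u" "u < 1" "y = (1 - u) *\<^sub>R a + u *\<^sub>R c"
        using seg by (auto simp: in_segment)
      obtain v v' where v: "v \<in> weights \<sigma>" "a = point v" "v' \<in> weights \<sigma>" "c = point v'"
        using ac unfolding \<sigma>(2) cell_eq[OF g] by blast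
      have "(\<lambda>x. (1 - u) * v x + u * v' x) \<in> weights \<sigma>"
        using v u by (intro weights_convex_combination) auto
      moreover have "point (\<lambda>x. (1 - u) * v x + u * v' x) = point w"
        using u(4) v w(2) by (simp add: point_convex_combination)
      ultimately have eq: "(\<lambda>x. (1 - u) * v x + u * v' x) = w"
        using weights_unique[OF g _ g\<tau> w(1)] by blast
      have "v x = 0 \<and> v' x = 0" if "x \<notin> \<tau>" for x
      proof -
        have "(1 - u) * v x + u * v' x = 0" using fun_cong[OF eq, of x] weights_off[OF w(1) that] by simp
        moreover have "0 \<le> v x" "0 \<le> v' x" using v weights_nonneg by blast+
        then have "0 \<le> (1 - u) * v x" "0 \<le> u * v' x" using u by simp_all
        ultimately show ?thesis using u by (simp add: add_nonneg_eq_0_iff)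
      qed
      then have "v \<in> weights \<tau>" "v' \<in> weights \<tau>"
        using weights_nonneg weights_row v(1,3) by (auto intro!: weightsI)
      then have "a \<in> cell \<tau>" "c \<in> cell \<tau>" using v(2,4) unfolding cell_eq[OF g\<tau>] by blast+
      then show False using \<tau>(2) u(1) by simp
    qed
    then show "y extreme_point_of G" using y by (simp add: extreme_point_of_def)
  qed
qed

end

theorem theorem5p5:
  fixes r s d n :: nat
    and e :: "nat \<Rightarrow> 'a::euclidean_space"
    and f :: "nat \<Rightarrow> 'b::euclidean_space"
    and b :: "nat \<Rightarrow> 'c::euclidean_space"
    and t :: "nat \<Rightarrow> real"
    and p :: 'c
  assumes "r \<ge> 1" and "s \<ge> 1"
    and "d = 2 * s - 2" and "n = r + d"
    and "bij_betw e {1..r} Basis"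
    and "bij_betw f {1..s} Basis"
    and "inj_on b {1..d}" and "b ` {1..d} \<subseteq> Basis"
    and "strict_mono_on {1..n} t"
    and "p \<in> rel_interior (cyclic_polytope b d n t)"
  shows "complex_iso (staircase_complex e f r s) (lower_complex b d n t p)
    \<and> (\<forall>G \<in> lower_complex b d n t p. real_of_int (aff_dim G) \<le> real d / 2)
    \<and> graph_iso (one_skeleton (staircase_complex e f r s)) (composition_graph r s)
    \<and> graph_iso (one_skeleton (lower_complex b d n t p)) (composition_graph r s)"
proof -
  interpret P: staircase_polar b r d n t p s
    by unfold_locales (use assms in \<open>auto simp: diff_mult_distrib2\<close>)
  interpret S: staircase_section e f r s
    by unfold_locales (use assms in auto)
  have "complex_iso (staircase_complex e f r s) (lower_complex b d n t p)"
    using complex_iso_trans[OF complex_iso_sym[OF S.complex_iso_staircase_complex]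
        P.complex_iso_lower_complex] .
  moreover have "graph_iso (one_skeleton (staircase_complex e f r s)) (composition_graph r s)"
    by (rule graph_iso_trans[OF graph_iso_one_skeleton graph_iso_composition_graph])
      (rule S.complex_iso_staircase_complex S.staircase_complex_cell
        S.extreme_point_of_staircase_complex; assumption?)+
  moreover have "graph_iso (one_skeleton (lower_complex b d n t p)) (composition_graph r s)"
    by (rule graph_iso_trans[OF graph_iso_one_skeleton graph_iso_composition_graph])
      (rule P.complex_iso_lower_complex P.lower_complex_cell
        P.extreme_point_of_lower_complex; assumption?)+
  ultimately show ?thesis using P.aff_dim_lower_complex by blast
qed

end
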